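(* Let $A,B$ be two nonempty open subsets of $\mathbb{R}^d$ with characteristic sets $D_k$, $k\in K$. There exists a nontrivial bounded linear translation-invariant operator on $L^2(\mathbb{R}^d)$ that satisfies the Bedrosian identity with respect to $(A,B)$ if and only if there exist constants $c_k\in\mathbb{C}$, $k\in K$, with $c_k=c_{k'}$ whenever $D_k\cap D_{k'}\neq\emptyset$, such that for every $k\in K$ the set complement in $\mathbb{R}^d$ of $\bigcup\{D_{k'}:k'\in K,\ c_{k'}=c_k\}$ has positive Lebesgue measure.
   Context: Functions are complex-valued. The Fourier transform is $\hat f(\xi)=(2\pi)^{-d/2}\int_{\mathbb{R}^d}f(x)e^{-ix\cdot\xi}\,dx$ for $f\in L^1(\mathbb{R}^d)$, extended to $L^2(\mathbb{R}^d)$ in the usual way. Lebesgue measure is denoted $|\cdot|$. An operator $T$ on $L^2(\mathbb{R}^d)$ is translation-invariant if $T(\tau_xf)=\tau_x(Tf)$ for all $x\in\mathbb{R}^d$, $f\in L^2(\mathbb{R}^d)$, where $\tau_xf:=f(\cdot-x)$. A bounded linear operator $T$ on $L^2(\mathbb{R}^d)$ is translation-invariant if and only if there is $m\in L^\infty(\mathbb{R}^d)$ (the Fourier multiplier of $T$) with $(Tf)\hat{\,}=m\hat f$ for all $f\in L^2(\mathbb{R}^d)$. Nontrivial means that $T$ is not a constant multiple of the identity operator (equivalently, its Fourier multiplier is not almost everywhere equal to a constant). Support: for a Lebesgue measurable function $\varphi$ on $\mathbb{R}^d$, $\operatorname{supp}\varphi$ is the set of all $x_0\in\mathbb{R}^d$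 such that $|U\cap\{x:\varphi(x)\neq0\}|>0$ for every open neighborhood $U$ of $x_0$. Bedrosian identity: a bounded linear operator $T:L^2(\mathbb{R}^d)\to L^2(\mathbb{R}^d)$ satisfies the Bedrosian identity with respect to a pair $(A,B)$ of Lebesgue measurable sets $A,B\subseteq\mathbb{R}^d$ if $T(fg)=f\,(Tg)$ holds for all $f,g\in L^2(\mathbb{R}^d)\cap L^\infty(\mathbb{R}^d)$ with $\operatorname{supp}\hat f\subseteq A$ and $\operatorname{supp}\hat g\subseteq B$. Characteristic sets: for nonempty open $A,B\subseteq\mathbb{R}^d$, decompose $A$, $B$ and $A+B=\{a+b:a\in A,\ b\in B\}$ into their connected components, $A=\bigcup_{i\in I}A_i$, $B=\bigcup_{j\in J}B_j$, $A+B=\bigcup_{k\in K}C_k$. For each $k\in K$ put $J_k:=\{j\in J: A_i+B_j\subseteq C_k\text{ for some } i\in I\}$ and $D_k:=C_k\cup\bigcup_{j\in J_k}B_j$. The sets $D_k$, $k\in K$, are the characteristic sets of $(A,B)$. *)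

theory Defs
  imports "HOL-Analysis.Analysis" "HOL-Library.Set_Algebras"
begin

text \<open>
  Elements of L^2(R^d) are represented by square integrable functions; equality in L^2 is equality
  almost everywhere with respect to Lebesgue measure.  An operator on L^2(R^d) is represented by a
  map on functions, of which only the values on square integrable functions matter, and these only
  up to null sets.
\<close>

definition L1_space :: "(real ^ 'n \<Rightarrow> complex) set" where
  "L1_space = {f. integrable lebesgue f}"

definition L2_space :: "(real ^ 'n \<Rightarrow> complex) set" where
  "L2_space = {f. f \<in> borel_measurable lebesgue \<and> integrable lebesgue (\<lambda>x. (cmod (f x))\<^sup>2)}"

definition Linf_space :: "(real ^ 'n \<Rightarrow> complex) set" where
  "Linf_space = {f. f \<in> borel_measurable lebesgue \<and> (\<exists>C. AE x in lebesgue. cmod (f x) \<le> C)}"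

definition L2_norm :: "(real ^ 'n \<Rightarrow> complex) \<Rightarrow> real" where
  "L2_norm f = sqrt (LINT x|lebesgue. (cmod (f x))\<^sup>2)"

definition L2_tendsto ::
    "(nat \<Rightarrow> real ^ 'n \<Rightarrow> complex) \<Rightarrow> (real ^ 'n \<Rightarrow> complex) \<Rightarrow> bool" where
  "L2_tendsto u f \<longleftrightarrow> (\<forall>n. u n \<in> L2_space) \<and> f \<in> L2_space \<and>
     (\<lambda>n. L2_norm (\<lambda>x. u n x - f x)) \<longlonglongrightarrow> 0"

definition fourier_L1 :: "(real ^ 'n \<Rightarrow> complex) \<Rightarrow> real ^ 'n \<Rightarrow> complex" where
  "fourier_L1 f \<xi> = complex_of_real ((2 * pi) powr (- real CARD('n) / 2)) *
     (LINT x|lebesgue. f x * exp (- \<i> * complex_of_real (x \<bullet> \<xi>)))"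

text \<open>
  The Fourier transform on L^2 is the continuous extension of the integral transform from
  the intersection of L^1 and L^2.  By Plancherel's theorem a function \<open>F\<close> as below exists for
  every \<open>f\<close> in L^2 and is unique up to null sets; \<open>fourier_L2\<close> picks a representative.
\<close>

definition has_fourier_L2 :: "(real ^ 'n \<Rightarrow> complex) \<Rightarrow> (real ^ 'n \<Rightarrow> complex) \<Rightarrow> bool" where
  "has_fourier_L2 f F \<longleftrightarrow>
     (\<exists>u. (\<forall>n. u n \<in> L1_space) \<and> L2_tendsto u f \<and> L2_tendsto (\<lambda>n. fourier_L1 (u n)) F)"

definition fourier_L2 :: "(real ^ 'n \<Rightarrow> complex) \<Rightarrow> real ^ 'n \<Rightarrow> complex" where
  "fourier_L2 f = (SOME F. has_fourier_L2 f F)"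

definition ess_supp :: "(real ^ 'n \<Rightarrow> complex) \<Rightarrow> (real ^ 'n) set" where
  "ess_supp \<phi> =
     {x\<^sub>0. \<forall>U. open U \<and> x\<^sub>0 \<in> U \<longrightarrow> emeasure lebesgue (U \<inter> {x. \<phi> x \<noteq> 0}) > 0}"

text \<open>
  The second conjunct says that the operator is well defined on classes modulo null sets.
\<close>

definition bounded_linear_L2 ::
    "((real ^ 'n \<Rightarrow> complex) \<Rightarrow> real ^ 'n \<Rightarrow> complex) \<Rightarrow> bool" where
  "bounded_linear_L2 T \<longleftrightarrow>
     (\<forall>f\<in>L2_space. T f \<in> L2_space) \<and>
     (\<forall>f\<in>L2_space. \<forall>g\<in>L2_space.
        (AE x in lebesgue. f x = g x) \<longrightarrow> (AE x in lebesgue. T f x = T g x)) \<and>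
     (\<forall>f\<in>L2_space. \<forall>g\<in>L2_space. AE x in lebesgue. T (\<lambda>y. f y + g y) x = T f x + T g x) \<and>
     (\<forall>c. \<forall>f\<in>L2_space. AE x in lebesgue. T (\<lambda>y. c * f y) x = c * T f x) \<and>
     (\<exists>C. \<forall>f\<in>L2_space. L2_norm (T f) \<le> C * L2_norm f)"

definition translation_invariant_L2 ::
    "((real ^ 'n \<Rightarrow> complex) \<Rightarrow> real ^ 'n \<Rightarrow> complex) \<Rightarrow> bool" where
  "translation_invariant_L2 T \<longleftrightarrow>
     (\<forall>x. \<forall>f\<in>L2_space. AE y in lebesgue. T (\<lambda>z. f (z - x)) y = T f (y - x))"

definition nontrivial_L2 ::
    "((real ^ 'n \<Rightarrow> complex) \<Rightarrow> real ^ 'n \<Rightarrow> complex) \<Rightarrow> bool" where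
  "nontrivial_L2 T \<longleftrightarrow> \<not> (\<exists>c. \<forall>f\<in>L2_space. AE x in lebesgue. T f x = c * f x)"

definition bedrosian_identity ::
    "((real ^ 'n \<Rightarrow> complex) \<Rightarrow> real ^ 'n \<Rightarrow> complex) \<Rightarrow> (real ^ 'n) set \<Rightarrow> (real ^ 'n) set \<Rightarrow> bool"
  where
  "bedrosian_identity T A B \<longleftrightarrow>
     (\<forall>f \<in> L2_space \<inter> Linf_space. \<forall>g \<in> L2_space \<inter> Linf_space.
        ess_supp (fourier_L2 f) \<subseteq> A \<and> ess_supp (fourier_L2 g) \<subseteq> B \<longrightarrow>
        (AE x in lebesgue. T (\<lambda>y. f y * g y) x = f x * T g x))"

text \<open>
  The characteristic sets are indexed by the connected components \<open>C\<close> of the Minkowski sum.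
\<close>

definition characteristic_set ::
    "(real ^ 'n) set \<Rightarrow> (real ^ 'n) set \<Rightarrow> (real ^ 'n) set \<Rightarrow> (real ^ 'n) set" where
  "characteristic_set A B C =
     C \<union> \<Union>{B' \<in> components B. \<exists>A' \<in> components A. A' + B' \<subseteq> C}"

end

theory Submission
  imports Defs "HOL-Probability.Characteristic_Functions"
begin

text \<open>
  A bounded translation-invariant operator is multiplication by some \<open>m\<close> on the Fourier side, and
  the Fourier transform turns products into convolutions.  Testing the Bedrosian identity with
  functions whose transforms live near points \<open>a \<in> A\<close> and \<open>b \<in> B\<close> shows that \<open>m\<close> is almost
  everywhere equal to one and the same constant near \<open>a + b\<close> and near \<open>b\<close>.  By connectedness \<open>m\<close>
  is then constant on every characteristic set, and these constants do the job, as \<open>m\<close> is not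
  constant almost everywhere.  Conversely, given the constants, let \<open>E\<close> be the union of all
  characteristic sets carrying one fixed value.  Every characteristic set is contained in \<open>E\<close> or
  disjoint from it, so \<open>a + b \<in> E \<longleftrightarrow> b \<in> E\<close> for \<open>a \<in> A\<close> and \<open>b \<in> B\<close>, and the operator with
  multiplier \<open>indicator E\<close> satisfies the identity.

  Plancherel's theorem comes from Gaussian regularization: the integral of \<open>|f^|\<^sup>2 exp (-s\<^sup>2 |\<xi>|\<^sup>2 / 2)\<close> is
  a Gaussian average of the autocorrelation of \<open>f\<close>, which is continuous at \<open>0\<close>.
\<close>

section \<open>The space of square integrable functions\<close>

text \<open>The Bedrosian identity may be tested only with bounded functions, so test functions are
  built on the Fourier side: an \<open>F\<close> that is integrable, square integrable and zero off
  a closed subset of \<open>A\<close> is the transform of a bounded \<open>f\<close>. Boundedness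
  puts \<open>f g\<close> and \<open>f (T g)\<close> into L1 and L2 at once; their transforms are
  then plain integrals, and Parseval evaluates them as convolutions at every frequency.

  The multiplier is read off from one function. \<open>gaussian 1\<close> is its own Fourier
  transform and vanishes nowhere, so \<open>m\<close> can only be the transform of \<open>T\<close>
  applied to it, divided by it. That this quotient serves all functions rests on \<open>T\<close>
  commuting with convolutions, which are limits of finite combinations of translations. No bound on
  \<open>m\<close> is derived; square integrability of \<open>m\<close> on a ball, read off from a
  product \<open>m F\<close>, takes its place.

  Operators and transforms are determined only up to null sets. Hence the relation
  \<open>has_fourier_L2\<close> is used rather than a chosen transform, and identities between
  operators are checked on the transforms and pulled back by injectivity.\<close>

definition L2_inner :: "(real ^ 'n \<Rightarrow> complex) \<Rightarrow> (real ^ 'n \<Rightarrow> complex) \<Rightarrow> complex" where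
  "L2_inner f g = (LINT x|lebesgue. f x * cnj (g x))"

lemma L2_measurable [measurable_dest]: "f \<in> L2_space \<Longrightarrow> f \<in> borel_measurable lebesgue"
  by (simp add: L2_space_def)

lemma L2_integrable_sq: "f \<in> L2_space \<Longrightarrow> integrable lebesgue (\<lambda>x. (cmod (f x))\<^sup>2)"
  by (simp add: L2_space_def)

lemma L2_dominated:
  assumes "f \<in> borel_measurable lebesgue" "g \<in> L2_space" "AE x in lebesgue. cmod (f x) \<le> C * cmod (g x)"
  shows "f \<in> L2_space"
proof -
  have [measurable]: "f \<in> borel_measurable lebesgue" by fact
  have "integrable lebesgue (\<lambda>x. (cmod (f x))\<^sup>2)"
  proof (rule Bochner_Integration.integrable_bound)
    show "integrable lebesgue (\<lambda>x. C\<^sup>2 * (cmod (g x))\<^sup>2)"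
      using L2_integrable_sq[OF assms(2)] by simp
    show "(\<lambda>x. (cmod (f x))\<^sup>2) \<in> borel_measurable lebesgue" by measurable
    show "AE x in lebesgue. norm ((cmod (f x))\<^sup>2) \<le> norm (C\<^sup>2 * (cmod (g x))\<^sup>2)"
      using assms(3)
    proof eventually_elim
      case (elim x)
      then show ?case using power_mono[OF elim, of 2] by (simp add: power_mult_distrib)
    qed
  qed
  then show ?thesis using assms(1) by (simp add: L2_space_def)
qed

lemma borel_measurable_cnj [measurable (raw)]:
  "f \<in> borel_measurable M \<Longrightarrow> (\<lambda>x. cnj (f x)) \<in> borel_measurable M"
  by (rule borel_measurable_continuous_on[of cnj]) (auto intro: continuous_intros)

lemma L2_zero [simp]: "(\<lambda>x. 0) \<in> L2_space"
  by (simp add: L2_space_def)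

lemma L2_add:
  assumes "f \<in> L2_space" "g \<in> L2_space"
  shows "(\<lambda>x. f x + g x) \<in> L2_space"
proof -
  note [measurable] = assms[THEN L2_measurable]
  have "integrable lebesgue (\<lambda>x. (cmod (f x + g x))\<^sup>2)"
  proof (rule Bochner_Integration.integrable_bound)
    show "integrable lebesgue (\<lambda>x. 2 * (cmod (f x))\<^sup>2 + 2 * (cmod (g x))\<^sup>2)"
      using assms[THEN L2_integrable_sq] by simp
    show "(\<lambda>x. (cmod (f x + g x))\<^sup>2) \<in> borel_measurable lebesgue" by measurable
    have "(cmod (f x + g x))\<^sup>2 \<le> 2 * (cmod (f x))\<^sup>2 + 2 * (cmod (g x))\<^sup>2" for x
    proof -
      have "(cmod (f x + g x))\<^sup>2 \<le> (cmod (f x) + cmod (g x))\<^sup>2"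
        by (intro power_mono norm_triangle_ineq) auto
      also have "\<dots> \<le> 2 * (cmod (f x))\<^sup>2 + 2 * (cmod (g x))\<^sup>2"
        using sum_squares_bound[of "cmod (f x)" "cmod (g x)"] by (simp add: power2_sum)
      finally show ?thesis .
    qed
    then show "AE x in lebesgue. norm ((cmod (f x + g x))\<^sup>2) \<le> norm (2 * (cmod (f x))\<^sup>2 + 2 * (cmod (g x))\<^sup>2)"
      by (auto simp: abs_of_nonneg)
  qed
  then show ?thesis by (simp add: L2_space_def)
qed

lemma L2_mult_bounded:
  assumes "f \<in> L2_space" "p \<in> borel_measurable lebesgue" "AE x in lebesgue. cmod (p x) \<le> C"
  shows "(\<lambda>x. p x * f x) \<in> L2_space"
proof (rule L2_dominated[OF _ assms(1)])
  note [measurable] = assms(2) L2_measurable[OF assms(1)]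
  show "(\<lambda>x. p x * f x) \<in> borel_measurable lebesgue" by measurable
  show "AE x in lebesgue. cmod (p x * f x) \<le> C * cmod (f x)"
    using assms(3) by eventually_elim (simp add: norm_mult mult_right_mono)
qed

lemma L2_cmult: "f \<in> L2_space \<Longrightarrow> (\<lambda>x. c * f x) \<in> L2_space"
  by (rule L2_mult_bounded[where C = "cmod c"]) auto

lemma L2_uminus: "f \<in> L2_space \<Longrightarrow> (\<lambda>x. - f x) \<in> L2_space"
  using L2_cmult[of f "-1"] by simp

lemma L2_diff: "f \<in> L2_space \<Longrightarrow> g \<in> L2_space \<Longrightarrow> (\<lambda>x. f x - g x) \<in> L2_space"
  using L2_add[of f "\<lambda>x. - g x"] L2_uminus[of g] by simp

lemma L2_cnj: "f \<in> L2_space \<Longrightarrow> (\<lambda>x. cnj (f x)) \<in> L2_space"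
  by (rule L2_dominated[where g = f and C = 1]) (auto intro: borel_measurable_cnj dest: L2_measurable)

lemma L2_sum: "(\<And>i. i \<in> I \<Longrightarrow> f i \<in> L2_space) \<Longrightarrow> (\<lambda>x. \<Sum>i\<in>I. f i x) \<in> L2_space"
  by (induction I rule: infinite_finite_induct) (auto intro: L2_add)

lemma L2_AE_cong:
  assumes "f \<in> L2_space" "AE x in lebesgue. f x = g x"
  shows "g \<in> L2_space"
proof (rule L2_dominated[where C = 1])
  show "g \<in> borel_measurable lebesgue"
    by (rule borel_measurable_AE[OF L2_measurable[OF assms(1)] assms(2)])
qed (use assms in auto)

lemma L2_mult_integrable:
  assumes "f \<in> L2_space" "g \<in> L2_space"
  shows "integrable lebesgue (\<lambda>x. f x * g x)"
proof (rule Bochner_Integration.integrable_bound)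
  note [measurable] = assms[THEN L2_measurable]
  show "integrable lebesgue (\<lambda>x. (cmod (f x))\<^sup>2 + (cmod (g x))\<^sup>2)"
    using assms[THEN L2_integrable_sq] by simp
  show "(\<lambda>x. f x * g x) \<in> borel_measurable lebesgue" by measurable
  have "cmod (f x * g x) \<le> (cmod (f x))\<^sup>2 + (cmod (g x))\<^sup>2" for x
  proof -
    have "0 \<le> cmod (f x) * cmod (g x)" by simp
    then show ?thesis
      using sum_squares_bound[of "cmod (f x)" "cmod (g x)"] unfolding norm_mult by linarith
  qed
  then show "AE x in lebesgue. norm (f x * g x) \<le> norm ((cmod (f x))\<^sup>2 + (cmod (g x))\<^sup>2)"
    by (auto simp: abs_of_nonneg)
qed

lemma L2_norm_nonneg [simp]: "0 \<le> L2_norm f"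
  by (simp add: L2_norm_def)

lemma L2_norm_sq: "(L2_norm f)\<^sup>2 = (LINT x|lebesgue. (cmod (f x))\<^sup>2)"
  by (simp add: L2_norm_def)

lemma L2_norm_cong_AE:
  assumes "AE x in lebesgue. f x = g x"
  shows "L2_norm f = L2_norm g"
proof -
  have *: "AE x in lebesgue. (cmod (f x))\<^sup>2 = (cmod (g x))\<^sup>2" "AE x in lebesgue. (cmod (g x))\<^sup>2 = (cmod (f x))\<^sup>2"
    using assms by auto
  have "(LINT x|lebesgue. (cmod (f x))\<^sup>2) = (LINT x|lebesgue. (cmod (g x))\<^sup>2)"
  proof (cases "(\<lambda>x. (cmod (f x))\<^sup>2) \<in> borel_measurable lebesgue")
    case True
    then show ?thesis using borel_measurable_AE[OF True *(1)] *(1) by (intro integral_cong_AE)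
  next
    \<comment> \<open>Neither square is measurable, so both integrals take the default value
      0.\<close>
    case False
    then have "(\<lambda>x. (cmod (g x))\<^sup>2) \<notin> borel_measurable lebesgue"
      using borel_measurable_AE[OF _ *(2)] by blast
    then show ?thesis using False
      by (metis (no_types, lifting) borel_measurable_integrable not_integrable_integral_eq)
  qed
  then show ?thesis by (simp add: L2_norm_def)
qed

lemma L2_norm_eq_0_iff:
  assumes "f \<in> L2_space"
  shows "L2_norm f = 0 \<longleftrightarrow> (AE x in lebesgue. f x = 0)"
  using integral_nonneg_eq_0_iff_AE[OF L2_integrable_sq[OF assms]] by (simp add: L2_norm_def)

lemma L2_norm_cmult: "L2_norm (\<lambda>x. c * f x) = cmod c * L2_norm f"
  by (simp add: L2_norm_def norm_mult power_mult_distrib real_sqrt_mult)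

lemma L2_norm_minus_commute: "L2_norm (\<lambda>x. f x - g x) = L2_norm (\<lambda>x. g x - f x)"
  by (simp add: L2_norm_def norm_minus_commute)

lemma L2_norm_cnj: "L2_norm (\<lambda>x. cnj (f x)) = L2_norm f"
  by (simp add: L2_norm_def)

section \<open>The inner product and the Cauchy-Schwarz inequality\<close>

lemma L2_inner_integrable:
  "f \<in> L2_space \<Longrightarrow> g \<in> L2_space \<Longrightarrow> integrable lebesgue (\<lambda>x. f x * cnj (g x))"
  by (intro L2_mult_integrable L2_cnj)

lemma L2_inner_self: "L2_inner f f = complex_of_real ((L2_norm f)\<^sup>2)"
  unfolding L2_inner_def L2_norm_sq complex_norm_square[symmetric] by (rule integral_complex_of_real)

lemma L2_inner_commute: "L2_inner g f = cnj (L2_inner f g)"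
proof -
  have "(LINT x|lebesgue. g x * cnj (f x)) = (LINT x|lebesgue. cnj (f x * cnj (g x)))"
    by (intro Bochner_Integration.integral_cong) auto
  then show ?thesis unfolding L2_inner_def by (simp only: Bochner_Integration.integral_cnj)
qed

lemma L2_inner_add_left:
  "f \<in> L2_space \<Longrightarrow> g \<in> L2_space \<Longrightarrow> h \<in> L2_space \<Longrightarrow>
    L2_inner (\<lambda>x. f x + g x) h = L2_inner f h + L2_inner g h"
  unfolding L2_inner_def by (simp add: distrib_right L2_inner_integrable)

lemma L2_inner_add_right:
  "f \<in> L2_space \<Longrightarrow> g \<in> L2_space \<Longrightarrow> h \<in> L2_space \<Longrightarrow>
    L2_inner h (\<lambda>x. f x + g x) = L2_inner h f + L2_inner h g"
  unfolding L2_inner_def by (simp add: distrib_left L2_inner_integrable)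

lemma L2_inner_diff_left:
  "f \<in> L2_space \<Longrightarrow> g \<in> L2_space \<Longrightarrow> h \<in> L2_space \<Longrightarrow>
    L2_inner (\<lambda>x. f x - g x) h = L2_inner f h - L2_inner g h"
  unfolding L2_inner_def by (simp add: left_diff_distrib L2_inner_integrable)

lemma L2_inner_diff_right:
  "f \<in> L2_space \<Longrightarrow> g \<in> L2_space \<Longrightarrow> h \<in> L2_space \<Longrightarrow>
    L2_inner h (\<lambda>x. f x - g x) = L2_inner h f - L2_inner h g"
  unfolding L2_inner_def by (simp add: right_diff_distrib L2_inner_integrable)

lemma L2_inner_cmult_right: "L2_inner h (\<lambda>x. c * f x) = cnj c * L2_inner h f"
  unfolding L2_inner_def by (simp add: mult.left_commute)

lemma L2_norm_add_sq:
  assumes "f \<in> L2_space" "g \<in> L2_space"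
  shows "(L2_norm (\<lambda>x. f x + g x))\<^sup>2 = (L2_norm f)\<^sup>2 + 2 * Re (L2_inner f g) + (L2_norm g)\<^sup>2"
proof -
  have "complex_of_real ((L2_norm (\<lambda>x. f x + g x))\<^sup>2) =
     L2_inner f f + L2_inner f g + (L2_inner g f + L2_inner g g)"
    unfolding L2_inner_self[symmetric] using assms
    by (simp add: L2_inner_add_left L2_inner_add_right L2_add)
  then have "Re (complex_of_real ((L2_norm (\<lambda>x. f x + g x))\<^sup>2)) =
     Re (L2_inner f f + L2_inner f g + (L2_inner g f + L2_inner g g))" by (rule arg_cong)
  moreover have "Re (L2_inner g f) = Re (L2_inner f g)"
    by (subst L2_inner_commute) simp
  ultimately show ?thesis by (simp add: L2_inner_self flip: of_real_power)
qed

lemma L2_norm_diff_sq: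
  assumes "f \<in> L2_space" "g \<in> L2_space"
  shows "(L2_norm (\<lambda>x. f x - g x))\<^sup>2 = (L2_norm f)\<^sup>2 - 2 * Re (L2_inner f g) + (L2_norm g)\<^sup>2"
proof -
  have "(\<lambda>x. f x - g x) = (\<lambda>x. f x + (-1) * g x)" by simp
  then show ?thesis using L2_norm_add_sq[OF assms(1) L2_cmult[OF assms(2), of "-1"]]
    by (simp only: L2_norm_cmult L2_inner_cmult_right) simp
qed

text \<open>The absolute value stands inside the integral because the L1 bounds in the completeness
  and Plancherel proofs need it there; the bound for \<open>L2_inner\<close> is a
  consequence.\<close>

lemma L2_Cauchy_Schwarz_abs:
  fixes f g :: "real ^ 'n \<Rightarrow> complex"
  assumes "f \<in> L2_space" "g \<in> L2_space"
  shows "(LINT x|lebesgue. cmod (f x * g x)) \<le> L2_norm f * L2_norm g"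
proof -
  define P where "P = (LINT x|lebesgue. cmod (f x * g x))"
  let ?a = "L2_norm f" and ?b = "L2_norm g"
  note [measurable] = assms[THEN L2_measurable]
  consider "?a = 0 \<or> ?b = 0" | "?a > 0" "?b > 0"
    using L2_norm_nonneg[of f] L2_norm_nonneg[of g] by linarith
  then show ?thesis
  proof cases
    case 1
    then have "AE x in lebesgue. cmod (f x * g x) = 0"
      using assms[THEN L2_norm_eq_0_iff] by (auto elim: eventually_mono)
    then have "P = (LINT x::real^'n|lebesgue. 0)"
      unfolding P_def by (intro integral_cong_AE) auto
    then show ?thesis using P_def by simp
  next
    case 2
    \<comment> \<open>The weight that balances the two squares: \<open>t^2 ?a^2 = ?b^2\<close>, so
      the nonnegative integral of \<open>(t |f| - |g|)^2\<close> yields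
      \<open>t P \<le> ?b^2 = t ?a ?b\<close>.\<close>
    define t where "t = ?b / ?a"
    have t: "t > 0" using 2 by (simp add: t_def)
    have int: "integrable lebesgue (\<lambda>x. cmod (f x * g x))"
      using L2_mult_integrable[OF assms] by simp
    have "0 \<le> (LINT x|lebesgue. (t * cmod (f x) - cmod (g x))\<^sup>2)"
      by (intro integral_nonneg_AE) auto
    also have "\<dots> = (LINT x|lebesgue. t\<^sup>2 * (cmod (f x))\<^sup>2 - (2 * t) * cmod (f x * g x) + (cmod (g x))\<^sup>2)"
      by (intro Bochner_Integration.integral_cong) (auto simp: norm_mult power2_diff power_mult_distrib)
    also have "\<dots> = t\<^sup>2 * ?a\<^sup>2 - (2 * t) * P + ?b\<^sup>2"
      unfolding P_def L2_norm_sq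
      using int L2_integrable_sq[OF assms(1)] L2_integrable_sq[OF assms(2)]
      by (simp only: Bochner_Integration.integral_add Bochner_Integration.integral_diff
            integral_mult_right_zero integrable_mult_right Bochner_Integration.integrable_diff)
    also have "t\<^sup>2 * ?a\<^sup>2 = ?b\<^sup>2" using 2 by (simp add: t_def power_divide)
    finally have "2 * t * P \<le> 2 * ?b\<^sup>2" by simp
    then have "t * P \<le> t * (?a * ?b)" using 2 by (simp add: t_def power2_eq_square)
    then show ?thesis using t by (simp add: P_def)
  qed
qed

lemma L2_Cauchy_Schwarz:
  assumes "f \<in> L2_space" "g \<in> L2_space"
  shows "cmod (L2_inner f g) \<le> L2_norm f * L2_norm g"
proof -
  have "cmod (L2_inner f g) \<le> (LINT x|lebesgue. cmod (f x * cnj (g x)))"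
    unfolding L2_inner_def by (rule integral_norm_bound)
  also have "\<dots> \<le> L2_norm f * L2_norm g"
    using L2_Cauchy_Schwarz_abs[OF assms(1) L2_cnj[OF assms(2)]] by (simp add: L2_norm_cnj)
  finally show ?thesis .
qed

lemma L2_norm_triangle:
  assumes "f \<in> L2_space" "g \<in> L2_space"
  shows "L2_norm (\<lambda>x. f x + g x) \<le> L2_norm f + L2_norm g"
proof (rule power2_le_imp_le)
  have "Re (L2_inner f g) \<le> L2_norm f * L2_norm g"
    using L2_Cauchy_Schwarz[OF assms] complex_Re_le_cmod order_trans by blast
  then show "(L2_norm (\<lambda>x. f x + g x))\<^sup>2 \<le> (L2_norm f + L2_norm g)\<^sup>2"
    by (simp add: L2_norm_add_sq[OF assms] power2_sum)
qed simp

lemma L2_norm_triangle_diff: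
  assumes "f \<in> L2_space" "g \<in> L2_space" "h \<in> L2_space"
  shows "L2_norm (\<lambda>x. f x - h x) \<le> L2_norm (\<lambda>x. f x - g x) + L2_norm (\<lambda>x. g x - h x)"
  using L2_norm_triangle[OF L2_diff[OF assms(1,2)] L2_diff[OF assms(2,3)]] by simp

lemma L2_norm_diff_triangle:
  assumes "f \<in> L2_space" "g \<in> L2_space"
  shows "\<bar>L2_norm f - L2_norm g\<bar> \<le> L2_norm (\<lambda>x. f x - g x)"
  using L2_norm_triangle_diff[OF assms L2_zero] L2_norm_triangle_diff[OF assms(2,1) L2_zero]
    L2_norm_minus_commute[of f g] by simp

section \<open>Convergence in mean square\<close>

lemma L2_tendstoI:
  "(\<And>n. u n \<in> L2_space) \<Longrightarrow> f \<in> L2_space \<Longrightarrow> (\<lambda>n. L2_norm (\<lambda>x. u n x - f x)) \<longlonglongrightarrow> 0 \<Longrightarrow> L2_tendsto u f"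
  by (simp add: L2_tendsto_def)

lemma L2_tendstoD:
  assumes "L2_tendsto u f"
  shows "u n \<in> L2_space" "f \<in> L2_space" "(\<lambda>n. L2_norm (\<lambda>x. u n x - f x)) \<longlonglongrightarrow> 0"
  using assms by (auto simp: L2_tendsto_def)

text \<open>Only a Lipschitz estimate along the sequence enters, not linearity of \<open>S\<close>.
  This covers conjugation, affine substitutions, unimodular factors, and operators that are linear
  only almost everywhere.\<close>

lemma L2_tendsto_bounded_linear:
  assumes u: "L2_tendsto u f" and S: "\<And>n. S (u n) \<in> L2_space" "S f \<in> L2_space"
    and b: "\<And>n. L2_norm (\<lambda>x. S (u n) x - S f x) \<le> C * L2_norm (\<lambda>x. u n x - f x)"
  shows "L2_tendsto (\<lambda>n. S (u n)) (S f)"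
proof (rule L2_tendstoI[OF S])
  show "(\<lambda>n. L2_norm (\<lambda>x. S (u n) x - S f x)) \<longlonglongrightarrow> 0"
  proof (rule tendsto_sandwich[OF _ _ tendsto_const])
    show "(\<lambda>n. C * L2_norm (\<lambda>x. u n x - f x)) \<longlonglongrightarrow> 0"
      using tendsto_mult_right_zero[OF L2_tendstoD(3)[OF u]] .
  qed (use b in auto)
qed

lemma L2_tendsto_add:
  assumes "L2_tendsto u f" "L2_tendsto v g"
  shows "L2_tendsto (\<lambda>n x. u n x + v n x) (\<lambda>x. f x + g x)"
proof (rule L2_tendstoI)
  note u = L2_tendstoD[OF assms(1)] and v = L2_tendstoD[OF assms(2)]
  show "(\<lambda>x. u n x + v n x) \<in> L2_space" "(\<lambda>x. f x + g x) \<in> L2_space" for n using u v by (auto intro: L2_add)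
  show "(\<lambda>n. L2_norm (\<lambda>x. u n x + v n x - (f x + g x))) \<longlonglongrightarrow> 0"
  proof (rule tendsto_sandwich[OF _ _ tendsto_const])
    show "(\<lambda>n. L2_norm (\<lambda>x. u n x - f x) + L2_norm (\<lambda>x. v n x - g x)) \<longlonglongrightarrow> 0"
      using tendsto_add[OF u(3) v(3)] by simp
    show "\<forall>\<^sub>F n in sequentially. L2_norm (\<lambda>x. u n x + v n x - (f x + g x))
        \<le> L2_norm (\<lambda>x. u n x - f x) + L2_norm (\<lambda>x. v n x - g x)"
      using L2_norm_triangle[OF L2_diff[OF u(1,2)] L2_diff[OF v(1,2)]] by (simp add: algebra_simps)
  qed auto
qed

lemma L2_tendsto_cmult:
  assumes "L2_tendsto u f"
  shows "L2_tendsto (\<lambda>n x. c * u n x) (\<lambda>x. c * f x)"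
  by (rule L2_tendsto_bounded_linear[OF assms, where S = "\<lambda>f x. c * f x" and C = "cmod c"])
    (auto intro: L2_cmult L2_tendstoD[OF assms] simp: L2_norm_cmult simp flip: right_diff_distrib)

lemma L2_tendsto_cnj:
  assumes "L2_tendsto u f"
  shows "L2_tendsto (\<lambda>n x. cnj (u n x)) (\<lambda>x. cnj (f x))"
  by (rule L2_tendsto_bounded_linear[OF assms, where S = "\<lambda>f x. cnj (f x)" and C = 1])
    (auto intro: L2_cnj L2_tendstoD[OF assms] simp: L2_norm_cnj simp flip: complex_cnj_diff)

lemma L2_tendsto_subseq:
  assumes "L2_tendsto u f" "strict_mono r"
  shows "L2_tendsto (\<lambda>n. u (r n)) f"
  using assms LIMSEQ_subseq_LIMSEQ[OF L2_tendstoD(3)[OF assms(1)] assms(2)]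
  by (auto simp: L2_tendsto_def o_def)

lemma L2_tendsto_AE_cong:
  assumes "L2_tendsto u f" "\<And>n. AE x in lebesgue. u n x = v n x" "AE x in lebesgue. f x = g x"
  shows "L2_tendsto v g"
proof -
  have "L2_norm (\<lambda>x. v n x - g x) = L2_norm (\<lambda>x. u n x - f x)" for n
    using assms(2)[of n] assms(3) by (intro L2_norm_cong_AE) auto
  moreover have "v n \<in> L2_space" for n
    using L2_AE_cong[OF L2_tendstoD(1)[OF assms(1)] assms(2)] .
  moreover have "g \<in> L2_space"
    using L2_AE_cong[OF L2_tendstoD(2)[OF assms(1)] assms(3)] .
  ultimately show ?thesis using assms(1) by (simp add: L2_tendsto_def)
qed

lemma L2_tendsto_norm:
  assumes "L2_tendsto u f"
  shows "(\<lambda>n. L2_norm (u n)) \<longlonglongrightarrow> L2_norm f"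
proof -
  note u = L2_tendstoD[OF assms]
  have "(\<lambda>n. L2_norm (u n) - L2_norm f) \<longlonglongrightarrow> 0"
    using u(3) by (rule Lim_null_comparison[rotated]) (use L2_norm_diff_triangle[OF u(1,2)] in auto)
  then show ?thesis by (simp add: LIM_zero_iff)
qed

lemma L2_tendsto_inner:
  assumes "L2_tendsto u f" "L2_tendsto v g"
  shows "(\<lambda>n. L2_inner (u n) (v n)) \<longlonglongrightarrow> L2_inner f g"
proof -
  note u = L2_tendstoD[OF assms(1)] and v = L2_tendstoD[OF assms(2)]
  have "(\<lambda>n. L2_inner (u n) (v n) - L2_inner f g) \<longlonglongrightarrow> 0"
  proof (rule Lim_null_comparison)
    show "(\<lambda>n. L2_norm (\<lambda>x. u n x - f x) * L2_norm (v n) + L2_norm f * L2_norm (\<lambda>x. v n x - g x)) \<longlonglongrightarrow> 0"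
      using tendsto_add[OF tendsto_mult[OF u(3) L2_tendsto_norm[OF assms(2)]] tendsto_mult[OF tendsto_const v(3)]]
      by simp
    have "cmod (L2_inner (u n) (v n) - L2_inner f g) \<le>
        L2_norm (\<lambda>x. u n x - f x) * L2_norm (v n) + L2_norm f * L2_norm (\<lambda>x. v n x - g x)" for n
    proof -
      have "L2_inner (u n) (v n) - L2_inner f g = L2_inner (\<lambda>x. u n x - f x) (v n) + L2_inner f (\<lambda>x. v n x - g x)"
        using u v by (simp add: L2_inner_diff_left L2_inner_diff_right)
      also have "cmod \<dots> \<le> cmod (L2_inner (\<lambda>x. u n x - f x) (v n)) + cmod (L2_inner f (\<lambda>x. v n x - g x))"
        by (rule norm_triangle_ineq)
      also have "\<dots> \<le> L2_norm (\<lambda>x. u n x - f x) * L2_norm (v n) + L2_norm f * L2_norm (\<lambda>x. v n x - g x)"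
        by (intro add_mono L2_Cauchy_Schwarz L2_diff u v)
      finally show ?thesis .
    qed
    then show "\<forall>\<^sub>F n in sequentially. cmod (L2_inner (u n) (v n) - L2_inner f g) \<le>
        L2_norm (\<lambda>x. u n x - f x) * L2_norm (v n) + L2_norm f * L2_norm (\<lambda>x. v n x - g x)" by simp
  qed
  then show ?thesis by (simp add: LIM_zero_iff)
qed

lemma L2_tendsto_unique:
  assumes "L2_tendsto u f" "L2_tendsto u g"
  shows "AE x in lebesgue. f x = g x"
proof -
  note u = L2_tendstoD[OF assms(1)] and v = L2_tendstoD[OF assms(2)]
  have "(\<lambda>n. L2_norm (\<lambda>x. u n x - f x) + L2_norm (\<lambda>x. u n x - g x)) \<longlonglongrightarrow> 0"
    using tendsto_add[OF u(3) v(3)] by simp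
  moreover have "L2_norm (\<lambda>x. f x - g x) \<le> L2_norm (\<lambda>x. u n x - f x) + L2_norm (\<lambda>x. u n x - g x)" for n
    using L2_norm_triangle_diff[OF u(2) u(1) v(2), of n] L2_norm_minus_commute[of f "u n"] by simp
  ultimately have "L2_norm (\<lambda>x. f x - g x) \<le> 0"
    by (intro LIMSEQ_le_const) auto
  then have "L2_norm (\<lambda>x. f x - g x) = 0" using L2_norm_nonneg order_antisym by blast
  then show ?thesis using L2_norm_eq_0_iff[OF L2_diff[OF u(2) v(2)]] by simp
qed

text \<open>Dominated convergence for \<open>|u n - f|^2\<close>, whose majorant is
  \<open>(2 C |g|)^2\<close> because the pointwise limit obeys the same bound as the
  sequence.\<close>

lemma L2_tendsto_dominated:
  fixes f g :: "real ^ 'n \<Rightarrow> complex"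
  assumes u: "\<And>n. u n \<in> borel_measurable lebesgue" and f: "f \<in> borel_measurable lebesgue"
    and g: "g \<in> L2_space"
    and lim: "AE x in lebesgue. (\<lambda>n. u n x) \<longlonglongrightarrow> f x"
    and bnd: "\<And>n. AE x in lebesgue. cmod (u n x) \<le> C * cmod (g x)"
  shows "L2_tendsto u f"
proof (rule L2_tendstoI)
  note [measurable] = u f
  show uL: "u n \<in> L2_space" for n using L2_dominated[OF u g bnd] .
  have allb: "AE x in lebesgue. \<forall>n. cmod (u n x) \<le> C * cmod (g x)" using bnd by (simp add: AE_all_countable)
  have fb: "AE x in lebesgue. cmod (f x) \<le> C * cmod (g x)"
    using lim allb by eventually_elim (use LIMSEQ_le_const2[OF tendsto_norm] in blast)
  show fL: "f \<in> L2_space" by (rule L2_dominated[OF f g fb])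
  have "(\<lambda>n. LINT x|lebesgue. (cmod (u n x - f x))\<^sup>2) \<longlonglongrightarrow> (LINT x::real^'n|lebesgue. 0)"
  proof (rule integral_dominated_convergence[where w = "\<lambda>x. (2 * C)\<^sup>2 * (cmod (g x))\<^sup>2"])
    show "integrable lebesgue (\<lambda>x. (2 * C)\<^sup>2 * (cmod (g x))\<^sup>2)" using L2_integrable_sq[OF g] by simp
    show "AE x in lebesgue. (\<lambda>n. (cmod (u n x - f x))\<^sup>2) \<longlonglongrightarrow> 0"
      using lim
    proof eventually_elim
      case (elim x)
      then have "(\<lambda>n. u n x - f x) \<longlonglongrightarrow> 0" by (simp add: LIM_zero_iff)
      then show ?case using tendsto_power[OF tendsto_norm, of _ 0 _ 2] by force
    qed
    show "AE x in lebesgue. norm ((cmod (u n x - f x))\<^sup>2) \<le> (2 * C)\<^sup>2 * (cmod (g x))\<^sup>2" for n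
      using bnd[of n] fb
    proof eventually_elim
      case (elim x)
      then have "cmod (u n x - f x) \<le> 2 * C * cmod (g x)" using norm_triangle_ineq4[of "u n x" "f x"] by linarith
      then have "(cmod (u n x - f x))\<^sup>2 \<le> (2 * C * cmod (g x))\<^sup>2" by (rule power_mono) simp
      then show ?case by (simp add: power_mult_distrib)
    qed
  qed auto
  then show "(\<lambda>n. L2_norm (\<lambda>x. u n x - f x)) \<longlonglongrightarrow> 0"
    unfolding L2_norm_def using tendsto_real_sqrt[of _ 0] by simp
qed

text \<open>Translations for \<open>c = 1\<close>; for \<open>c = -1\<close> the reflections about a
  point that occur in convolutions. Measurability is between the completed measures, where
  continuity of the map is not enough by itself.\<close>

lemma lebesgue_unit_affine:
  fixes t :: "'a::euclidean_space"
  assumes "\<bar>c\<bar> = 1"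
  shows lebesgue_unit_affine_measurable: "(\<lambda>x. t + c *\<^sub>R x) \<in> lebesgue \<rightarrow>\<^sub>M lebesgue"
    and lebesgue_unit_affine_distr: "distr lebesgue lebesgue (\<lambda>x. t + c *\<^sub>R x) = lebesgue"
proof -
  have c: "\<And>j. j \<in> (Basis :: 'a set) \<Longrightarrow> c \<noteq> 0" using assms by auto
  have eq: "(\<lambda>x. t + (\<Sum>j\<in>Basis. (c * (x \<bullet> j)) *\<^sub>R j)) = (\<lambda>x. t + c *\<^sub>R x)"
    unfolding scaleR_scaleR[symmetric] scaleR_sum_right[symmetric] euclidean_representation ..
  show "(\<lambda>x. t + c *\<^sub>R x) \<in> lebesgue \<rightarrow>\<^sub>M lebesgue"
    using lebesgue_affine_measurable[of "\<lambda>_. c" t] c unfolding eq by blast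
  show "distr lebesgue lebesgue (\<lambda>x. t + c *\<^sub>R x) = lebesgue"
    using lebesgue_affine_euclidean[of "\<lambda>_. c" t] c assms unfolding eq by (simp add: density_1)
qed

lemma lebesgue_integral_unit_affine:
  fixes f :: "real ^ 'n \<Rightarrow> 'b::{banach, second_countable_topology}"
  assumes "\<bar>c\<bar> = 1" "f \<in> borel_measurable lebesgue"
  shows "(LINT x|lebesgue. f (t + c *\<^sub>R x)) = (LINT x|lebesgue. f x)"
  using integral_distr[OF lebesgue_unit_affine_measurable[OF assms(1), of t] assms(2)]
  unfolding lebesgue_unit_affine_distr[OF assms(1)] by simp

lemma lebesgue_integrable_unit_affine:
  fixes f :: "real ^ 'n \<Rightarrow> 'b::{banach, second_countable_topology}"
  assumes "\<bar>c\<bar> = 1" "integrable lebesgue f"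
  shows "integrable lebesgue (\<lambda>x. f (t + c *\<^sub>R x))"
  using integrable_distr[OF lebesgue_unit_affine_measurable[OF assms(1), of t]] assms(2)
  unfolding lebesgue_unit_affine_distr[OF assms(1)] by blast

lemma lebesgue_AE_unit_affine:
  fixes t :: "real ^ 'n"
  assumes "\<bar>c\<bar> = 1" "AE x in lebesgue. P x"
  shows "AE x in lebesgue. P (t + c *\<^sub>R x)"
  using AE_distrD[OF lebesgue_unit_affine_measurable[OF assms(1), of t]] assms(2)
  unfolding lebesgue_unit_affine_distr[OF assms(1)] by blast

lemma L2_unit_affine:
  fixes t :: "real ^ 'n"
  assumes "\<bar>c\<bar> = 1" "f \<in> L2_space"
  shows "(\<lambda>x. f (t + c *\<^sub>R x)) \<in> L2_space" "L2_norm (\<lambda>x. f (t + c *\<^sub>R x)) = L2_norm f"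
proof -
  note [measurable] = L2_measurable[OF assms(2)] lebesgue_unit_affine_measurable[OF assms(1)]
  have "(\<lambda>x. f (t + c *\<^sub>R x)) \<in> borel_measurable lebesgue" by measurable
  then show "(\<lambda>x. f (t + c *\<^sub>R x)) \<in> L2_space"
    using lebesgue_integrable_unit_affine[OF assms(1) L2_integrable_sq[OF assms(2)]]
    by (simp add: L2_space_def)
  show "L2_norm (\<lambda>x. f (t + c *\<^sub>R x)) = L2_norm f"
    unfolding L2_norm_def
    by (subst lebesgue_integral_unit_affine[OF assms(1), of "\<lambda>x. (cmod (f x))\<^sup>2"]) auto
qed

lemma L2_tendsto_unit_affine:
  fixes t :: "real ^ 'n"
  assumes "\<bar>c\<bar> = 1" "L2_tendsto u f"
  shows "L2_tendsto (\<lambda>n x. u n (t + c *\<^sub>R x)) (\<lambda>x. f (t + c *\<^sub>R x))"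
  by (rule L2_tendsto_bounded_linear[OF assms(2), where S = "\<lambda>f x. f (t + c *\<^sub>R x)" and C = 1])
    (auto simp: L2_unit_affine[OF assms(1)] L2_tendstoD[OF assms(2)]
       L2_unit_affine[OF assms(1) L2_diff] )

section \<open>Gaussians\<close>

text \<open>Fubini over the coordinates: \<open>lborel\<close> is the image of a finite product of
  one-dimensional Lebesgue measures under the map that rebuilds a vector from its
  coordinates.\<close>

lemma lborel_integral_prod:
  fixes f :: "'a::euclidean_space \<Rightarrow> real \<Rightarrow> complex"
  assumes f: "\<And>b. b \<in> Basis \<Longrightarrow> integrable lborel (f b)"
  shows "integrable lborel (\<lambda>x. \<Prod>b\<in>Basis. f b (x \<bullet> b))" (is ?A)
    and "(LINT x|lborel. (\<Prod>b\<in>Basis. f b (x \<bullet> b))) = (\<Prod>b\<in>Basis. LINT x|lborel. f b x)" (is ?B)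
proof -
  interpret product_sigma_finite "\<lambda>b::'a. lborel :: real measure" ..
  let ?T = "\<lambda>g. \<Sum>b\<in>Basis. g b *\<^sub>R (b::'a)"
  have [measurable]: "b \<in> Basis \<Longrightarrow> f b \<in> borel_measurable borel" for b
    using borel_measurable_integrable[OF f] by simp
  have T: "?T \<in> (\<Pi>\<^sub>M b\<in>Basis. lborel) \<rightarrow>\<^sub>M borel" by measurable
  have F: "(\<lambda>x. \<Prod>b\<in>Basis. f b (x \<bullet> b)) \<in> borel_measurable borel" by measurable
  have eq: "(\<lambda>g. \<Prod>b\<in>Basis. f b (?T g \<bullet> b)) = (\<lambda>g. \<Prod>b\<in>Basis. f b (g b))"
    by (intro ext prod.cong) auto
  show ?A
    by (subst lborel_eq, subst integrable_distr_eq[OF T F], subst eq)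
      (rule product_integrable_prod, auto intro: f)
  show ?B
    by (subst lborel_eq, subst integral_distr[OF T F], subst eq)
      (rule product_integral_prod, auto intro: f)
qed

text \<open>The substitution \<open>x = s * y\<close> with \<open>s = 1 / sqrt \<epsilon>\<close>
  turns the integral into the characteristic function of the standard normal law at
  \<open>- s * t\<close>.\<close>

lemma gaussian_integral_real:
  assumes "\<epsilon> > 0"
  shows "integrable lborel (\<lambda>x. complex_of_real (exp (- \<epsilon> * x\<^sup>2 / 2)) * exp (- \<i> * complex_of_real (x * t)))" (is ?A)
    and "(LINT x|lborel. complex_of_real (exp (- \<epsilon> * x\<^sup>2 / 2)) * exp (- \<i> * complex_of_real (x * t))) =
      complex_of_real (sqrt (2 * pi / \<epsilon>) * exp (- t\<^sup>2 / (2 * \<epsilon>)))" (is ?B)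
proof -
  define s where "s = 1 / sqrt \<epsilon>"
  have s: "s > 0" "s\<^sup>2 = 1 / \<epsilon>" using assms by (auto simp: s_def power_divide)
  define g where "g = (\<lambda>x. complex_of_real (exp (- \<epsilon> * x\<^sup>2 / 2)) * exp (- \<i> * complex_of_real (x * t)))"
  define h where "h = (\<lambda>y. std_normal_density y *\<^sub>R exp (\<i> * complex_of_real ((- s * t) * y)))"
  have h_int: "integrable lborel h"
  proof (rule Bochner_Integration.integrable_bound)
    show "integrable lborel std_normal_density" by (rule integrable_normal_density) simp
    show "h \<in> borel_measurable lborel" unfolding h_def by measurable
  qed (auto simp: h_def)
  have "(LINT y|lborel. h y) = char std_normal_distribution (- s * t)"
    unfolding char_def h_def by (subst integral_density) auto
  then have hv: "(LINT y|lborel. h y) = complex_of_real (exp (- (s * t)\<^sup>2 / 2))"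
    by (simp add: char_std_normal_distribution)
  have gh: "g (s * y) = complex_of_real (sqrt (2 * pi)) * h y" for y
  proof -
    have "\<epsilon> * (s * y)\<^sup>2 = y\<^sup>2" using s assms by (simp add: power_mult_distrib)
    then show ?thesis
      by (simp add: g_def h_def std_normal_density_def scaleR_conv_of_real algebra_simps)
  qed
  have "integrable lborel (\<lambda>y. g (0 + s * y))" using h_int by (simp add: gh)
  then have "integrable lborel g" using lborel_integrable_real_affine_iff[of s g 0] s by simp
  then show ?A by (simp add: g_def)
  have "(LINT x|lborel. g x) = \<bar>s\<bar> *\<^sub>R (LINT x|lborel. g (0 + s * x))"
    using s by (intro lborel_integral_real_affine) auto
  also have "\<dots> = complex_of_real (s * sqrt (2 * pi) * exp (- (s * t)\<^sup>2 / 2))"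
    using s hv by (simp add: gh scaleR_conv_of_real)
  also have "s * sqrt (2 * pi) = sqrt (2 * pi / \<epsilon>)" using assms by (simp add: s_def real_sqrt_divide)
  also have "- (s * t)\<^sup>2 / 2 = - t\<^sup>2 / (2 * \<epsilon>)" using s by (simp add: power_mult_distrib)
  finally show ?B by (simp add: g_def)
qed

text \<open>Here \<open>\<epsilon>\<close> is the inverse variance. There is no normalizing factor,
  so that \<open>gaussian 1\<close> is a fixed point of the Fourier transform. The values are real
  but typed as complex, to be used directly as functions of the spaces above.\<close>

definition gaussian :: "real \<Rightarrow> 'a::euclidean_space \<Rightarrow> complex" where
  "gaussian \<epsilon> x = complex_of_real (exp (- \<epsilon> * (norm x)\<^sup>2 / 2))"

lemma norm_sq_sum_Basis: "(norm (x::'a::euclidean_space))\<^sup>2 = (\<Sum>b\<in>Basis. (x \<bullet> b)\<^sup>2)"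
  unfolding power2_norm_eq_inner by (subst euclidean_inner) (simp add: power2_eq_square)

lemma gaussian_eq_prod:
  "gaussian \<epsilon> (x::'a::euclidean_space) = (\<Prod>b\<in>Basis. complex_of_real (exp (- \<epsilon> * (x \<bullet> b)\<^sup>2 / 2)))"
proof -
  have "- \<epsilon> * (norm x)\<^sup>2 / 2 = (\<Sum>b\<in>Basis. - \<epsilon> * (x \<bullet> b)\<^sup>2 / 2)"
    unfolding norm_sq_sum_Basis sum_distrib_left sum_divide_distrib ..
  then show ?thesis unfolding gaussian_def by (simp only: exp_sum finite_Basis of_real_prod)
qed

lemma gaussian_fourier_integral:
  fixes \<xi> :: "'a::euclidean_space"
  assumes "\<epsilon> > 0"
  shows "integrable lborel (\<lambda>x. gaussian \<epsilon> x * exp (- \<i> * complex_of_real (x \<bullet> \<xi>)))" (is ?A)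
    and "(LINT x|lborel. gaussian \<epsilon> x * exp (- \<i> * complex_of_real (x \<bullet> \<xi>))) =
      complex_of_real (sqrt (2 * pi / \<epsilon>) ^ DIM('a)) * gaussian (1 / \<epsilon>) \<xi>" (is ?B)
proof -
  let ?f = "\<lambda>(b::'a) y. complex_of_real (exp (- \<epsilon> * y\<^sup>2 / 2)) * exp (- \<i> * complex_of_real (y * (\<xi> \<bullet> b)))"
  have eq: "gaussian \<epsilon> x * exp (- \<i> * complex_of_real (x \<bullet> \<xi>)) = (\<Prod>b\<in>Basis. ?f b (x \<bullet> b))" for x
  proof -
    have "gaussian \<epsilon> x = (\<Prod>b\<in>Basis. complex_of_real (exp (- \<epsilon> * (x \<bullet> b)\<^sup>2 / 2)))"
      by (simp only: gaussian_eq_prod)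
    moreover have "exp (- \<i> * complex_of_real (x \<bullet> \<xi>)) =
        (\<Prod>b\<in>Basis. exp (- \<i> * complex_of_real ((x \<bullet> b) * (\<xi> \<bullet> b))))"
      by (subst euclidean_inner) (simp add: exp_sum sum_distrib_left flip: sum_negf)
    ultimately show ?thesis by (simp add: prod.distrib)
  qed
  show ?A unfolding eq by (rule lborel_integral_prod(1)) (rule gaussian_integral_real(1)[OF assms])
  have "(LINT x|lborel. gaussian \<epsilon> x * exp (- \<i> * complex_of_real (x \<bullet> \<xi>))) =
     (\<Prod>b\<in>(Basis::'a set). LINT x|lborel. ?f b x)"
    unfolding eq by (rule lborel_integral_prod(2)) (rule gaussian_integral_real(1)[OF assms])
  also have "\<dots> = (\<Prod>b\<in>(Basis::'a set). complex_of_real (sqrt (2 * pi / \<epsilon>) * exp (- (\<xi> \<bullet> b)\<^sup>2 / (2 * \<epsilon>))))"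
    by (intro prod.cong refl gaussian_integral_real(2) assms)
  also have "\<dots> = complex_of_real (sqrt (2 * pi / \<epsilon>) ^ DIM('a)) * gaussian (1 / \<epsilon>) \<xi>"
    unfolding gaussian_eq_prod by (simp add: prod.distrib mult.commute)
  finally show ?B .
qed

lemma gaussian_measurable [measurable]: "gaussian \<epsilon> \<in> borel_measurable borel"
  unfolding gaussian_def by measurable

lemma gaussian_integrable: "\<epsilon> > 0 \<Longrightarrow> integrable lborel (gaussian \<epsilon>)"
  using gaussian_fourier_integral(1)[of \<epsilon> 0] by simp

lemma gaussian_nonzero [simp]: "gaussian \<epsilon> x \<noteq> 0"
  by (simp add: gaussian_def)

lemma gaussian_L1:
  assumes "\<epsilon> > 0"
  shows "gaussian \<epsilon> \<in> L1_space"
  unfolding L1_space_def using gaussian_integrable[OF assms] by (simp add: integrable_completion)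

lemma gaussian_L2:
  assumes "\<epsilon> > 0"
  shows "(gaussian \<epsilon> :: real ^ 'n \<Rightarrow> complex) \<in> L2_space"
proof -
  have "(cmod (gaussian \<epsilon> x))\<^sup>2 = cmod (gaussian (2 * \<epsilon>) x)" for x :: "real ^ 'n"
    by (simp add: gaussian_def power2_eq_square flip: exp_add)
  then show ?thesis
    using integrable_norm[of lebesgue "gaussian (2 * \<epsilon>) :: real ^ 'n \<Rightarrow> complex"] gaussian_L1[of "2 * \<epsilon>"] assms
    unfolding L2_space_def L1_space_def by (auto intro: measurable_completion)
qed

text \<open>A function of L1 and L2 with an explicit transform that is nowhere zero: dividing by it
  defines the multiplier of an operator and detects whether an operator is trivial.\<close>

lemma fourier_L1_gaussian: "fourier_L1 (gaussian 1) = (gaussian 1 :: real ^ 'n \<Rightarrow> complex)"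
proof
  fix \<xi> :: "real ^ 'n"
  have "(2 * pi) powr (- real CARD('n) / 2) * sqrt (2 * pi) ^ CARD('n) = 1"
    by (simp add: powr_half_sqrt[symmetric] powr_powr flip: powr_realpow powr_add)
  then have "complex_of_real ((2 * pi) powr (- real CARD('n) / 2)) * complex_of_real (sqrt (2 * pi) ^ CARD('n)) = 1"
    by (metis of_real_1 of_real_mult)
  moreover have "(LINT x|lebesgue. gaussian 1 x * exp (- \<i> * complex_of_real (x \<bullet> \<xi>))) =
      (LINT x|lborel. gaussian 1 x * exp (- \<i> * complex_of_real (x \<bullet> \<xi>)))"
    by (rule integral_completion) measurable
  ultimately show "fourier_L1 (gaussian 1) \<xi> = gaussian 1 \<xi>"
    unfolding fourier_L1_def using gaussian_fourier_integral(2)[of 1 \<xi>]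
    by (simp add: mult.assoc[symmetric])
qed

section \<open>Completeness\<close>

lemma L2_tendsto_AE_subseq:
  fixes f :: "real ^ 'n \<Rightarrow> complex"
  assumes "L2_tendsto u f"
  obtains r where "strict_mono (r :: nat \<Rightarrow> nat)" "AE x in lebesgue. (\<lambda>n. u (r n) x) \<longlonglongrightarrow> f x"
proof -
  note u = L2_tendstoD[OF assms]
  have "(\<lambda>n. LINT x|lebesgue. norm ((cmod (u n x - f x))\<^sup>2)) \<longlonglongrightarrow> 0"
    using tendsto_power[OF u(3), of 2] by (simp add: L2_norm_sq)
  from tendsto_L1_AE_subseq[OF L2_integrable_sq[OF L2_diff[OF u(1,2)]] this]
  obtain r :: "nat \<Rightarrow> nat" where r: "strict_mono r"
    "AE x in lebesgue. (\<lambda>n. (cmod (u (r n) x - f x))\<^sup>2) \<longlonglongrightarrow> 0" by auto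
  have "AE x in lebesgue. (\<lambda>n. u (r n) x) \<longlonglongrightarrow> f x"
    using r(2)
  proof eventually_elim
    case (elim x)
    from tendsto_real_sqrt[OF elim] have "(\<lambda>n. cmod (u (r n) x - f x)) \<longlonglongrightarrow> 0" by simp
    then show ?case using tendsto_norm_zero_iff LIM_zero_iff by blast
  qed
  then show ?thesis using r(1) that by blast
qed

text \<open>Square integrability of the limit is a conclusion, since the pointwise limit built in
  the completeness proof is at first only measurable.\<close>

lemma L2_fatou:
  assumes u: "\<And>n. u n \<in> L2_space" and b: "\<And>n. L2_norm (u n) \<le> C"
    and lim: "AE x in lebesgue. (\<lambda>n. u n x) \<longlonglongrightarrow> f x" and f: "f \<in> borel_measurable lebesgue"
  shows "f \<in> L2_space" "L2_norm f \<le> C"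
proof -
  note [measurable] = f u[THEN L2_measurable]
  have C: "C \<ge> 0" using b[of 0] L2_norm_nonneg order_trans by blast
  have nn: "(\<integral>\<^sup>+x. ennreal ((cmod (u n x))\<^sup>2) \<partial>lebesgue) \<le> ennreal (C\<^sup>2)" for n
    using b[of n] power_mono[OF b[of n], of 2]
    by (subst nn_integral_eq_integral[OF L2_integrable_sq[OF u]]) (auto simp: L2_norm_sq[symmetric] ennreal_leI)
  have "(\<integral>\<^sup>+x. ennreal ((cmod (f x))\<^sup>2) \<partial>lebesgue) =
      (\<integral>\<^sup>+x. liminf (\<lambda>n. ennreal ((cmod (u n x))\<^sup>2)) \<partial>lebesgue)"
  proof (rule nn_integral_cong_AE)
    show "AE x in lebesgue. ennreal ((cmod (f x))\<^sup>2) = liminf (\<lambda>n. ennreal ((cmod (u n x))\<^sup>2))"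
      using lim
    proof eventually_elim
      case (elim x)
      have "(\<lambda>n. ennreal ((cmod (u n x))\<^sup>2)) \<longlonglongrightarrow> ennreal ((cmod (f x))\<^sup>2)"
        by (intro tendsto_intros elim)
      from lim_imp_Liminf[OF _ this] show ?case by simp
    qed
  qed
  also have "\<dots> \<le> liminf (\<lambda>n. \<integral>\<^sup>+x. ennreal ((cmod (u n x))\<^sup>2) \<partial>lebesgue)"
    by (rule nn_integral_liminf) measurable
  also have "\<dots> \<le> ennreal (C\<^sup>2)"
    by (rule Liminf_le) (auto intro: always_eventually nn)
  finally have le: "(\<integral>\<^sup>+x. ennreal ((cmod (f x))\<^sup>2) \<partial>lebesgue) \<le> ennreal (C\<^sup>2)" .
  have int: "integrable lebesgue (\<lambda>x. (cmod (f x))\<^sup>2)"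
  proof (rule integrableI_bounded)
    show "(\<integral>\<^sup>+x. ennreal (norm ((cmod (f x))\<^sup>2)) \<partial>lebesgue) < \<infinity>"
      using le_less_trans[OF le] by simp
  qed measurable
  then show "f \<in> L2_space" using f by (simp add: L2_space_def)
  have "(L2_norm f)\<^sup>2 \<le> C\<^sup>2"
    using le by (subst (asm) nn_integral_eq_integral[OF int]) (auto simp: L2_norm_sq)
  then show "L2_norm f \<le> C" using C by (rule power2_le_imp_le)
qed

text \<open>Riesz-Fischer: along a fast Cauchy subsequence the increments are summable almost
  everywhere, which gives a pointwise limit; Fatou's lemma then turns the Cauchy bounds into
  convergence of the whole sequence in norm.\<close>

lemma L2_complete:
  fixes u :: "nat \<Rightarrow> real ^ 'n \<Rightarrow> complex"
  assumes u: "\<And>n. u n \<in> L2_space"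
    and Cauchy: "\<And>e. e > 0 \<Longrightarrow> \<exists>N. \<forall>m\<ge>N. \<forall>n\<ge>N. L2_norm (\<lambda>x. u m x - u n x) < e"
  obtains f where "L2_tendsto u f"
proof -
  note [measurable] = u[THEN L2_measurable]
  have "\<exists>r. \<forall>k::nat. (\<forall>m\<ge>r k. \<forall>n\<ge>r k. L2_norm (\<lambda>x. u m x - u n x) < (1/2)^k) \<and> r k < r (Suc k)"
  proof (rule dependent_nat_choice)
    show "\<exists>N. \<forall>m\<ge>N. \<forall>n\<ge>N. L2_norm (\<lambda>x. u m x - u n x) < (1/2)^0" by (rule Cauchy) simp
    fix k M
    obtain N where "\<forall>m\<ge>N. \<forall>n\<ge>N. L2_norm (\<lambda>x. u m x - u n x) < (1/2)^Suc k"
      using Cauchy[of "(1/2)^Suc k"] by auto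
    then show "\<exists>N. (\<forall>m\<ge>N. \<forall>n\<ge>N. L2_norm (\<lambda>x. u m x - u n x) < (1/2)^Suc k) \<and> M < N"
      by (intro exI[of _ "max N (Suc M)"]) auto
  qed
  then obtain r :: "nat \<Rightarrow> nat" where r: "\<And>k m n. m \<ge> r k \<Longrightarrow> n \<ge> r k \<Longrightarrow> L2_norm (\<lambda>x. u m x - u n x) < (1/2)^k"
    and "\<And>k. r k < r (Suc k)" by blast
  then have sm: "strict_mono r" by (simp add: strict_mono_Suc_iff)
  define d where "d k x = u (r (Suc k)) x - u (r k) x" for k x
  have dL2: "d k \<in> L2_space" for k unfolding d_def by (intro L2_diff u)
  note [measurable] = dL2[THEN L2_measurable]
  \<comment> \<open>The weight turns the \<open>L\<^sup>2\<close> bounds on the increments into summable \<open>L\<^sup>1\<close> bounds.\<close>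
  let ?w = "gaussian 1 :: real ^ 'n \<Rightarrow> complex"
  have w: "?w \<in> L2_space" by (rule gaussian_L2) simp
  have [measurable]: "?w \<in> borel_measurable lebesgue" using L2_measurable[OF w] .
  have dw: "(\<integral>\<^sup>+x. ennreal (cmod (d k x * ?w x)) \<partial>lebesgue) \<le> ennreal ((1/2)^k * L2_norm ?w)" for k
  proof -
    have "(\<integral>\<^sup>+x. ennreal (cmod (d k x * ?w x)) \<partial>lebesgue) = ennreal (LINT x|lebesgue. cmod (d k x * ?w x))"
      by (intro nn_integral_eq_integral integrable_norm L2_mult_integrable dL2 w) auto
    also have "\<dots> \<le> ennreal (L2_norm (d k) * L2_norm ?w)"
      by (intro ennreal_leI L2_Cauchy_Schwarz_abs dL2 w)
    also have "\<dots> \<le> ennreal ((1/2)^k * L2_norm ?w)"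
      using r[of k "r (Suc k)" "r k"] sm unfolding d_def
      by (intro ennreal_leI mult_right_mono) (auto simp: less_imp_le strict_mono_less_eq)
    finally show ?thesis .
  qed
  have "(\<integral>\<^sup>+x. (\<Sum>k. ennreal (cmod (d k x * ?w x))) \<partial>lebesgue) =
      (\<Sum>k. \<integral>\<^sup>+x. ennreal (cmod (d k x * ?w x)) \<partial>lebesgue)"
    by (rule nn_integral_suminf) measurable
  also have "\<dots> \<le> (\<Sum>k. ennreal ((1/2)^k * L2_norm ?w))"
    by (intro suminf_le dw) auto
  also have "\<dots> < \<infinity>"
    by (subst suminf_ennreal2) (auto intro!: summable_mult2 summable_geometric)
  finally have "AE x in lebesgue. (\<Sum>k. ennreal (cmod (d k x * ?w x))) \<noteq> \<infinity>"
    by (intro nn_integral_PInf_AE) auto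
  then have conv: "AE x in lebesgue. convergent (\<lambda>k. u (r k) x)"
  proof eventually_elim
    case (elim x)
    have "summable (\<lambda>k. cmod (d k x * ?w x))"
      using elim by (intro summable_suminf_not_top) auto
    then have "summable (\<lambda>k. d k x * ?w x)" by (rule summable_norm_cancel)
    \<comment> \<open>The weight vanishes nowhere and can be divided out at each point.\<close>
    then have "summable (\<lambda>k. d k x * ?w x / ?w x)" by (rule summable_divide)
    then have "summable (\<lambda>k. d k x)" by simp
    then have "convergent (\<lambda>n. \<Sum>k<n. d k x)" by (simp add: summable_iff_convergent)
    then have "convergent (\<lambda>n. u (r n) x - u (r 0) x)"
      unfolding d_def by (subst (asm) sum_lessThan_telescope)
    then have "convergent (\<lambda>n. (u (r n) x - u (r 0) x) + u (r 0) x)"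
      by (intro convergent_add convergent_const)
    then show ?case by simp
  qed
  define f where "f x = lim (\<lambda>k. u (r k) x)" for x
  have f [measurable]: "f \<in> borel_measurable lebesgue"
    unfolding f_def by measurable
  have lim: "AE x in lebesgue. (\<lambda>k. u (r k) x) \<longlonglongrightarrow> f x"
    using conv by eventually_elim (simp add: f_def convergent_LIMSEQ_iff)
  have near: "L2_norm (\<lambda>x. u n x - f x) \<le> (1/2)^k \<and> (\<lambda>x. u n x - f x) \<in> L2_space" if "n \<ge> r k" for n k
  proof -
    have "AE x in lebesgue. (\<lambda>j. u n x - u (r (j + k)) x) \<longlonglongrightarrow> u n x - f x"
      using lim by eventually_elim (intro tendsto_diff tendsto_const LIMSEQ_ignore_initial_segment)
    moreover have "L2_norm (\<lambda>x. u n x - u (r (j + k)) x) \<le> (1/2)^k" for j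
      using r[of k n "r (j + k)"] that sm by (auto simp: strict_mono_less_eq less_imp_le)
    ultimately show ?thesis
      using L2_fatou[where u = "\<lambda>j x. u n x - u (r (j + k)) x" and f = "\<lambda>x. u n x - f x" and C = "(1/2)^k"]
        L2_diff[OF u u] by simp
  qed
  have fL2: "f \<in> L2_space"
    using L2_diff[OF u conjunct2[OF near[of 0 "r 0"]], of "r 0"] by simp
  have "L2_tendsto u f"
  proof (rule L2_tendstoI[OF u fL2], rule LIMSEQ_I)
    fix e :: real assume "e > 0"
    then obtain k where "(1/2)^k < e" using real_arch_pow_inv[of e "1/2"] by auto
    then have "norm (L2_norm (\<lambda>x. u n x - f x) - 0) < e" if "n \<ge> r k" for n
      using near[OF that] by simp
    then show "\<exists>N. \<forall>n\<ge>N. norm (L2_norm (\<lambda>x. u n x - f x) - 0) < e" by blast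
  qed
  then show ?thesis by (rule that)
qed

section \<open>The Fourier transform of integrable functions\<close>

text \<open>Fubini arguments take place over products of \<open>lborel\<close>, where expressions
  such as \<open>u (s z + x)\<close> are jointly measurable for Borel \<open>u\<close>. Functions
  measurable for the completion are replaced by such a representative first.\<close>

lemma lebesgue_borel_representative:
  fixes f :: "'a::euclidean_space \<Rightarrow> complex"
  assumes "f \<in> borel_measurable lebesgue"
  obtains g where "g \<in> borel_measurable borel" "AE x in lebesgue. f x = g x"
proof -
  have "(\<lambda>x. Re (f x)) \<in> borel_measurable lebesgue" "(\<lambda>x. Im (f x)) \<in> borel_measurable lebesgue"
    using assms by (auto intro: borel_measurable_Re borel_measurable_Im)
  from this[THEN completion_ex_borel_measurable_real] obtain a b
    where ab [measurable]: "a \<in> borel_measurable lborel" "b \<in> borel_measurable lborel"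
      and AE: "AE x in lborel. Re (f x) = a x" "AE x in lborel. Im (f x) = b x" by blast
  show ?thesis
  proof (rule that)
    have [measurable]: "a \<in> borel_measurable borel" "b \<in> borel_measurable borel" using ab by simp_all
    show "(\<lambda>x. complex_of_real (a x) + \<i> * complex_of_real (b x)) \<in> borel_measurable borel" by measurable
    have "AE x in lborel. f x = complex_of_real (a x) + \<i> * complex_of_real (b x)"
      using AE by eventually_elim (simp add: complex_eq_iff)
    then show "AE x in lebesgue. f x = complex_of_real (a x) + \<i> * complex_of_real (b x)"
      by (rule AE_completion)
  qed
qed

lemma norm_exp_minus_ii [simp]: "cmod (exp (- (\<i> * complex_of_real r))) = 1"
  by (simp add: norm_exp_eq_Re)

lemma L1_measurable: "f \<in> L1_space \<Longrightarrow> f \<in> borel_measurable lebesgue"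
  by (simp add: L1_space_def)

lemma L1_AE_cong:
  assumes "f \<in> L1_space" "AE x in lebesgue. f x = g x"
  shows "g \<in> L1_space"
  using assms integrable_cong_AE[OF _ _ assms(2)] borel_measurable_AE[OF L1_measurable[OF assms(1)] assms(2)]
  by (auto simp: L1_space_def)

lemma L1_borel_representative:
  fixes f :: "real ^ 'n \<Rightarrow> complex"
  assumes "f \<in> L1_space"
  obtains g where "g \<in> borel_measurable borel" "integrable lborel g" "AE x in lebesgue. f x = g x"
proof -
  obtain g where g: "g \<in> borel_measurable borel" "AE x in lebesgue. f x = g x"
    using lebesgue_borel_representative[OF L1_measurable[OF assms]] by blast
  then have "integrable lborel g"
    using L1_AE_cong[OF assms g(2)] by (simp add: L1_space_def integrable_completion)
  then show ?thesis using that g by blast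
qed

lemma L1_mult_bounded:
  assumes "f \<in> L1_space" "p \<in> borel_measurable lebesgue" "\<And>x. cmod (p x) \<le> C"
  shows "(\<lambda>x. p x * f x) \<in> L1_space"
proof -
  have f: "integrable lebesgue f" using assms(1) by (simp add: L1_space_def)
  note [measurable] = assms(2) borel_measurable_integrable[OF f]
  have C: "C \<ge> 0" using assms(3) norm_ge_zero order_trans by blast
  have "integrable lebesgue (\<lambda>x. p x * f x)"
  proof (rule Bochner_Integration.integrable_bound)
    show "integrable lebesgue (\<lambda>x. C * cmod (f x))" using f by simp
    show "AE x in lebesgue. norm (p x * f x) \<le> norm (C * cmod (f x))"
      using assms(3) C by (auto simp: norm_mult intro!: mult_right_mono)
  qed measurable
  then show ?thesis by (simp add: L1_space_def)
qed

lemma lborel_lebesgue_integral: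
  fixes f :: "'a::euclidean_space \<Rightarrow> 'b::{banach, second_countable_topology}"
  assumes "f \<in> borel_measurable borel"
  shows "(LINT x|lebesgue. f x) = (LINT x|lborel. f x)"
  using assms by (intro integral_completion) simp

lemma fourier_kernel_measurable [measurable]:
  "(\<lambda>x. exp (- \<i> * complex_of_real (x \<bullet> (\<xi> :: 'a::euclidean_space)))) \<in> borel_measurable borel"
  by measurable

lemma borel_imp_lebesgue_measurable:
  "f \<in> borel_measurable borel \<Longrightarrow> f \<in> borel_measurable lebesgue"
  by (rule measurable_completion) simp

lemma fourier_L1_cong_AE:
  assumes "f \<in> borel_measurable lebesgue" "AE x in lebesgue. f x = g x"
  shows "fourier_L1 f = fourier_L1 g"
proof
  fix \<xi>
  note k = borel_imp_lebesgue_measurable[OF fourier_kernel_measurable[of \<xi>]]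
  have "AE x in lebesgue. f x * exp (- \<i> * complex_of_real (x \<bullet> \<xi>)) = g x * exp (- \<i> * complex_of_real (x \<bullet> \<xi>))"
    using assms(2) by eventually_elim simp
  from integral_cong_AE[OF borel_measurable_times[OF assms(1) k]
      borel_measurable_times[OF borel_measurable_AE[OF assms] k] this]
  show "fourier_L1 f \<xi> = fourier_L1 g \<xi>" by (simp add: fourier_L1_def)
qed

lemma fourier_integrable:
  assumes "f \<in> L1_space"
  shows "integrable lebesgue (\<lambda>x. f x * exp (- \<i> * complex_of_real (x \<bullet> \<xi>)))"
  using L1_mult_bounded[OF assms borel_imp_lebesgue_measurable[OF fourier_kernel_measurable[of \<xi>]], of 1]
  by (simp add: L1_space_def mult.commute)

lemma fourier_L1_measurable:
  fixes f :: "real ^ 'n \<Rightarrow> complex"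
  assumes "f \<in> L1_space"
  shows "fourier_L1 f \<in> borel_measurable borel"
proof -
  obtain g where g [measurable]: "g \<in> borel_measurable borel" and fg: "AE x in lebesgue. f x = g x"
    using L1_borel_representative[OF assms] by blast
  have "fourier_L1 g = (\<lambda>\<xi>. complex_of_real ((2 * pi) powr (- real CARD('n) / 2)) *
     (LINT x|lborel. g x * exp (- \<i> * complex_of_real (x \<bullet> \<xi>))))"
    unfolding fourier_L1_def by (intro ext arg_cong2[where f = "(*)"] refl lborel_lebesgue_integral) measurable
  also have "\<dots> \<in> borel_measurable borel" by measurable
  finally show ?thesis using fourier_L1_cong_AE[OF L1_measurable[OF assms] fg] by simp
qed

lemma fourier_L1_bounded:
  fixes f :: "real ^ 'n \<Rightarrow> complex"
  shows "cmod (fourier_L1 f \<xi>) \<le> (2 * pi) powr (- real CARD('n) / 2) * (LINT x|lebesgue. cmod (f x))"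
proof -
  have "cmod (LINT x|lebesgue. f x * exp (- \<i> * complex_of_real (x \<bullet> \<xi>))) \<le>
      (LINT x|lebesgue. cmod (f x * exp (- \<i> * complex_of_real (x \<bullet> \<xi>))))"
    by (rule integral_norm_bound)
  then show ?thesis unfolding fourier_L1_def by (simp add: norm_mult mult_left_mono)
qed

lemma integrable_pair_kernel:
  fixes u v :: "'a::euclidean_space \<Rightarrow> complex"
  assumes u: "integrable lborel u" and v: "integrable lborel v"
    and k [measurable]: "(\<lambda>(x, y). k x y) \<in> borel_measurable (borel \<Otimes>\<^sub>M borel)" and k1: "\<And>x y. cmod (k x y) \<le> 1"
  shows "integrable (lborel \<Otimes>\<^sub>M lborel) (\<lambda>(x, y). u x * v y * k x y)"
proof -
  note [measurable] = borel_measurable_integrable[OF u] borel_measurable_integrable[OF v]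
  have m: "(\<lambda>(x, y). u x * v y * k x y) \<in> borel_measurable (lborel \<Otimes>\<^sub>M lborel)" by measurable
  have vk: "integrable lborel (\<lambda>y. u x * v y * k x y)" for x
  proof (rule Bochner_Integration.integrable_bound)
    show "integrable lborel (\<lambda>y. u x * v y)" using v by simp
    show "AE y in lborel. norm (u x * v y * k x y) \<le> norm (u x * v y)"
      using k1 by (auto simp: norm_mult intro!: mult_left_le)
  qed measurable
  show ?thesis
  proof (rule lborel_pair.Fubini_integrable[OF m])
    show "integrable lborel (\<lambda>x. LINT y|lborel. norm (case (x, y) of (x, y) \<Rightarrow> u x * v y * k x y))"
    proof (rule Bochner_Integration.integrable_bound)
      show "integrable lborel (\<lambda>x. cmod (u x) * (LINT y|lborel. cmod (v y)))" using u by simp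
      have "(LINT y|lborel. norm (u x * v y * k x y)) \<le> (LINT y|lborel. cmod (u x) * cmod (v y))" for x
        using integrable_norm[OF vk[of x]] v k1 by (intro integral_mono) (auto simp: norm_mult intro!: mult_left_le)
      then show "AE x in lborel. norm (LINT y|lborel. norm (case (x, y) of (x, y) \<Rightarrow> u x * v y * k x y))
           \<le> norm (cmod (u x) * (LINT y|lborel. cmod (v y)))" by simp
    qed measurable
  qed (use vk in auto)
qed

text \<open>Fubini, as the kernel \<open>exp (- i x . y)\<close> is symmetric in \<open>x\<close>
  and \<open>y\<close>. Both Plancherel's theorem and the inversion formula are drawn from this
  identity.\<close>

lemma fourier_multiplication_formula:
  fixes u v :: "real ^ 'n \<Rightarrow> complex"
  assumes "u \<in> L1_space" "v \<in> L1_space"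
  shows "(LINT x|lebesgue. fourier_L1 u x * v x) = (LINT x|lebesgue. u x * fourier_L1 v x)"
proof -
  obtain f where f [measurable]: "f \<in> borel_measurable borel" and fi: "integrable lborel f"
    and uf: "AE x in lebesgue. u x = f x" using L1_borel_representative[OF assms(1)] by blast
  obtain g where g [measurable]: "g \<in> borel_measurable borel" and gi: "integrable lborel g"
    and vg: "AE x in lebesgue. v x = g x" using L1_borel_representative[OF assms(2)] by blast
  have F: "fourier_L1 u = fourier_L1 f" "fourier_L1 v = fourier_L1 g"
    using assms uf vg by (auto intro: fourier_L1_cong_AE L1_measurable)
  note [measurable] = fourier_L1_measurable[OF L1_AE_cong[OF assms(1) uf]] fourier_L1_measurable[OF L1_AE_cong[OF assms(2) vg]]
     L1_measurable[OF assms(1)] L1_measurable[OF assms(2)]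
     borel_imp_lebesgue_measurable[OF f] borel_imp_lebesgue_measurable[OF g]
  have FL [measurable]: "fourier_L1 f \<in> borel_measurable lebesgue" "fourier_L1 g \<in> borel_measurable lebesgue"
    by (auto intro: borel_imp_lebesgue_measurable)
  define c where "c = complex_of_real ((2 * pi) powr (- real CARD('n) / 2))"
  let ?k = "\<lambda>(x::real^'n) y. exp (- \<i> * complex_of_real (x \<bullet> y))"
  have F_eq: "fourier_L1 h \<xi> = c * (LINT x|lborel. h x * ?k x \<xi>)" if [measurable]: "h \<in> borel_measurable borel" for h \<xi>
    unfolding fourier_L1_def c_def[symmetric] by (subst lborel_lebesgue_integral) auto
  have int: "integrable (lborel \<Otimes>\<^sub>M lborel) (\<lambda>(x, y). f x * g y * ?k x y)"
    by (rule integrable_pair_kernel[OF fi gi]) auto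
  have "(LINT x|lebesgue. fourier_L1 u x * v x) = (LINT x|lebesgue. fourier_L1 f x * g x)"
    unfolding F using vg by (intro integral_cong_AE) auto
  also have "\<dots> = (LINT y|lborel. fourier_L1 f y * g y)"
    by (rule lborel_lebesgue_integral) measurable
  also have "\<dots> = (LINT y|lborel. c * (LINT x|lborel. f x * g y * ?k x y))"
    by (intro Bochner_Integration.integral_cong refl)
      (simp add: F_eq mult_ac flip: integral_mult_left_zero integral_mult_right_zero)
  also have "\<dots> = c * (LINT y|lborel. LINT x|lborel. f x * g y * ?k x y)"
    by simp
  also have "\<dots> = c * (LINT x|lborel. LINT y|lborel. f x * g y * ?k x y)"
    using lborel_pair.Fubini_integral[OF int] by simp
  also have "\<dots> = (LINT x|lborel. c * (LINT y|lborel. f x * g y * ?k x y))"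
    by simp
  also have "\<dots> = (LINT x|lborel. f x * fourier_L1 g x)"
    by (intro Bochner_Integration.integral_cong refl)
      (simp add: F_eq mult_ac inner_commute flip: integral_mult_left_zero integral_mult_right_zero)
  also have "\<dots> = (LINT x|lebesgue. f x * fourier_L1 g x)"
    by (rule lborel_lebesgue_integral[symmetric]) measurable
  also have "\<dots> = (LINT x|lebesgue. u x * fourier_L1 v x)"
    unfolding F using uf by (intro integral_cong_AE) auto
  finally show ?thesis .
qed

lemma norm_gaussian: "cmod (gaussian \<epsilon> x) = exp (- \<epsilon> * (norm x)\<^sup>2 / 2)"
  by (simp add: gaussian_def)

section \<open>Plancherel's theorem\<close>

text \<open>The Gaussian replaces a compact cutoff. The quotient of \<open>u\<close> by the Gaussian
  is set to 0 where it is large, then approximated almost everywhere by continuous functions with a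
  common bound; both limits are dominated, by \<open>u\<close> and by a multiple of the
  Gaussian.\<close>

lemma L2_dense_continuous:
  fixes u :: "real ^ 'n \<Rightarrow> complex"
  assumes u: "u \<in> L2_space" and e: "e > 0"
  obtains \<phi> K where "continuous_on UNIV \<phi>" "\<And>x. cmod (\<phi> x) \<le> K"
    "(\<lambda>x. \<phi> x * gaussian 1 x) \<in> L2_space" "L2_norm (\<lambda>x. u x - \<phi> x * gaussian 1 x) < e"
proof -
  let ?G = "gaussian 1 :: real ^ 'n \<Rightarrow> complex"
  have G2: "?G \<in> L2_space" by (rule gaussian_L2) simp
  note [measurable] = L2_measurable[OF u] L2_measurable[OF G2]
  define t where "t n x = (if cmod (u x / ?G x) \<le> real n then u x / ?G x else 0)" for n x
  have tm [measurable]: "t n \<in> borel_measurable lebesgue" for n unfolding t_def by measurable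
  have "L2_tendsto (\<lambda>n x. t n x * ?G x) u"
  proof (rule L2_tendsto_dominated[OF _ _ u])
    show "AE x in lebesgue. (\<lambda>n. t n x * ?G x) \<longlonglongrightarrow> u x"
    proof (rule AE_I2)
      fix x
      obtain N :: nat where N: "cmod (u x / ?G x) \<le> real N" using real_arch_simple by blast
      then have "\<forall>\<^sub>F n in sequentially. u x = t n x * ?G x"
        by (intro eventually_sequentiallyI[of N]) (auto simp: t_def)
      then show "(\<lambda>n. t n x * ?G x) \<longlonglongrightarrow> u x" by (rule Lim_transform_eventually[OF tendsto_const])
    qed
    show "AE x in lebesgue. cmod (t n x * ?G x) \<le> 1 * cmod (u x)" for n
      by (auto simp: t_def)
  qed measurable
  note tu = L2_tendstoD[OF this]
  from LIMSEQ_D[OF tu(3), of "e/2"] e obtain N where N: "\<And>n. n \<ge> N \<Longrightarrow> L2_norm (\<lambda>x. t n x * ?G x - u x) < e/2"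
    by auto
  define k where "k = Suc N"
  have k: "real k > 0" "L2_norm (\<lambda>x. t k x * ?G x - u x) < e/2" using N[of k] by (auto simp: k_def)
  have tb: "cmod (t k x) \<le> real k" for x by (simp add: t_def)
  have "t k measurable_on UNIV"
    using measurable_on_iff_borel_measurable[of UNIV "t k"] by (simp add: lebesgue_on_UNIV_eq)
  then obtain Z g where Z: "negligible Z" and gc: "\<And>n. continuous_on UNIV (g n)"
    and glim: "\<And>x. x \<notin> Z \<Longrightarrow> (\<lambda>n. g n x) \<longlonglongrightarrow> t k x" unfolding measurable_on_def by auto
  \<comment> \<open>Radial projection onto the disc of radius \<open>k\<close>. It is continuous and
    fixes the values of \<open>t k\<close>, so clipping bounds the continuous approximants without
    changing their limit.\<close>
  define clip where "clip z = (real k / max (real k) (cmod z)) *\<^sub>R z" for z :: complex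
  have mx: "max (real k) (cmod z) > 0" for z :: complex using k by (simp add: less_max_iff_disj)
  have clip_cont: "continuous_on UNIV clip"
    unfolding clip_def using mx by (intro continuous_intros) (metis less_irrefl)
  have clip_le: "cmod (clip z) \<le> real k" for z
    using mx[of z] k by (simp add: clip_def divide_le_eq mult_left_mono)
  have clip_id: "clip z = z" if "cmod z \<le> real k" for z
    using that k by (simp add: clip_def max_def)
  define \<phi> where "\<phi> n x = clip (g n x)" for n x
  have \<phi>c: "continuous_on UNIV (\<phi> n)" for n
    unfolding \<phi>_def using continuous_on_compose2[OF clip_cont gc] by auto
  have [measurable]: "\<phi> n \<in> borel_measurable lebesgue" for n
    using \<phi>c by (intro borel_imp_lebesgue_measurable borel_measurable_continuous_onI)
  have "L2_tendsto (\<lambda>n x. \<phi> n x * ?G x) (\<lambda>x. t k x * ?G x)"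
  proof (rule L2_tendsto_dominated[OF _ _ G2])
    have "AE x in lebesgue. x \<notin> Z"
      using Z by (simp add: AE_not_in negligible_iff_null_sets)
    then show "AE x in lebesgue. (\<lambda>n. \<phi> n x * ?G x) \<longlonglongrightarrow> t k x * ?G x"
    proof eventually_elim
      case (elim x)
      have "(\<lambda>n. clip (g n x)) \<longlonglongrightarrow> clip (t k x)"
        using clip_cont glim[OF elim] by (intro isCont_tendsto_compose[of _ clip]) (auto simp: continuous_on_eq_continuous_at)
      then show ?case unfolding \<phi>_def clip_id[OF tb] by (intro tendsto_intros)
    qed
    show "AE x in lebesgue. cmod (\<phi> n x * ?G x) \<le> real k * cmod (?G x)" for n
      using clip_le by (auto simp: \<phi>_def norm_mult intro!: mult_right_mono)
  qed measurable
  note pt = L2_tendstoD[OF this]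
  from LIMSEQ_D[OF pt(3), of "e/2"] e obtain n where n: "L2_norm (\<lambda>x. \<phi> n x * ?G x - t k x * ?G x) < e/2"
    by auto
  have "L2_norm (\<lambda>x. u x - \<phi> n x * ?G x) < e"
    using L2_norm_triangle_diff[OF pt(1,2) u, of n] n k(2) by (simp add: L2_norm_minus_commute[of u])
  then show ?thesis using that[of "\<phi> n" "real k"] \<phi>c clip_le pt(1) by (auto simp: \<phi>_def)
qed

text \<open>Three-epsilon argument: translation is an isometry, so \<open>u\<close> may be exchanged
  for a nearby product \<open>v\<close> of a bounded continuous function and a Gaussian, for which
  dominated convergence applies.\<close>

lemma L2_tendsto_translate:
  fixes u :: "real ^ 'n \<Rightarrow> complex"
  assumes u: "u \<in> L2_space" and h: "h \<longlonglongrightarrow> 0"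
  shows "L2_tendsto (\<lambda>n x. u (h n + x)) u"
proof (rule L2_tendstoI[OF _ u])
  have tr: "(\<lambda>x. v (a + x)) \<in> L2_space" "L2_norm (\<lambda>x. v (a + x)) = L2_norm v" if "v \<in> L2_space" for v a
    using L2_unit_affine[of 1 v a] that by auto
  show "(\<lambda>x. u (h n + x)) \<in> L2_space" for n using tr u by blast
  obtain R where R: "R > 0" "\<And>n. norm (h n) \<le> R"
    using BseqE[OF convergent_imp_Bseq[OF convergentI[OF h]]] by blast
  show "(\<lambda>n. L2_norm (\<lambda>x. u (h n + x) - u x)) \<longlonglongrightarrow> 0"
  proof (rule LIMSEQ_I)
    fix e :: real assume e: "e > 0"
    then obtain \<phi> K where \<phi>: "continuous_on UNIV \<phi>" "\<And>x. cmod (\<phi> x) \<le> K"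
      and vL: "(\<lambda>x. \<phi> x * gaussian 1 x) \<in> L2_space" and uv: "L2_norm (\<lambda>x. u x - \<phi> x * gaussian 1 x) < e/3"
      using L2_dense_continuous[OF u, of "e/3"] by auto
    define v where "v x = \<phi> x * gaussian 1 x" for x
    have v: "v \<in> L2_space" using vL by (simp add: v_def[abs_def])
    have vc: "isCont v x" for x
      unfolding v_def[abs_def] gaussian_def using \<phi>(1)
      by (auto simp: continuous_on_eq_continuous_at intro!: continuous_intros)
    have "L2_tendsto (\<lambda>n x. v (h n + x)) v"
    proof (rule L2_tendsto_dominated[OF _ L2_measurable[OF v] gaussian_L2[of "1/2"]])
      show "(\<lambda>x. v (h n + x)) \<in> borel_measurable lebesgue" for n using L2_measurable tr v by blast
      show "AE x in lebesgue. (\<lambda>n. v (h n + x)) \<longlonglongrightarrow> v x"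
      proof (rule AE_I2)
        fix x
        have "(\<lambda>n. h n + x) \<longlonglongrightarrow> 0 + x" by (intro tendsto_intros h)
        then show "(\<lambda>n. v (h n + x)) \<longlonglongrightarrow> v x" using isCont_tendsto_compose[OF vc] by simp
      qed
      \<comment> \<open>A majorant common to all translates:
        \<open>|x|^2 \<le> 2 |h n + x|^2 + 2 R^2\<close> bounds each translated Gaussian by a
        multiple of the wider \<open>gaussian (1/2)\<close>.\<close>
      have "cmod (v (h n + x)) \<le> K * exp (R\<^sup>2 / 2) * cmod (gaussian (1/2) x)" for n x
      proof -
        have "norm x \<le> norm (h n + x) + norm (h n)" by (metis add_diff_cancel_left' norm_triangle_ineq4 add.commute)
        then have "(norm x)\<^sup>2 \<le> (norm (h n + x) + norm (h n))\<^sup>2" by (rule power_mono) simp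
        also have "\<dots> \<le> 2 * (norm (h n + x))\<^sup>2 + 2 * (norm (h n))\<^sup>2"
          using sum_squares_bound[of "norm (h n + x)" "norm (h n)"] by (simp add: power2_sum)
        finally have "(norm x)\<^sup>2 \<le> 2 * (norm (h n + x))\<^sup>2 + 2 * R\<^sup>2"
          using power_mono[OF R(2), of n 2] by simp
        then have "exp (- (norm (h n + x))\<^sup>2 / 2) \<le> exp (R\<^sup>2 / 2 - (norm x)\<^sup>2 / 4)" by simp
        also have "\<dots> = exp (R\<^sup>2 / 2) * cmod (gaussian (1/2) x)"
          unfolding norm_gaussian exp_add[symmetric] by simp
        finally have le: "exp (- (norm (h n + x))\<^sup>2 / 2) \<le> exp (R\<^sup>2 / 2) * cmod (gaussian (1/2) x)" .
        have "K \<ge> 0" using \<phi>(2)[of 0] norm_ge_zero order_trans by blast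
        then have "cmod (\<phi> (h n + x)) * exp (- (norm (h n + x))\<^sup>2 / 2) \<le> K * (exp (R\<^sup>2 / 2) * cmod (gaussian (1/2) x))"
          by (intro mult_mono \<phi>(2) le) auto
        then show ?thesis by (simp add: v_def norm_mult gaussian_def mult.assoc)
      qed
      then show "AE x in lebesgue. cmod (v (h n + x)) \<le> K * exp (R\<^sup>2 / 2) * cmod (gaussian (1/2) x)" for n
        by simp
    qed simp
    from LIMSEQ_D[OF L2_tendstoD(3)[OF this], of "e/3"] e
    obtain N where N: "\<And>n. n \<ge> N \<Longrightarrow> L2_norm (\<lambda>x. v (h n + x) - v x) < e/3" by auto
    have "L2_norm (\<lambda>x. u (h n + x) - u x) < e" if "n \<ge> N" for n
    proof -
      have "L2_norm (\<lambda>x. u (h n + x) - v (h n + x)) = L2_norm (\<lambda>x. u x - v x)"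
        using tr(2)[OF L2_diff[OF u v]] by simp
      moreover have "L2_norm (\<lambda>x. u (h n + x) - u x) \<le> L2_norm (\<lambda>x. u (h n + x) - v (h n + x)) + L2_norm (\<lambda>x. v (h n + x) - u x)"
        by (intro L2_norm_triangle_diff tr u v)
      moreover have "L2_norm (\<lambda>x. v (h n + x) - u x) \<le> L2_norm (\<lambda>x. v (h n + x) - v x) + L2_norm (\<lambda>x. v x - u x)"
        by (intro L2_norm_triangle_diff tr u v)
      moreover have "L2_norm (\<lambda>x. u x - v x) < e/3" using uv by (simp add: v_def)
      ultimately show ?thesis using N[OF that] L2_norm_minus_commute[of u v] by linarith
    qed
    then show "\<exists>N. \<forall>n\<ge>N. norm (L2_norm (\<lambda>x. u (h n + x) - u x) - 0) < e" by auto
  qed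
qed

lemma lborel_integral_affine:
  fixes f :: "'a::euclidean_space \<Rightarrow> 'b::{banach, second_countable_topology}"
  assumes [measurable]: "f \<in> borel_measurable borel" and s: "s > 0"
  shows "(LINT x|lborel. f x) = s ^ DIM('a) *\<^sub>R (LINT z|lborel. f (t + s *\<^sub>R z))"
proof -
  have "(LINT x|lborel. f x) = (LINT x|density (distr lborel borel (\<lambda>x. t + s *\<^sub>R x)) (\<lambda>_. \<bar>s\<bar> ^ DIM('a)). f x)"
    using lborel_affine[of s t] s by simp
  also have "\<dots> = (LINT x|distr lborel borel (\<lambda>x. t + s *\<^sub>R x). \<bar>s\<bar> ^ DIM('a) *\<^sub>R f x)"
    by (subst integral_density) auto
  also have "\<dots> = (LINT z|lborel. \<bar>s\<bar> ^ DIM('a) *\<^sub>R f (t + s *\<^sub>R z))"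
    by (subst integral_distr) auto
  finally show ?thesis using s by simp
qed

lemma fourier_const: "(2 * pi) powr (- real n / 2) = 1 / sqrt (2 * pi) ^ n"
proof -
  have "sqrt (2 * pi) ^ n = sqrt (2 * pi) powr real n" by (simp add: powr_realpow)
  also have "\<dots> = ((2 * pi) powr (1 / 2)) powr real n" by (simp only: powr_half_sqrt pi_ge_zero mult_nonneg_nonneg zero_le_numeral)
  also have "\<dots> = (2 * pi) powr (real n / 2)" by (simp only: powr_powr) simp
  finally show ?thesis by (simp add: powr_minus_divide)
qed

text \<open>Up to the factor \<open>sqrt (2 * pi) ^ d\<close> the right-hand side is an approximate
  identity centred at \<open>x\<close>, of width \<open>sqrt \<epsilon>\<close>. Pairing it with
  \<open>u\<close> averages \<open>u\<close> around \<open>x\<close>.\<close>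

lemma fourier_L1_gaussian_modulated:
  fixes x y :: "real ^ 'n"
  assumes "\<epsilon> > 0"
  shows "fourier_L1 (\<lambda>\<xi>. gaussian \<epsilon> \<xi> * exp (\<i> * complex_of_real (\<xi> \<bullet> x))) y =
    complex_of_real ((1 / sqrt \<epsilon>) ^ CARD('n)) * gaussian (1 / \<epsilon>) (y - x)"
proof -
  have "(LINT \<xi>|lebesgue. gaussian \<epsilon> \<xi> * exp (\<i> * complex_of_real (\<xi> \<bullet> x)) * exp (- \<i> * complex_of_real (\<xi> \<bullet> y))) =
    (LINT \<xi>|lborel. gaussian \<epsilon> \<xi> * exp (\<i> * complex_of_real (\<xi> \<bullet> x)) * exp (- \<i> * complex_of_real (\<xi> \<bullet> y)))"
    by (rule lborel_lebesgue_integral) measurable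
  also have "\<dots> = (LINT \<xi>|lborel. gaussian \<epsilon> \<xi> * exp (- \<i> * complex_of_real (\<xi> \<bullet> (y - x))))"
    by (simp add: mult.assoc inner_diff_right algebra_simps flip: exp_add)
  also have "\<dots> = complex_of_real (sqrt (2 * pi / \<epsilon>) ^ CARD('n)) * gaussian (1 / \<epsilon>) (y - x)"
    using gaussian_fourier_integral(2)[OF assms, of "y - x"] by simp
  finally show ?thesis
    unfolding fourier_L1_def fourier_const by (simp add: real_sqrt_divide power_divide)
qed

lemma gaussian_measurable_lebesgue [measurable]: "gaussian \<epsilon> \<in> borel_measurable lebesgue"
  by (rule borel_imp_lebesgue_measurable) measurable

lemma fourier_L1_measurable_lebesgue:
  "f \<in> L1_space \<Longrightarrow> fourier_L1 f \<in> borel_measurable lebesgue"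
  by (intro borel_imp_lebesgue_measurable fourier_L1_measurable)

text \<open>The multiplication formula, applied to \<open>u\<close> and to the conjugate of its
  transform times a Gaussian, moves one transform onto the second factor. That transform is a
  Gaussian average of translates of the conjugate of \<open>u\<close>, and Fubini brings out the
  autocorrelation.\<close>

lemma gaussian_regularized_energy:
  fixes u :: "real ^ 'n \<Rightarrow> complex"
  assumes um [measurable]: "u \<in> borel_measurable borel" and u1: "u \<in> L1_space" and u2: "u \<in> L2_space" and s: "s > 0"
  shows "integrable lebesgue (\<lambda>\<xi>. (cmod (fourier_L1 u \<xi>))\<^sup>2 * exp (- s\<^sup>2 * (norm \<xi>)\<^sup>2 / 2))" (is ?int)
    and "complex_of_real (LINT \<xi>|lebesgue. (cmod (fourier_L1 u \<xi>))\<^sup>2 * exp (- s\<^sup>2 * (norm \<xi>)\<^sup>2 / 2)) =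
      (LINT z|lborel. gaussian 1 z * L2_inner u (\<lambda>x. u (s *\<^sub>R z + x))) / complex_of_real (sqrt (2 * pi) ^ CARD('n))"
      (is ?eq)
proof -
  let ?F = "fourier_L1 u"
  let ?c = "complex_of_real (1 / sqrt (2 * pi) ^ CARD('n))"
  have Fm [measurable]: "?F \<in> borel_measurable borel" by (rule fourier_L1_measurable[OF u1])
  have FmL [measurable]: "?F \<in> borel_measurable lebesgue" by (rule fourier_L1_measurable_lebesgue[OF u1])
  define M where "M = (2 * pi) powr (- real CARD('n) / 2) * (LINT x|lebesgue. cmod (u x))"
  have Fb: "cmod (?F \<xi>) \<le> M" for \<xi> unfolding M_def by (rule fourier_L1_bounded)
  have e: "s\<^sup>2 > 0" using s by simp
  have G1: "(\<lambda>\<xi>. cnj (?F \<xi>) * gaussian (s\<^sup>2) \<xi>) \<in> L1_space"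
    by (rule L1_mult_bounded[OF gaussian_L1[OF e], where C = M]) (use Fb in auto)
  have G2: "(\<lambda>\<xi>. gaussian (s\<^sup>2) \<xi> * exp (\<i> * complex_of_real (\<xi> \<bullet> x))) \<in> L1_space" for x :: "real ^ 'n"
  proof -
    have "(\<lambda>\<xi>. exp (\<i> * complex_of_real (\<xi> \<bullet> x))) \<in> borel_measurable lebesgue"
      by (rule borel_imp_lebesgue_measurable) measurable
    from L1_mult_bounded[OF gaussian_L1[OF e] this, of 1] show ?thesis by (simp add: mult.commute)
  qed
  have eqF: "?F \<xi> * (cnj (?F \<xi>) * gaussian (s\<^sup>2) \<xi>) = complex_of_real ((cmod (?F \<xi>))\<^sup>2 * exp (- s\<^sup>2 * (norm \<xi>)\<^sup>2 / 2))" for \<xi>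
    by (simp add: gaussian_def mult.assoc[symmetric] complex_norm_square[symmetric])
  have "(\<lambda>\<xi>. ?F \<xi> * (cnj (?F \<xi>) * gaussian (s\<^sup>2) \<xi>)) \<in> L1_space"
    by (rule L1_mult_bounded[OF G1, where C = M]) (use Fb in auto)
  then show ?int unfolding eqF L1_space_def by (simp only: mem_Collect_eq complex_of_real_integrable_eq)
  \<comment> \<open>After conjugation this is a pairing of the transform of \<open>u\<close> with a
    modulated Gaussian, so the multiplication formula applies a second time and the only transform
    left is that of the Gaussian.\<close>
  have inner: "fourier_L1 (\<lambda>\<xi>. cnj (?F \<xi>) * gaussian (s\<^sup>2) \<xi>) x =
      ?c * (LINT z|lborel. cnj (u (s *\<^sub>R z + x)) * gaussian 1 z)" for x
  proof -
    have "(LINT \<xi>|lebesgue. cnj (?F \<xi>) * gaussian (s\<^sup>2) \<xi> * exp (- \<i> * complex_of_real (\<xi> \<bullet> x))) =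
       (LINT \<xi>|lebesgue. cnj (?F \<xi> * (gaussian (s\<^sup>2) \<xi> * exp (\<i> * complex_of_real (\<xi> \<bullet> x)))))"
      by (intro Bochner_Integration.integral_cong refl) (simp add: gaussian_def exp_cnj)
    also have "\<dots> = cnj (LINT \<xi>|lebesgue. ?F \<xi> * (gaussian (s\<^sup>2) \<xi> * exp (\<i> * complex_of_real (\<xi> \<bullet> x))))"
      by (rule Bochner_Integration.integral_cnj)
    also have "(LINT \<xi>|lebesgue. ?F \<xi> * (gaussian (s\<^sup>2) \<xi> * exp (\<i> * complex_of_real (\<xi> \<bullet> x)))) =
      (LINT y|lebesgue. u y * (complex_of_real ((1 / sqrt (s\<^sup>2)) ^ CARD('n)) * gaussian (1 / s\<^sup>2) (y - x)))"
      unfolding fourier_multiplication_formula[OF u1 G2] fourier_L1_gaussian_modulated[OF e] ..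
    also have "\<dots> = (LINT y|lborel. u y * (complex_of_real ((1 / s) ^ CARD('n)) * gaussian (1 / s\<^sup>2) (y - x)))"
      using s by (subst lborel_lebesgue_integral) auto
    \<comment> \<open>Substituting \<open>y = x + s z\<close> turns the Gaussian of width
      \<open>s\<close> into the fixed weight \<open>gaussian 1 z\<close>; the Jacobian
      \<open>s ^ d\<close> cancels \<open>(1 / s) ^ d\<close>.\<close>
    also have "\<dots> = s ^ DIM(real ^ 'n) *\<^sub>R (LINT z|lborel. u (x + s *\<^sub>R z) * (complex_of_real ((1 / s) ^ CARD('n)) * gaussian (1 / s\<^sup>2) ((x + s *\<^sub>R z) - x)))"
      by (rule lborel_integral_affine[OF _ s]) measurable
    also have "\<dots> = (LINT z|lborel. s ^ DIM(real ^ 'n) *\<^sub>R (u (x + s *\<^sub>R z) * (complex_of_real ((1 / s) ^ CARD('n)) * gaussian (1 / s\<^sup>2) ((x + s *\<^sub>R z) - x))))"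
      by simp
    also have "\<dots> = (LINT z|lborel. u (s *\<^sub>R z + x) * gaussian 1 z)"
    proof (intro Bochner_Integration.integral_cong refl)
      fix z :: "real ^ 'n"
      have "gaussian (1 / s\<^sup>2) (x + s *\<^sub>R z - x) = gaussian 1 z"
        using s by (simp add: gaussian_def power_mult_distrib)
      moreover have "s ^ CARD('n) *\<^sub>R (a * (complex_of_real ((1 / s) ^ CARD('n)) * b)) = a * b" for a b
        using s by (simp add: scaleR_conv_of_real power_divide)
      ultimately show "s ^ DIM(real ^ 'n) *\<^sub>R (u (x + s *\<^sub>R z) * (complex_of_real ((1 / s) ^ CARD('n)) * gaussian (1 / s\<^sup>2) (x + s *\<^sub>R z - x))) =
        u (s *\<^sub>R z + x) * gaussian 1 z"
        by (simp add: add.commute)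
    qed
    also have "cnj \<dots> = (LINT z|lborel. cnj (u (s *\<^sub>R z + x) * gaussian 1 z))"
      by (rule Bochner_Integration.integral_cnj[symmetric])
    also have "\<dots> = (LINT z|lborel. cnj (u (s *\<^sub>R z + x)) * gaussian 1 z)"
      by (intro Bochner_Integration.integral_cong refl) (simp add: gaussian_def)
    finally show ?thesis unfolding fourier_L1_def fourier_const by simp
  qed
  let ?H = "\<lambda>z x. u x * cnj (u (s *\<^sub>R z + x)) * gaussian 1 z"
  have ua: "(\<lambda>x. u (a + x)) \<in> L2_space" "L2_norm (\<lambda>x. u (a + x)) = L2_norm u" for a
    using L2_unit_affine[of 1 u a] u2 by auto
  have ip: "integrable lborel (\<lambda>x. u x * cnj (u (a + x)))" for a
    using L2_inner_integrable[OF u2 ua(1)] by (subst (asm) integrable_completion) auto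
  have ipn: "(LINT x|lborel. cmod (u x * cnj (u (a + x)))) \<le> (L2_norm u)\<^sup>2" for a
  proof -
    have "(LINT x|lborel. cmod (u x * cnj (u (a + x)))) = (LINT x|lebesgue. cmod (u x * cnj (u (a + x))))"
      by (rule lborel_lebesgue_integral[symmetric]) measurable
    also have "\<dots> \<le> L2_norm u * L2_norm (\<lambda>x. cnj (u (a + x)))"
      by (intro L2_Cauchy_Schwarz_abs u2 L2_cnj ua)
    finally show ?thesis by (simp add: L2_norm_cnj ua power2_eq_square)
  qed
  \<comment> \<open>By Cauchy-Schwarz the integral over \<open>x\<close> is at most
    \<open>(L2_norm u)^2\<close> times the Gaussian in \<open>z\<close>, which is
    integrable.\<close>
  have Hint: "integrable (lborel \<Otimes>\<^sub>M lborel) (\<lambda>(z, x). ?H z x)"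
  proof (rule lborel_pair.Fubini_integrable)
    show "(\<lambda>(z, x). ?H z x) \<in> borel_measurable (lborel \<Otimes>\<^sub>M lborel)" by measurable
    show "integrable lborel (\<lambda>z. LINT x|lborel. norm (case (z, x) of (z, x) \<Rightarrow> ?H z x))"
    proof (rule Bochner_Integration.integrable_bound)
      show "integrable lborel (\<lambda>z::real^'n. (L2_norm u)\<^sup>2 * cmod (gaussian 1 z))"
        by (intro integrable_mult_right integrable_norm gaussian_integrable) simp
      have "(LINT x|lborel. norm (?H z x)) \<le> (L2_norm u)\<^sup>2 * cmod (gaussian 1 z)" for z
        using ipn[of "s *\<^sub>R z"] by (simp add: norm_mult mult_right_mono)
      then show "AE z in lborel. norm (LINT x|lborel. norm (case (z, x) of (z, x) \<Rightarrow> ?H z x)) \<le> norm ((L2_norm u)\<^sup>2 * cmod (gaussian 1 z))"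
        by simp
    qed measurable
  qed (use ip in simp)
  have "complex_of_real (LINT \<xi>|lebesgue. (cmod (?F \<xi>))\<^sup>2 * exp (- s\<^sup>2 * (norm \<xi>)\<^sup>2 / 2)) =
      (LINT \<xi>|lebesgue. ?F \<xi> * (cnj (?F \<xi>) * gaussian (s\<^sup>2) \<xi>))"
    unfolding eqF by (rule integral_complex_of_real[symmetric])
  also have "\<dots> = (LINT x|lebesgue. u x * (?c * (LINT z|lborel. cnj (u (s *\<^sub>R z + x)) * gaussian 1 z)))"
    unfolding fourier_multiplication_formula[OF u1 G1] inner ..
  also have "\<dots> = (LINT x|lborel. u x * (?c * (LINT z|lborel. cnj (u (s *\<^sub>R z + x)) * gaussian 1 z)))"
    by (rule lborel_lebesgue_integral) measurable
  also have "\<dots> = (LINT x|lborel. ?c * (LINT z|lborel. ?H z x))"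
    by (intro Bochner_Integration.integral_cong refl) (simp add: mult_ac flip: integral_mult_right_zero)
  also have "\<dots> = ?c * (LINT x|lborel. LINT z|lborel. ?H z x)" by simp
  also have "(LINT x|lborel. LINT z|lborel. ?H z x) = (LINT z|lborel. LINT x|lborel. ?H z x)"
    by (rule lborel_pair.Fubini_integral[OF Hint])
  also have "\<dots> = (LINT z|lborel. gaussian 1 z * L2_inner u (\<lambda>x. u (s *\<^sub>R z + x)))"
  proof (intro Bochner_Integration.integral_cong refl)
    fix z
    have "L2_inner u (\<lambda>x. u (s *\<^sub>R z + x)) = (LINT x|lborel. u x * cnj (u (s *\<^sub>R z + x)))"
      unfolding L2_inner_def by (rule lborel_lebesgue_integral) measurable
    then show "(LINT x|lborel. ?H z x) = gaussian 1 z * L2_inner u (\<lambda>x. u (s *\<^sub>R z + x))" by simp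
  qed
  finally show ?eq by simp
qed

text \<open>The regularized energy is taken along \<open>s n = 1 / (n + 1)\<close>. On the side of
  the autocorrelation dominated convergence gives the limit \<open>(L2_norm v)^2\<close>; on the
  Fourier side the damping factors increase to 1.\<close>

theorem plancherel_L1_L2:
  fixes u :: "real ^ 'n \<Rightarrow> complex"
  assumes "u \<in> L1_space" "u \<in> L2_space"
  shows "fourier_L1 u \<in> L2_space" "L2_norm (fourier_L1 u) = L2_norm u"
proof -
  obtain v where v [measurable]: "v \<in> borel_measurable borel" and uv: "AE x in lebesgue. u x = v x"
    using L1_borel_representative[OF assms(1)] by blast
  have v1: "v \<in> L1_space" and v2: "v \<in> L2_space"
    using L1_AE_cong[OF assms(1) uv] L2_AE_cong[OF assms(2) uv] .
  have Feq: "fourier_L1 u = fourier_L1 v" by (rule fourier_L1_cong_AE[OF L1_measurable[OF assms(1)] uv])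
  let ?F = "fourier_L1 v"
  let ?C = "complex_of_real (sqrt (2 * pi) ^ CARD('n))"
  define s where "s n = 1 / real (Suc n)" for n
  have s: "s n > 0" "s \<longlonglongrightarrow> 0" for n
    using LIMSEQ_Suc[OF lim_1_over_n] by (auto simp: s_def[abs_def])
  have FmL [measurable]: "?F \<in> borel_measurable lebesgue" by (rule fourier_L1_measurable_lebesgue[OF v1])
  define E where "E n \<xi> = (cmod (?F \<xi>))\<^sup>2 * exp (- (s n)\<^sup>2 * (norm \<xi>)\<^sup>2 / 2)" for n \<xi>
  have va: "(\<lambda>x. v (a + x)) \<in> L2_space" "L2_norm (\<lambda>x. v (a + x)) = L2_norm v" for a
    using L2_unit_affine[of 1 v a] v2 by auto
  let ?W = "\<lambda>h. L2_inner v (\<lambda>x. v (h + x))"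
  have Wlim: "(\<lambda>n. ?W (s n *\<^sub>R z)) \<longlonglongrightarrow> L2_inner v v" for z
  proof -
    have "(\<lambda>n. s n *\<^sub>R z) \<longlonglongrightarrow> 0 *\<^sub>R z" by (intro tendsto_intros s)
    then have "L2_tendsto (\<lambda>n x. v (s n *\<^sub>R z + x)) v" by (intro L2_tendsto_translate v2) simp
    moreover have "L2_tendsto (\<lambda>n. v) v" by (rule L2_tendstoI) (auto simp: v2 L2_norm_def)
    ultimately show ?thesis by (intro L2_tendsto_inner)
  qed
  have Wm [measurable]: "?W \<in> borel_measurable borel"
  proof -
    have "?W h = (LINT x|lborel. v x * cnj (v (h + x)))" for h
      unfolding L2_inner_def by (rule lborel_lebesgue_integral) measurable
    then have "?W = (\<lambda>h. LINT x|lborel. v x * cnj (v (h + x)))" by auto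
    also have "\<dots> \<in> borel_measurable borel" by measurable
    finally show ?thesis .
  qed
  have gi: "integrable lborel (gaussian 1 :: real ^ 'n \<Rightarrow> complex)" by (rule gaussian_integrable) simp
  have "(\<lambda>n. LINT z|lborel. gaussian 1 z * ?W (s n *\<^sub>R z)) \<longlonglongrightarrow> (LINT z::real^'n|lborel. gaussian 1 z * L2_inner v v)"
  proof (rule integral_dominated_convergence[where w = "\<lambda>z. cmod (gaussian 1 z) * (L2_norm v)\<^sup>2"])
    show "integrable lborel (\<lambda>z::real^'n. cmod (gaussian 1 z) * (L2_norm v)\<^sup>2)" using integrable_norm[OF gi] by simp
    show "AE z in lborel. (\<lambda>n. gaussian 1 z * ?W (s n *\<^sub>R z)) \<longlonglongrightarrow> gaussian 1 z * L2_inner v v"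
      using Wlim by (auto intro!: tendsto_intros)
    show "AE z in lborel. norm (gaussian 1 z * ?W (s n *\<^sub>R z)) \<le> cmod (gaussian 1 z) * (L2_norm v)\<^sup>2" for n
      using L2_Cauchy_Schwarz[OF v2 va(1)] by (auto simp: norm_mult va(2) power2_eq_square intro!: mult_left_mono)
  qed measurable
  also have "(LINT z::real^'n|lborel. gaussian 1 z * L2_inner v v) = ?C * complex_of_real ((L2_norm v)\<^sup>2)"
    using gaussian_fourier_integral(2)[of 1 "0 :: real ^ 'n"] by (simp add: L2_inner_self gaussian_def)
  finally have "(\<lambda>n. (LINT z|lborel. gaussian 1 z * ?W (s n *\<^sub>R z)) / ?C) \<longlonglongrightarrow> ?C * complex_of_real ((L2_norm v)\<^sup>2) / ?C"
    by (intro tendsto_divide tendsto_const) auto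
  then have "(\<lambda>n. complex_of_real (LINT \<xi>|lebesgue. E n \<xi>)) \<longlonglongrightarrow> complex_of_real ((L2_norm v)\<^sup>2)"
    unfolding E_def by (subst gaussian_regularized_energy(2)[OF v v1 v2 s(1)]) simp
  then have Elim: "(\<lambda>n. LINT \<xi>|lebesgue. E n \<xi>) \<longlonglongrightarrow> (L2_norm v)\<^sup>2"
    by (simp only: tendsto_of_real_iff)
  have Ei: "integrable lebesgue (E n)" for n
    unfolding E_def[abs_def] by (rule gaussian_regularized_energy(1)[OF v v1 v2 s(1)])
  have Emono: "mono (\<lambda>n. E n \<xi>)" for \<xi>
  proof (rule monoI)
    fix m n :: nat assume "m \<le> n"
    then have "s n \<le> s m" by (simp add: s_def frac_le)
    then have "(s n)\<^sup>2 \<le> (s m)\<^sup>2" using s(1)[of n] by (intro power_mono) auto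
    then show "E m \<xi> \<le> E n \<xi>" unfolding E_def by (intro mult_left_mono) (auto intro!: mult_right_mono)
  qed
  have Econv: "(\<lambda>n. E n \<xi>) \<longlonglongrightarrow> (cmod (?F \<xi>))\<^sup>2" for \<xi>
  proof -
    have "(\<lambda>n. E n \<xi>) \<longlonglongrightarrow> (cmod (?F \<xi>))\<^sup>2 * exp (- (0::real)\<^sup>2 * (norm \<xi>)\<^sup>2 / 2)"
      unfolding E_def by (intro tendsto_intros s) simp
    then show ?thesis by simp
  qed
  have m: "(\<lambda>\<xi>. (cmod (?F \<xi>))\<^sup>2) \<in> borel_measurable lebesgue" by measurable
  have AE: "AE \<xi> in lebesgue. mono (\<lambda>n. E n \<xi>)" "AE \<xi> in lebesgue. (\<lambda>n. E n \<xi>) \<longlonglongrightarrow> (cmod (?F \<xi>))\<^sup>2"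
    using Emono Econv by auto
  \<comment> \<open>Monotone convergence yields the integrability of the square of the transform
    together with its integral; neither is known beforehand.\<close>
  note mc = integrable_monotone_convergence[OF Ei AE Elim m] integral_monotone_convergence[OF Ei AE Elim m]
  show "fourier_L1 u \<in> L2_space" unfolding Feq using mc(1) FmL by (simp add: L2_space_def)
  have "L2_norm ?F = L2_norm v" unfolding L2_norm_def[of ?F] mc(2) by simp
  then show "L2_norm (fourier_L1 u) = L2_norm u" unfolding Feq using L2_norm_cong_AE[OF uv] by simp
qed

section \<open>The Fourier transform of square integrable functions\<close>

lemma fourier_L1_add:
  assumes "f \<in> L1_space" "g \<in> L1_space"
  shows "fourier_L1 (\<lambda>x. f x + g x) \<xi> = fourier_L1 f \<xi> + fourier_L1 g \<xi>"
  unfolding fourier_L1_def distrib_right distrib_left[symmetric]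
  by (simp only: Bochner_Integration.integral_add[OF assms[THEN fourier_integrable, of \<xi>]])

lemma fourier_L1_cmult: "fourier_L1 (\<lambda>x. c * f x) \<xi> = c * fourier_L1 f \<xi>"
proof -
  have "(LINT x|lebesgue. c * f x * exp (- \<i> * complex_of_real (x \<bullet> \<xi>))) =
      c * (LINT x|lebesgue. f x * exp (- \<i> * complex_of_real (x \<bullet> \<xi>)))"
    unfolding mult.assoc by (rule integral_mult_right_zero)
  then show ?thesis by (simp only: fourier_L1_def mult.left_commute)
qed

lemma fourier_L1_diff:
  assumes "f \<in> L1_space" "g \<in> L1_space"
  shows "fourier_L1 (\<lambda>x. f x - g x) \<xi> = fourier_L1 f \<xi> - fourier_L1 g \<xi>"
  unfolding fourier_L1_def left_diff_distrib right_diff_distrib[symmetric]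
  by (simp only: Bochner_Integration.integral_diff[OF assms[THEN fourier_integrable, of \<xi>]])

lemma indicator_L2:
  fixes S :: "(real ^ 'n) set"
  assumes "bounded S" "S \<in> sets lebesgue"
  shows "(indicator S :: real ^ 'n \<Rightarrow> complex) \<in> L2_space"
proof -
  have "S \<in> lmeasurable" using assms by (rule bounded_set_imp_lmeasurable)
  then have "integrable lebesgue (indicator S :: real ^ 'n \<Rightarrow> real)"
    by (intro integrable_real_indicator) (auto simp: fmeasurable_def)
  moreover have "(cmod (indicator S x))\<^sup>2 = indicator S x" for x :: "real ^ 'n"
    by (simp add: indicator_def)
  ultimately show ?thesis using assms(2) by (simp add: L2_space_def)
qed

lemma L2_truncation:
  fixes f :: "real ^ 'n \<Rightarrow> complex"
  assumes f: "f \<in> L2_space"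
  defines "u \<equiv> \<lambda>n::nat. \<lambda>x. indicator (ball 0 (real n)) x * f x"
  shows "u n \<in> L1_space" "L2_tendsto u f"
proof -
  have [measurable]: "ball 0 r \<in> sets lebesgue" for r :: real
    by simp
  have ind: "(indicator (ball 0 (real n)) :: real ^ 'n \<Rightarrow> complex) \<in> L2_space" for n
    by (rule indicator_L2) auto
  show "u n \<in> L1_space" unfolding u_def L1_space_def using L2_mult_integrable[OF ind f] by simp
  note [measurable] = L2_measurable[OF f]
  show "L2_tendsto u f"
  proof (rule L2_tendsto_dominated[OF _ L2_measurable[OF f] f])
    show "u n \<in> borel_measurable lebesgue" for n
      unfolding u_def by (intro borel_measurable_times L2_measurable ind f)
    show "AE x in lebesgue. (\<lambda>n. u n x) \<longlonglongrightarrow> f x"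
    proof (rule AE_I2)
      fix x :: "real ^ 'n"
      obtain N :: nat where N: "norm x < real N" using reals_Archimedean2 by blast
      then have "\<forall>\<^sub>F n in sequentially. f x = u n x"
        by (intro eventually_sequentiallyI[of N]) (auto simp: u_def)
      then show "(\<lambda>n. u n x) \<longlonglongrightarrow> f x" by (rule Lim_transform_eventually[OF tendsto_const])
    qed
    show "AE x in lebesgue. cmod (u n x) \<le> 1 * cmod (f x)" for n
      by (auto simp: u_def indicator_def)
  qed
qed

lemma has_fourier_L2_space:
  assumes "has_fourier_L2 f F"
  shows "f \<in> L2_space" "F \<in> L2_space"
  using assms by (auto simp: has_fourier_L2_def L2_tendsto_def)

text \<open>Truncations to balls lie in L1 and L2. Plancherel for their differences makes the
  transforms a Cauchy sequence, and completeness supplies the limit.\<close>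

lemma has_fourier_L2_exists:
  fixes f :: "real ^ 'n \<Rightarrow> complex"
  assumes "f \<in> L2_space"
  obtains F where "has_fourier_L2 f F"
proof -
  define u where "u = (\<lambda>n::nat. \<lambda>x. indicator (ball 0 (real n)) x * f x)"
  have u: "u n \<in> L1_space" "L2_tendsto u f" for n
    using L2_truncation[OF assms] by (auto simp: u_def)
  note u2 = L2_tendstoD[OF u(2)]
  have F: "fourier_L1 (u n) \<in> L2_space" for n by (rule plancherel_L1_L2(1)[OF u(1) u2(1)])
  have d: "L2_norm (\<lambda>x. fourier_L1 (u m) x - fourier_L1 (u n) x) = L2_norm (\<lambda>x. u m x - u n x)" for m n
  proof -
    have "(\<lambda>x. u m x - u n x) \<in> L1_space" using u(1) by (simp add: L1_space_def)
    note plancherel_L1_L2(2)[OF this L2_diff[OF u2(1) u2(1)]]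
    moreover have "fourier_L1 (\<lambda>x. u m x - u n x) = (\<lambda>x. fourier_L1 (u m) x - fourier_L1 (u n) x)"
      by (rule ext) (rule fourier_L1_diff[OF u(1) u(1)])
    ultimately show ?thesis by simp
  qed
  obtain G where "L2_tendsto (\<lambda>n. fourier_L1 (u n)) G"
  proof (rule L2_complete[OF F])
    fix e :: real assume "e > 0"
    then obtain N where N: "\<And>n. n \<ge> N \<Longrightarrow> L2_norm (\<lambda>x. u n x - f x) < e/2"
      using LIMSEQ_D[OF u2(3), of "e/2"] by auto
    have "L2_norm (\<lambda>x. fourier_L1 (u m) x - fourier_L1 (u n) x) < e" if "m \<ge> N" "n \<ge> N" for m n
      using L2_norm_triangle_diff[OF u2(1) u2(2) u2(1), of m n] N[OF that(1)] N[OF that(2)]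
      by (simp add: d L2_norm_minus_commute[of f])
    then show "\<exists>N. \<forall>m\<ge>N. \<forall>n\<ge>N. L2_norm (\<lambda>x. fourier_L1 (u m) x - fourier_L1 (u n) x) < e" by blast
  qed blast
  then show ?thesis using that u by (auto simp: has_fourier_L2_def)
qed

lemma has_fourier_L2_norm:
  assumes "has_fourier_L2 f F"
  shows "L2_norm F = L2_norm f"
proof -
  obtain u where u: "\<And>n. u n \<in> L1_space" "L2_tendsto u f" "L2_tendsto (\<lambda>n. fourier_L1 (u n)) F"
    using assms by (auto simp: has_fourier_L2_def)
  have "(\<lambda>n. L2_norm (u n)) \<longlonglongrightarrow> L2_norm F"
    using L2_tendsto_norm[OF u(3)] plancherel_L1_L2(2)[OF u(1) L2_tendstoD(1)[OF u(2)]] by simp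
  then show ?thesis using L2_tendsto_norm[OF u(2)] LIMSEQ_unique by blast
qed

lemma has_fourier_L2_add:
  assumes "has_fourier_L2 f F" "has_fourier_L2 g G"
  shows "has_fourier_L2 (\<lambda>x. f x + g x) (\<lambda>x. F x + G x)"
proof -
  obtain u where u: "\<And>n. u n \<in> L1_space" "L2_tendsto u f" "L2_tendsto (\<lambda>n. fourier_L1 (u n)) F"
    using assms by (auto simp: has_fourier_L2_def)
  obtain v where v: "\<And>n. v n \<in> L1_space" "L2_tendsto v g" "L2_tendsto (\<lambda>n. fourier_L1 (v n)) G"
    using assms by (auto simp: has_fourier_L2_def)
  have "fourier_L1 (\<lambda>x. u n x + v n x) = (\<lambda>x. fourier_L1 (u n) x + fourier_L1 (v n) x)" for n
    by (rule ext) (rule fourier_L1_add[OF u(1) v(1)])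
  then show ?thesis
    using u v L2_tendsto_add[OF u(2) v(2)] L2_tendsto_add[OF u(3) v(3)] unfolding has_fourier_L2_def
    by (intro exI[of _ "\<lambda>n x. u n x + v n x"]) (auto simp: L1_space_def)
qed

lemma has_fourier_L2_cmult:
  assumes "has_fourier_L2 f F"
  shows "has_fourier_L2 (\<lambda>x. c * f x) (\<lambda>x. c * F x)"
proof -
  obtain u where u: "\<And>n. u n \<in> L1_space" "L2_tendsto u f" "L2_tendsto (\<lambda>n. fourier_L1 (u n)) F"
    using assms by (auto simp: has_fourier_L2_def)
  have "fourier_L1 (\<lambda>x. c * u n x) = (\<lambda>x. c * fourier_L1 (u n) x)" for n
    by (rule ext) (rule fourier_L1_cmult)
  then show ?thesis
    using u L2_tendsto_cmult[OF u(2)] L2_tendsto_cmult[OF u(3)] unfolding has_fourier_L2_def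
    by (intro exI[of _ "\<lambda>n x. c * u n x"]) (auto simp: L1_space_def)
qed

lemma has_fourier_L2_diff:
  assumes "has_fourier_L2 f F" "has_fourier_L2 g G"
  shows "has_fourier_L2 (\<lambda>x. f x - g x) (\<lambda>x. F x - G x)"
  using has_fourier_L2_add[OF assms(1) has_fourier_L2_cmult[OF assms(2), of "-1"]] by simp

lemma has_fourier_L2_sum:
  fixes f F :: "'i \<Rightarrow> real ^ 'n \<Rightarrow> complex"
  assumes "\<And>i. i \<in> I \<Longrightarrow> has_fourier_L2 (f i) (F i)"
  shows "has_fourier_L2 (\<lambda>x. \<Sum>i\<in>I. f i x) (\<lambda>x. \<Sum>i\<in>I. F i x)"
proof -
  have "has_fourier_L2 (\<lambda>x::real^'n. 0) (\<lambda>x. 0)"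
  proof -
    obtain Z :: "real ^ 'n \<Rightarrow> complex" where "has_fourier_L2 (\<lambda>x. 0) Z" using has_fourier_L2_exists[OF L2_zero] .
    from has_fourier_L2_cmult[OF this, of 0] show ?thesis by simp
  qed
  with assms show ?thesis
    by (induction I rule: infinite_finite_induct) (auto intro: has_fourier_L2_add)
qed

lemma has_fourier_L2_cong_AE:
  assumes "has_fourier_L2 f F" "AE x in lebesgue. f x = g x" "AE x in lebesgue. F x = G x"
  shows "has_fourier_L2 g G"
proof -
  obtain u where u: "\<And>n. u n \<in> L1_space" "L2_tendsto u f" "L2_tendsto (\<lambda>n. fourier_L1 (u n)) F"
    using assms by (auto simp: has_fourier_L2_def)
  have "L2_tendsto u g" "L2_tendsto (\<lambda>n. fourier_L1 (u n)) G"
    using L2_tendsto_AE_cong[OF u(2) _ assms(2)] L2_tendsto_AE_cong[OF u(3) _ assms(3)] by auto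
  with u(1) show ?thesis unfolding has_fourier_L2_def by blast
qed

text \<open>Plancherel for the difference. The transform is thus independent of the approximating
  sequence, and the choice made by \<open>fourier_L2\<close> is harmless.\<close>

lemma has_fourier_L2_unique:
  assumes "has_fourier_L2 f F" "has_fourier_L2 g G" "AE x in lebesgue. f x = g x"
  shows "AE x in lebesgue. F x = G x"
proof -
  note d = has_fourier_L2_diff[OF assms(1,2)]
  have "L2_norm (\<lambda>x. f x - g x) = 0"
    using assms(3) by (subst L2_norm_eq_0_iff[OF has_fourier_L2_space(1)[OF d]]) simp
  then have "AE x in lebesgue. F x - G x = 0"
    using has_fourier_L2_norm[OF d] L2_norm_eq_0_iff[OF has_fourier_L2_space(2)[OF d]] by simp
  then show ?thesis by simp
qed

lemma has_fourier_L2_inj: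
  assumes "has_fourier_L2 f F" "has_fourier_L2 g G" "AE x in lebesgue. F x = G x"
  shows "AE x in lebesgue. f x = g x"
proof -
  note d = has_fourier_L2_diff[OF assms(1,2)]
  have "L2_norm (\<lambda>x. F x - G x) = 0"
    using assms(3) by (subst L2_norm_eq_0_iff[OF has_fourier_L2_space(2)[OF d]]) simp
  then have "AE x in lebesgue. f x - g x = 0"
    using has_fourier_L2_norm[OF d] L2_norm_eq_0_iff[OF has_fourier_L2_space(1)[OF d]] by simp
  then show ?thesis by simp
qed

lemma has_fourier_L2_L1:
  fixes f :: "real ^ 'n \<Rightarrow> complex"
  assumes "f \<in> L1_space" "f \<in> L2_space"
  shows "has_fourier_L2 f (fourier_L1 f)"
proof -
  have "L2_tendsto (\<lambda>n. g) g" if "g \<in> L2_space" for g :: "real ^ 'n \<Rightarrow> complex"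
    using that by (simp add: L2_tendsto_def L2_norm_def)
  then show ?thesis
    unfolding has_fourier_L2_def using assms plancherel_L1_L2(1)[OF assms]
    by (intro exI[of _ "\<lambda>n. f"]) simp
qed

lemma has_fourier_L2_fourier_L2:
  assumes "f \<in> L2_space"
  shows "has_fourier_L2 f (fourier_L2 f)"
proof -
  obtain F where "has_fourier_L2 f F" using has_fourier_L2_exists[OF assms] .
  then show ?thesis unfolding fourier_L2_def by (rule someI[where P = "has_fourier_L2 f"])
qed

lemma has_fourier_L2_tendsto_iff:
  assumes "\<And>n. has_fourier_L2 (f n) (F n)" "has_fourier_L2 g G"
  shows "L2_tendsto f g \<longleftrightarrow> L2_tendsto F G"
proof -
  have "L2_norm (\<lambda>x. F n x - G x) = L2_norm (\<lambda>x. f n x - g x)" for n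
    by (rule has_fourier_L2_norm[OF has_fourier_L2_diff[OF assms]])
  then show ?thesis
    using has_fourier_L2_space[OF assms(1)] has_fourier_L2_space[OF assms(2)] by (simp add: L2_tendsto_def)
qed

lemma has_fourier_L2_multiplication_formula:
  assumes "has_fourier_L2 f F" "has_fourier_L2 g G"
  shows "(LINT x|lebesgue. F x * g x) = (LINT x|lebesgue. f x * G x)"
proof -
  obtain u where u: "\<And>n. u n \<in> L1_space" "L2_tendsto u f" "L2_tendsto (\<lambda>n. fourier_L1 (u n)) F"
    using assms by (auto simp: has_fourier_L2_def)
  obtain v where v: "\<And>n. v n \<in> L1_space" "L2_tendsto v g" "L2_tendsto (\<lambda>n. fourier_L1 (v n)) G"
    using assms by (auto simp: has_fourier_L2_def)
  have "(\<lambda>n. LINT x|lebesgue. fourier_L1 (u n) x * v n x) \<longlonglongrightarrow> (LINT x|lebesgue. F x * g x)"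
    using L2_tendsto_inner[OF u(3) L2_tendsto_cnj[OF v(2)]] by (simp add: L2_inner_def)
  moreover have "(\<lambda>n. LINT x|lebesgue. u n x * fourier_L1 (v n) x) \<longlonglongrightarrow> (LINT x|lebesgue. f x * G x)"
    using L2_tendsto_inner[OF u(2) L2_tendsto_cnj[OF v(3)]] by (simp add: L2_inner_def)
  ultimately show ?thesis
    using fourier_multiplication_formula[OF u(1) v(1)] LIMSEQ_unique by simp
qed

text \<open>
  By the multiplication formula, conjugating the Fourier transform by complex conjugation yields
  its adjoint; an isometry whose adjoint is an isometry too is unitary.
\<close>

lemma has_fourier_L2_inversion:
  assumes "has_fourier_L2 (\<lambda>x. cnj (F x)) H"
  shows "has_fourier_L2 (\<lambda>x. cnj (H x)) F"
proof -
  have F: "F \<in> L2_space" using L2_cnj[OF has_fourier_L2_space(1)[OF assms]] by simp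
  have H: "H \<in> L2_space" using has_fourier_L2_space(2)[OF assms] .
  obtain F' where F': "has_fourier_L2 (\<lambda>x. cnj (H x)) F'" using has_fourier_L2_exists[OF L2_cnj[OF H]] .
  have F'2: "F' \<in> L2_space" using has_fourier_L2_space(2)[OF F'] .
  have nF: "L2_norm F = L2_norm H" using has_fourier_L2_norm[OF assms] by (simp add: L2_norm_cnj)
  have nF': "L2_norm F' = L2_norm H" using has_fourier_L2_norm[OF F'] by (simp add: L2_norm_cnj)
  have "L2_inner F' F = (LINT x|lebesgue. cnj (H x) * H x)"
    unfolding L2_inner_def by (rule has_fourier_L2_multiplication_formula[OF F' assms])
  also have "\<dots> = L2_inner H H" by (simp add: L2_inner_def mult.commute)
  \<comment> \<open>Both \<open>F'\<close> and \<open>F\<close> have the norm of \<open>H\<close>,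
    and their inner product is the square of that norm, so the expansion of the squared distance
    cancels.\<close>
  finally have "(L2_norm (\<lambda>x. F' x - F x))\<^sup>2 = 0"
    unfolding L2_norm_diff_sq[OF F'2 F] nF nF' by (simp add: L2_inner_self flip: of_real_power)
  then have "AE x in lebesgue. F' x - F x = 0"
    using L2_norm_eq_0_iff[OF L2_diff[OF F'2 F]] by simp
  then show ?thesis by (intro has_fourier_L2_cong_AE[OF F']) auto
qed

lemma has_fourier_L2_inverse_exists:
  assumes "F \<in> L2_space"
  obtains f where "has_fourier_L2 f F"
proof -
  obtain H where "has_fourier_L2 (\<lambda>x. cnj (F x)) H" using has_fourier_L2_exists[OF L2_cnj[OF assms]] .
  from that[OF has_fourier_L2_inversion[OF this]] show ?thesis .
qed

text \<open>By inversion the transform of the conjugate of \<open>G\<close> is the conjugate of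
  \<open>g\<close>; this pair is put into the multiplication formula.\<close>

lemma parseval:
  assumes "has_fourier_L2 f F" "has_fourier_L2 g G"
  shows "L2_inner F G = L2_inner f g"
proof -
  have "has_fourier_L2 (\<lambda>x. cnj (G x)) (\<lambda>x. cnj (g x))"
    by (rule has_fourier_L2_inversion) (simp add: assms(2))
  from has_fourier_L2_multiplication_formula[OF assms(1) this] show ?thesis by (simp add: L2_inner_def)
qed

section \<open>Translation, modulation and products\<close>

lemma has_fourier_L2_translate:
  fixes f :: "real ^ 'n \<Rightarrow> complex"
  assumes "has_fourier_L2 f F"
  shows "has_fourier_L2 (\<lambda>x. f (x - a)) (\<lambda>\<xi>. exp (- \<i> * complex_of_real (a \<bullet> \<xi>)) * F \<xi>)"
proof -
  obtain u where u: "\<And>n. u n \<in> L1_space" "L2_tendsto u f" "L2_tendsto (\<lambda>n. fourier_L1 (u n)) F"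
    using assms by (auto simp: has_fourier_L2_def)
  have shift: "(\<lambda>x. g (x - a)) = (\<lambda>x. g (- a + 1 *\<^sub>R x))" for g :: "real ^ 'n \<Rightarrow> complex" by simp
  have k: "(\<lambda>\<xi>. exp (- \<i> * complex_of_real (a \<bullet> \<xi>))) \<in> borel_measurable lebesgue"
    by (rule borel_imp_lebesgue_measurable) measurable
  show ?thesis unfolding has_fourier_L2_def
  proof (intro exI[of _ "\<lambda>n x. u n (x - a)"] conjI allI)
    show "(\<lambda>x. u n (x - a)) \<in> L1_space" for n
      using lebesgue_integrable_unit_affine[of 1 "u n" "- a"] u(1)[of n] by (simp add: L1_space_def)
    show "L2_tendsto (\<lambda>n x. u n (x - a)) (\<lambda>x. f (x - a))"
      using L2_tendsto_unit_affine[OF _ u(2), of 1 "- a"] by simp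
    have "fourier_L1 (\<lambda>x. u n (x - a)) = (\<lambda>\<xi>. exp (- \<i> * complex_of_real (a \<bullet> \<xi>)) * fourier_L1 (u n) \<xi>)" for n
    proof
      fix \<xi>
      have [measurable]: "(\<lambda>x. u n x * exp (- \<i> * complex_of_real (x \<bullet> \<xi>))) \<in> borel_measurable lebesgue"
        using fourier_integrable[OF u(1)] by (rule borel_measurable_integrable)
      have "(LINT x|lebesgue. u n (x - a) * exp (- \<i> * complex_of_real (x \<bullet> \<xi>))) =
        (LINT x|lebesgue. exp (- \<i> * complex_of_real (a \<bullet> \<xi>)) * (u n (- a + 1 *\<^sub>R x) * exp (- \<i> * complex_of_real ((- a + 1 *\<^sub>R x) \<bullet> \<xi>))))"
        by (intro Bochner_Integration.integral_cong refl)
          (simp add: inner_diff_left algebra_simps flip: exp_add)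
      also have "\<dots> = exp (- \<i> * complex_of_real (a \<bullet> \<xi>)) * (LINT x|lebesgue. u n (- a + 1 *\<^sub>R x) * exp (- \<i> * complex_of_real ((- a + 1 *\<^sub>R x) \<bullet> \<xi>)))"
        by (rule integral_mult_right_zero)
      also have "(LINT x|lebesgue. u n (- a + 1 *\<^sub>R x) * exp (- \<i> * complex_of_real ((- a + 1 *\<^sub>R x) \<bullet> \<xi>))) =
        (LINT x|lebesgue. u n x * exp (- \<i> * complex_of_real (x \<bullet> \<xi>)))"
        using fourier_integrable[OF u(1), THEN borel_measurable_integrable]
        by (intro lebesgue_integral_unit_affine[where f = "\<lambda>x. u n x * exp (- \<i> * complex_of_real (x \<bullet> \<xi>))"]) auto
      finally show "fourier_L1 (\<lambda>x. u n (x - a)) \<xi> = exp (- \<i> * complex_of_real (a \<bullet> \<xi>)) * fourier_L1 (u n) \<xi>"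
        unfolding fourier_L1_def by (simp add: mult.left_commute)
    qed
    moreover have "L2_tendsto (\<lambda>n \<xi>. exp (- \<i> * complex_of_real (a \<bullet> \<xi>)) * fourier_L1 (u n) \<xi>) (\<lambda>\<xi>. exp (- \<i> * complex_of_real (a \<bullet> \<xi>)) * F \<xi>)"
      by (rule L2_tendsto_bounded_linear[OF u(3), where S = "\<lambda>f \<xi>. exp (- \<i> * complex_of_real (a \<bullet> \<xi>)) * f \<xi>" and C = 1])
        (auto intro!: L2_mult_bounded[OF _ k, where C = 1, simplified] L2_tendstoD[OF u(3)]
          simp: L2_norm_def norm_mult simp flip: right_diff_distrib)
    ultimately show "L2_tendsto (\<lambda>n. fourier_L1 (\<lambda>x. u n (x - a))) (\<lambda>\<xi>. exp (- \<i> * complex_of_real (a \<bullet> \<xi>)) * F \<xi>)"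
      by simp
  qed
qed

text \<open>Tailored to convolution: the inner product of \<open>g\<close> with this function is the
  Fourier integral of \<open>f g\<close> at \<open>\<xi>\<close>, and on the transforms it becomes
  the convolution integral.\<close>

lemma has_fourier_L2_cnj_modulate:
  fixes f :: "real ^ 'n \<Rightarrow> complex"
  assumes "has_fourier_L2 f F"
  shows "has_fourier_L2 (\<lambda>x. cnj (f x) * exp (\<i> * complex_of_real (x \<bullet> \<xi>))) (\<lambda>\<eta>. cnj (F (\<xi> - \<eta>)))"
proof -
  obtain u where u: "\<And>n. u n \<in> L1_space" "L2_tendsto u f" "L2_tendsto (\<lambda>n. fourier_L1 (u n)) F"
    using assms by (auto simp: has_fourier_L2_def)
  have k: "(\<lambda>x. exp (\<i> * complex_of_real (x \<bullet> \<xi>))) \<in> borel_measurable lebesgue"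
    by (rule borel_imp_lebesgue_measurable) measurable
  show ?thesis unfolding has_fourier_L2_def
  proof (intro exI[of _ "\<lambda>n x. cnj (u n x) * exp (\<i> * complex_of_real (x \<bullet> \<xi>))"] conjI allI)
    show "(\<lambda>x. cnj (u n x) * exp (\<i> * complex_of_real (x \<bullet> \<xi>))) \<in> L1_space" for n
      using L1_mult_bounded[OF _ k, of "\<lambda>x. cnj (u n x)" 1] u(1)[of n]
      by (simp add: L1_space_def mult.commute)
    have "L2_tendsto (\<lambda>n x. exp (\<i> * complex_of_real (x \<bullet> \<xi>)) * cnj (u n x)) (\<lambda>x. exp (\<i> * complex_of_real (x \<bullet> \<xi>)) * cnj (f x))"
      by (rule L2_tendsto_bounded_linear[OF L2_tendsto_cnj[OF u(2)], where S = "\<lambda>f x. exp (\<i> * complex_of_real (x \<bullet> \<xi>)) * f x" and C = 1])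
        (auto intro!: L2_mult_bounded[OF _ k, where C = 1, simplified] L2_cnj L2_tendstoD[OF u(2)]
          simp: L2_norm_def norm_mult simp flip: right_diff_distrib)
    then show "L2_tendsto (\<lambda>n x. cnj (u n x) * exp (\<i> * complex_of_real (x \<bullet> \<xi>))) (\<lambda>x. cnj (f x) * exp (\<i> * complex_of_real (x \<bullet> \<xi>)))"
      by (simp add: mult.commute)
    have "fourier_L1 (\<lambda>x. cnj (u n x) * exp (\<i> * complex_of_real (x \<bullet> \<xi>))) = (\<lambda>\<eta>. cnj (fourier_L1 (u n) (\<xi> - \<eta>)))" for n
    proof
      fix \<eta>
      have "(LINT x|lebesgue. cnj (u n x) * exp (\<i> * complex_of_real (x \<bullet> \<xi>)) * exp (- \<i> * complex_of_real (x \<bullet> \<eta>))) =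
        (LINT x|lebesgue. cnj (u n x * exp (- \<i> * complex_of_real (x \<bullet> (\<xi> - \<eta>)))))"
        by (intro Bochner_Integration.integral_cong refl)
          (simp add: inner_diff_right exp_cnj mult.assoc algebra_simps flip: exp_add)
      also have "\<dots> = cnj (LINT x|lebesgue. u n x * exp (- \<i> * complex_of_real (x \<bullet> (\<xi> - \<eta>))))"
        by (rule Bochner_Integration.integral_cnj)
      finally show "fourier_L1 (\<lambda>x. cnj (u n x) * exp (\<i> * complex_of_real (x \<bullet> \<xi>))) \<eta> = cnj (fourier_L1 (u n) (\<xi> - \<eta>))"
        unfolding fourier_L1_def by simp
    qed
    then show "L2_tendsto (\<lambda>n. fourier_L1 (\<lambda>x. cnj (u n x) * exp (\<i> * complex_of_real (x \<bullet> \<xi>)))) (\<lambda>\<eta>. cnj (F (\<xi> - \<eta>)))"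
      using L2_tendsto_cnj[OF L2_tendsto_unit_affine[OF _ u(3), of "-1" \<xi>]] by simp
  qed
qed

text \<open>Parseval with \<open>\<xi>\<close> fixed. Both sides are inner products of square
  integrable functions, so the convolution theorem holds at every \<open>\<xi>\<close>, not just
  almost everywhere.\<close>

lemma fourier_L1_product:
  fixes f g :: "real ^ 'n \<Rightarrow> complex"
  assumes "has_fourier_L2 f F" "has_fourier_L2 g G"
  shows "fourier_L1 (\<lambda>x. f x * g x) \<xi> =
    complex_of_real ((2 * pi) powr (- real CARD('n) / 2)) * (LINT \<eta>|lebesgue. F (\<xi> - \<eta>) * G \<eta>)"
proof -
  have "(LINT x|lebesgue. f x * g x * exp (- \<i> * complex_of_real (x \<bullet> \<xi>))) =
      L2_inner g (\<lambda>x. cnj (f x) * exp (\<i> * complex_of_real (x \<bullet> \<xi>)))"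
    unfolding L2_inner_def by (intro Bochner_Integration.integral_cong refl) (simp add: exp_cnj)
  also have "\<dots> = L2_inner G (\<lambda>\<eta>. cnj (F (\<xi> - \<eta>)))"
    by (rule parseval[OF assms(2) has_fourier_L2_cnj_modulate[OF assms(1)], symmetric])
  also have "\<dots> = (LINT \<eta>|lebesgue. F (\<xi> - \<eta>) * G \<eta>)"
    by (simp add: L2_inner_def mult.commute)
  finally show ?thesis by (simp add: fourier_L1_def)
qed

section \<open>Multipliers of translation-invariant operators\<close>

context
  fixes T :: "(real ^ 'n \<Rightarrow> complex) \<Rightarrow> real ^ 'n \<Rightarrow> complex"
  assumes T: "bounded_linear_L2 T"
begin

lemma bounded_linear_L2_in: "f \<in> L2_space \<Longrightarrow> T f \<in> L2_space"
  using T unfolding bounded_linear_L2_def by blast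

lemma bounded_linear_L2_add:
  "f \<in> L2_space \<Longrightarrow> g \<in> L2_space \<Longrightarrow> AE x in lebesgue. T (\<lambda>y. f y + g y) x = T f x + T g x"
  using T unfolding bounded_linear_L2_def by blast

lemma bounded_linear_L2_cmult:
  "f \<in> L2_space \<Longrightarrow> AE x in lebesgue. T (\<lambda>y. c * f y) x = c * T f x"
  using T unfolding bounded_linear_L2_def by blast

lemma bounded_linear_L2_diff:
  assumes "f \<in> L2_space" "g \<in> L2_space"
  shows "AE x in lebesgue. T (\<lambda>y. f y - g y) x = T f x - T g x"
proof -
  have "AE x in lebesgue. T (\<lambda>y. f y + - 1 * g y) x = T f x + T (\<lambda>y. - 1 * g y) x"
    by (rule bounded_linear_L2_add[OF assms(1) L2_cmult[OF assms(2)]])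
  then show ?thesis using bounded_linear_L2_cmult[OF assms(2), of "-1"] by eventually_elim simp
qed

lemma bounded_linear_L2_sum:
  assumes "finite I" "\<And>i. i \<in> I \<Longrightarrow> f i \<in> L2_space"
  shows "AE x in lebesgue. T (\<lambda>y. \<Sum>i\<in>I. f i y) x = (\<Sum>i\<in>I. T (f i) x)"
  using assms
proof (induction I rule: finite_induct)
  case empty
  then show ?case using bounded_linear_L2_cmult[OF L2_zero, of 0] by simp
next
  case (insert i I)
  have "AE x in lebesgue. T (\<lambda>y. f i y + (\<Sum>i\<in>I. f i y)) x = T (f i) x + T (\<lambda>y. \<Sum>i\<in>I. f i y) x"
    using insert.prems by (intro bounded_linear_L2_add L2_sum) auto
  moreover have "AE x in lebesgue. T (\<lambda>y. \<Sum>i\<in>I. f i y) x = (\<Sum>i\<in>I. T (f i) x)"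
    using insert by auto
  ultimately show ?case by eventually_elim (simp add: insert.hyps)
qed

lemma bounded_linear_L2_tendsto:
  assumes "L2_tendsto u f"
  shows "L2_tendsto (\<lambda>n. T (u n)) (T f)"
proof -
  note u = L2_tendstoD[OF assms]
  obtain C where C: "\<And>f. f \<in> L2_space \<Longrightarrow> L2_norm (T f) \<le> C * L2_norm f"
    using T unfolding bounded_linear_L2_def by blast
  have "L2_norm (\<lambda>x. T (u n) x - T f x) \<le> C * L2_norm (\<lambda>x. u n x - f x)" for n
    using C[OF L2_diff[OF u(1,2)], of n] L2_norm_cong_AE[OF bounded_linear_L2_diff[OF u(1,2)], of n] by simp
  then show ?thesis
    by (intro L2_tendsto_bounded_linear[OF assms, where S = T]) (auto intro: bounded_linear_L2_in u)
qed

end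

text \<open>
  Replacing \<open>x\<close> by a simple function in the exponent of the Fourier integral leaves a finite sum of
  characters, that is, the symbol of a finite combination of translations.
\<close>

lemma fourier_L1_trigonometric_approximation:
  fixes k :: "real ^ 'n \<Rightarrow> complex"
  assumes k: "k \<in> L1_space"
  obtains R :: "nat \<Rightarrow> (real ^ 'n) set" and a :: "nat \<Rightarrow> real ^ 'n \<Rightarrow> complex" and K :: real
  where "\<forall>n. finite (R n)"
    and "\<forall>n \<xi>. cmod (\<Sum>v\<in>R n. a n v * exp (- \<i> * complex_of_real (v \<bullet> \<xi>))) \<le> K"
    and "\<forall>\<xi>. (\<lambda>n. \<Sum>v\<in>R n. a n v * exp (- \<i> * complex_of_real (v \<bullet> \<xi>))) \<longlonglongrightarrow> fourier_L1 k \<xi>"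
proof -
  have ki: "integrable lebesgue k" using k by (simp add: L1_space_def)
  note [measurable] = borel_measurable_integrable[OF ki]
  have "(\<lambda>x. x) \<in> borel_measurable (lebesgue :: (real ^ 'n) measure)"
    by (rule borel_imp_lebesgue_measurable) simp
  from borel_measurable_implies_sequence_metric[OF this, of 0]
  obtain s :: "nat \<Rightarrow> real ^ 'n \<Rightarrow> real ^ 'n"
    where "(\<forall>i. simple_function lebesgue (s i)) \<and> (\<forall>x\<in>space lebesgue. (\<lambda>i. s i x) \<longlonglongrightarrow> x) \<and>
      (\<forall>i. \<forall>x\<in>space lebesgue. dist (s i x) 0 \<le> 2 * dist x 0)"
    by (rule exE)
  then have s: "\<And>n. simple_function lebesgue (s n)" "\<And>x. (\<lambda>n. s n x) \<longlonglongrightarrow> x"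
    by simp_all
  let ?c = "complex_of_real ((2 * pi) powr (- real CARD('n) / 2))"
  define R where "R n = range (s n)" for n
  have R: "finite (R n)" for n using s(1)[of n] by (simp add: simple_function_def R_def)
  have lev: "{x. s n x = v} \<in> sets lebesgue" for n v
    using simple_functionD(2)[OF s(1), of n "{v}"] by (simp add: vimage_def)
  \<comment> \<open>The coefficient of the translation by \<open>v\<close> is the integral of
    \<open>k\<close> over the level set of \<open>s n\<close> at \<open>v\<close>, with the Fourier
    constant. A level set may have infinite measure, but \<open>k\<close> is integrable.\<close>
  define a where "a n v = ?c * (LINT x|lebesgue. indicator {x. s n x = v} x * k x)" for n v
  let ?e = "\<lambda>v \<xi>. exp (- \<i> * complex_of_real (v \<bullet> \<xi>))"
  have ik: "integrable lebesgue (\<lambda>x. indicator {x. s n x = v} x * k x)" for n v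
  proof -
    have "indicator {x. s n x = v} x * k x = indicator {x. s n x = v} x *\<^sub>R k x" for x
      by (simp add: indicator_def)
    then show ?thesis using integrable_mult_indicator[OF lev ki, of n v] by simp
  qed
  have p: "(\<Sum>v\<in>R n. a n v * ?e v \<xi>) = ?c * (LINT x|lebesgue. ?e (s n x) \<xi> * k x)" for n \<xi>
  proof -
    have "?e (s n x) \<xi> * k x = (\<Sum>v\<in>R n. indicator {x. s n x = v} x * k x * ?e v \<xi>)" for x
    proof -
      have "(\<Sum>v\<in>R n. indicator {x. s n x = v} x * k x * ?e v \<xi>) = (\<Sum>v\<in>R n. if v = s n x then k x * ?e v \<xi> else 0)"
        by (intro sum.cong) (auto simp: indicator_def)
      also have "\<dots> = ?e (s n x) \<xi> * k x" using R by (simp add: R_def)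
      finally show ?thesis ..
    qed
    then have "(LINT x|lebesgue. ?e (s n x) \<xi> * k x) = (LINT x|lebesgue. (\<Sum>v\<in>R n. indicator {x. s n x = v} x * k x * ?e v \<xi>))"
      by simp
    also have "\<dots> = (\<Sum>v\<in>R n. LINT x|lebesgue. indicator {x. s n x = v} x * k x * ?e v \<xi>)"
      by (rule Bochner_Integration.integral_sum) (intro integrable_mult_left ik)
    also have "\<dots> = (\<Sum>v\<in>R n. (LINT x|lebesgue. indicator {x. s n x = v} x * k x) * ?e v \<xi>)"
      by (simp only: integral_mult_left_zero)
    finally show ?thesis by (simp add: a_def sum_distrib_left mult.assoc)
  qed
  have em: "(\<lambda>x. ?e (s n x) \<xi>) \<in> borel_measurable lebesgue" for n \<xi>
  proof -
    have [measurable]: "s n \<in> borel_measurable lebesgue" by (rule borel_measurable_simple_function[OF s(1)])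
    show ?thesis by measurable
  qed
  show ?thesis
  proof (rule that[of R a "cmod ?c * (LINT x|lebesgue. cmod (k x))"]; intro allI)
    show "finite (R n)" for n by (rule R)
    show "cmod (\<Sum>v\<in>R n. a n v * ?e v \<xi>) \<le> cmod ?c * (LINT x|lebesgue. cmod (k x))" for n \<xi>
    proof -
      have "cmod (LINT x|lebesgue. ?e (s n x) \<xi> * k x) \<le> (LINT x|lebesgue. cmod (?e (s n x) \<xi> * k x))"
        by (rule integral_norm_bound)
      then show ?thesis unfolding p by (simp add: norm_mult mult_left_mono)
    qed
    show "(\<lambda>n. \<Sum>v\<in>R n. a n v * ?e v \<xi>) \<longlonglongrightarrow> fourier_L1 k \<xi>" for \<xi>
    proof -
      have "(\<lambda>n. LINT x|lebesgue. ?e (s n x) \<xi> * k x) \<longlonglongrightarrow> (LINT x|lebesgue. ?e x \<xi> * k x)"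
      proof (rule integral_dominated_convergence[where w = "\<lambda>x. cmod (k x)"])
        show "(\<lambda>x. ?e (s n x) \<xi> * k x) \<in> borel_measurable lebesgue" for n using em by measurable
        show "(\<lambda>x. ?e x \<xi> * k x) \<in> borel_measurable lebesgue"
          by (intro borel_measurable_times borel_imp_lebesgue_measurable[OF fourier_kernel_measurable]) measurable
        show "AE x in lebesgue. (\<lambda>n. ?e (s n x) \<xi> * k x) \<longlonglongrightarrow> ?e x \<xi> * k x"
          by (intro AE_I2 tendsto_intros s(2))
        show "AE x in lebesgue. norm (?e (s n x) \<xi> * k x) \<le> cmod (k x)" for n
          by (simp add: norm_mult)
      qed (use ki in simp)
      from tendsto_mult_left[OF this, of ?c] show ?thesis
        unfolding p fourier_L1_def by (simp only: mult.commute[of "k _"])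
    qed
  qed
qed

text \<open>\<open>T\<close> commutes with convolution by \<open>k\<close>, as \<open>h'\<close> is
  a multiple of that convolution of \<open>h\<close>. Trigonometric sums with a common bound
  \<open>K\<close> are symbols of finite combinations of translations, with which \<open>T\<close>
  commutes; continuity of \<open>T\<close> and dominated convergence on the Fourier side give the
  limit.\<close>

lemma fourier_multiplier_L1:
  fixes T :: "(real ^ 'n \<Rightarrow> complex) \<Rightarrow> real ^ 'n \<Rightarrow> complex"
  assumes T: "bounded_linear_L2 T" and ti: "translation_invariant_L2 T"
    and k: "k \<in> L1_space" and h: "has_fourier_L2 h H" and h': "has_fourier_L2 h' (\<lambda>\<xi>. fourier_L1 k \<xi> * H \<xi>)"
    and W: "has_fourier_L2 (T h) W" and W': "has_fourier_L2 (T h') W'"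
  shows "AE \<xi> in lebesgue. W' \<xi> = fourier_L1 k \<xi> * W \<xi>"
proof -
  obtain R :: "nat \<Rightarrow> (real ^ 'n) set" and a :: "nat \<Rightarrow> real ^ 'n \<Rightarrow> complex" and K :: real
    where R': "\<forall>n. finite (R n)"
    and pK: "\<forall>n \<xi>. cmod (\<Sum>v\<in>R n. a n v * exp (- \<i> * complex_of_real (v \<bullet> \<xi>))) \<le> K"
    and plim: "\<forall>\<xi>. (\<lambda>n. \<Sum>v\<in>R n. a n v * exp (- \<i> * complex_of_real (v \<bullet> \<xi>))) \<longlonglongrightarrow> fourier_L1 k \<xi>"
    using fourier_L1_trigonometric_approximation[OF k] .
  have R: "finite (R n)" for n using R' by blast
  define p where "p n \<xi> = (\<Sum>v\<in>R n. a n v * exp (- \<i> * complex_of_real (v \<bullet> \<xi>)))" for n \<xi>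
  have pm: "p n \<in> borel_measurable lebesgue" for n
    unfolding p_def by (rule borel_imp_lebesgue_measurable) measurable
  have conv: "L2_tendsto (\<lambda>n \<xi>. p n \<xi> * F \<xi>) (\<lambda>\<xi>. fourier_L1 k \<xi> * F \<xi>)" if F: "F \<in> L2_space" for F
  proof (rule L2_tendsto_dominated[OF _ _ F])
    show "(\<lambda>\<xi>. p n \<xi> * F \<xi>) \<in> borel_measurable lebesgue" for n
      by (intro borel_measurable_times pm L2_measurable F)
    show "(\<lambda>\<xi>. fourier_L1 k \<xi> * F \<xi>) \<in> borel_measurable lebesgue"
      by (intro borel_measurable_times fourier_L1_measurable_lebesgue k L2_measurable F)
    show "AE \<xi> in lebesgue. (\<lambda>n. p n \<xi> * F \<xi>) \<longlonglongrightarrow> fourier_L1 k \<xi> * F \<xi>"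
      unfolding p_def by (intro AE_I2 tendsto_intros plim[rule_format])
    show "AE \<xi> in lebesgue. cmod (p n \<xi> * F \<xi>) \<le> K * cmod (F \<xi>)" for n
      using pK by (auto simp: p_def norm_mult intro!: mult_right_mono)
  qed
  have four: "has_fourier_L2 (\<lambda>x. \<Sum>v\<in>R n. a n v * g (x - v)) (\<lambda>\<xi>. p n \<xi> * G \<xi>)" if "has_fourier_L2 g G" for g G n
  proof -
    have "has_fourier_L2 (\<lambda>x. \<Sum>v\<in>R n. a n v * g (x - v)) (\<lambda>\<xi>. \<Sum>v\<in>R n. a n v * (exp (- \<i> * complex_of_real (v \<bullet> \<xi>)) * G \<xi>))"
      by (intro has_fourier_L2_sum has_fourier_L2_cmult has_fourier_L2_translate that)
    then show ?thesis by (simp add: p_def sum_distrib_right mult.assoc)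
  qed
  define hn where "hn n x = (\<Sum>v\<in>R n. a n v * h (x - v))" for n x
  have hnF: "has_fourier_L2 (hn n) (\<lambda>\<xi>. p n \<xi> * H \<xi>)" for n unfolding hn_def[abs_def] by (rule four[OF h])
  have "L2_tendsto hn h'"
    using conv[OF has_fourier_L2_space(2)[OF h]] has_fourier_L2_tendsto_iff[OF hnF h'] by simp
  then have Tlim: "L2_tendsto (\<lambda>n. T (hn n)) (T h')" by (rule bounded_linear_L2_tendsto[OF T])
  have hL: "h \<in> L2_space" by (rule has_fourier_L2_space(1)[OF h])
  have tr: "(\<lambda>x. h (x - v)) \<in> L2_space" for v
    using has_fourier_L2_space(1)[OF has_fourier_L2_translate[OF h]] .
  have Thn: "AE x in lebesgue. (\<Sum>v\<in>R n. a n v * T h (x - v)) = T (hn n) x" for n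
  proof -
    have "AE x in lebesgue. T (\<lambda>x. \<Sum>v\<in>R n. a n v * h (x - v)) x = (\<Sum>v\<in>R n. T (\<lambda>x. a n v * h (x - v)) x)"
      by (intro bounded_linear_L2_sum[OF T] R L2_cmult tr)
    moreover have "AE x in lebesgue. \<forall>v\<in>R n. T (\<lambda>x. a n v * h (x - v)) x = a n v * T (\<lambda>x. h (x - v)) x"
      by (intro AE_finite_allI R bounded_linear_L2_cmult[OF T] tr)
    moreover have "AE x in lebesgue. \<forall>v\<in>R n. T (\<lambda>x. h (x - v)) x = T h (x - v)"
      using ti hL by (intro AE_finite_allI R) (auto simp: translation_invariant_L2_def)
    ultimately show ?thesis by eventually_elim (simp add: hn_def[abs_def])
  qed
  have "has_fourier_L2 (T (hn n)) (\<lambda>\<xi>. p n \<xi> * W \<xi>)" for n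
    by (rule has_fourier_L2_cong_AE[OF four[OF W] Thn]) simp
  from has_fourier_L2_tendsto_iff[OF this W'] Tlim
  have "L2_tendsto (\<lambda>n \<xi>. p n \<xi> * W \<xi>) W'" by simp
  from L2_tendsto_unique[OF this conv[OF has_fourier_L2_space(2)[OF W]]] show ?thesis .
qed

text \<open>Quantified over all transforms of \<open>f\<close> and \<open>T f\<close>, hence
  independent of the representatives that \<open>fourier_L2\<close> picks. Regularity of
  \<open>m\<close> is available through the products \<open>m F\<close>, which agree almost
  everywhere with square integrable functions.\<close>

definition fourier_multiplier ::
    "((real ^ 'n \<Rightarrow> complex) \<Rightarrow> real ^ 'n \<Rightarrow> complex) \<Rightarrow> (real ^ 'n \<Rightarrow> complex) \<Rightarrow> bool" where
  "fourier_multiplier T m \<longleftrightarrow>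
     (\<forall>f F G. has_fourier_L2 f F \<longrightarrow> has_fourier_L2 (T f) G \<longrightarrow> (AE \<xi> in lebesgue. G \<xi> = m \<xi> * F \<xi>))"

text \<open>The candidate \<open>m\<close> is forced by the action of \<open>T\<close> on
  \<open>gaussian 1\<close> and is a genuine quotient everywhere. It is verified for integrable
  \<open>u\<close> first and then for all functions by truncation.\<close>

theorem translation_invariant_multiplier:
  fixes T :: "(real ^ 'n \<Rightarrow> complex) \<Rightarrow> real ^ 'n \<Rightarrow> complex"
  assumes T: "bounded_linear_L2 T" and ti: "translation_invariant_L2 T"
  obtains m where "fourier_multiplier T m"
proof -
  let ?g = "gaussian 1 :: real ^ 'n \<Rightarrow> complex"
  have g1: "?g \<in> L1_space" and g2: "?g \<in> L2_space" by (auto intro: gaussian_L1 gaussian_L2)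
  have gF: "has_fourier_L2 ?g ?g"
    using has_fourier_L2_L1[OF g1 g2] by (simp add: fourier_L1_gaussian)
  obtain G0 where G0: "has_fourier_L2 (T ?g) G0"
    using has_fourier_L2_exists[OF bounded_linear_L2_in[OF T g2]] .
  define m where "m \<xi> = G0 \<xi> / ?g \<xi>" for \<xi>
  \<comment> \<open>Both \<open>u\<close> and the Gaussian may play the role of the convolution kernel.\<close>
  have step: "AE \<xi> in lebesgue. U \<xi> = m \<xi> * fourier_L1 u \<xi>"
    if u: "u \<in> L1_space" "u \<in> L2_space" and U: "has_fourier_L2 (T u) U" for u U
  proof -
    have uF: "has_fourier_L2 u (fourier_L1 u)" by (rule has_fourier_L2_L1[OF u])
    have "(\<lambda>\<xi>. fourier_L1 u \<xi> * ?g \<xi>) \<in> L2_space"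
      using fourier_L1_bounded by (intro L2_mult_bounded[OF g2 fourier_L1_measurable_lebesgue[OF u(1)]] AE_I2)
    then obtain h' where h': "has_fourier_L2 h' (\<lambda>\<xi>. fourier_L1 u \<xi> * ?g \<xi>)"
      using has_fourier_L2_inverse_exists[of "\<lambda>\<xi>. fourier_L1 u \<xi> * ?g \<xi>"] by blast
    then have h'2: "has_fourier_L2 h' (\<lambda>\<xi>. fourier_L1 ?g \<xi> * fourier_L1 u \<xi>)"
      by (simp add: fourier_L1_gaussian mult.commute)
    obtain W' where W': "has_fourier_L2 (T h') W'"
      using has_fourier_L2_exists[OF bounded_linear_L2_in[OF T has_fourier_L2_space(1)[OF h']]] .
    have "AE \<xi> in lebesgue. W' \<xi> = fourier_L1 u \<xi> * G0 \<xi>"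
      by (rule fourier_multiplier_L1[OF T ti u(1) gF h' G0 W'])
    moreover have "AE \<xi> in lebesgue. W' \<xi> = fourier_L1 ?g \<xi> * U \<xi>"
      by (rule fourier_multiplier_L1[OF T ti g1 uF h'2 U W'])
    \<comment> \<open>The two expressions for \<open>W'\<close> are equated and divided by the
      Gaussian.\<close>
    ultimately show ?thesis
      by eventually_elim (simp add: m_def fourier_L1_gaussian field_simps)
  qed
  show ?thesis
  proof (rule that[of m], unfold fourier_multiplier_def, intro allI impI)
    fix f F G assume F: "has_fourier_L2 f F" and G: "has_fourier_L2 (T f) G"
    have f: "f \<in> L2_space" by (rule has_fourier_L2_space(1)[OF F])
    define u where "u = (\<lambda>n::nat. \<lambda>x. indicator (ball 0 (real n)) x * f x)"
    have u: "u n \<in> L1_space" "L2_tendsto u f" for n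
      using L2_truncation[OF f] by (auto simp: u_def)
    have u2: "u n \<in> L2_space" for n by (rule L2_tendstoD(1)[OF u(2)])
    have uF: "has_fourier_L2 (u n) (fourier_L1 (u n))" for n by (rule has_fourier_L2_L1[OF u(1) u2])
    have U: "has_fourier_L2 (T (u n)) (fourier_L2 (T (u n)))" for n
      by (intro has_fourier_L2_fourier_L2 bounded_linear_L2_in[OF T] u2)
    have FL: "L2_tendsto (\<lambda>n. fourier_L1 (u n)) F"
      using u(2) has_fourier_L2_tendsto_iff[OF uF F] by simp
    have UL: "L2_tendsto (\<lambda>n. fourier_L2 (T (u n))) G"
      using bounded_linear_L2_tendsto[OF T u(2)] has_fourier_L2_tendsto_iff[OF U G] by simp
    \<comment> \<open>With no bound on \<open>m\<close> at hand, the limit is taken pointwise, along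
      a subsequence of a subsequence on which both sides converge almost everywhere.\<close>
    obtain r where r: "strict_mono (r :: nat \<Rightarrow> nat)" "AE \<xi> in lebesgue. (\<lambda>n. fourier_L1 (u (r n)) \<xi>) \<longlonglongrightarrow> F \<xi>"
      using L2_tendsto_AE_subseq[OF FL] .
    obtain q where q: "strict_mono (q :: nat \<Rightarrow> nat)" "AE \<xi> in lebesgue. (\<lambda>n. fourier_L2 (T (u (r (q n)))) \<xi>) \<longlonglongrightarrow> G \<xi>"
      using L2_tendsto_AE_subseq[OF L2_tendsto_subseq[OF UL r(1)]] .
    have "AE \<xi> in lebesgue. \<forall>n. fourier_L2 (T (u n)) \<xi> = m \<xi> * fourier_L1 (u n) \<xi>"
      using step[OF u(1) u2 U] by (simp add: AE_all_countable)
    with r(2) q(2) show "AE \<xi> in lebesgue. G \<xi> = m \<xi> * F \<xi>"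
    proof eventually_elim
      case (elim \<xi>)
      have "(\<lambda>n. m \<xi> * fourier_L1 (u (r (q n))) \<xi>) \<longlonglongrightarrow> m \<xi> * F \<xi>"
        using LIMSEQ_subseq_LIMSEQ[OF elim(1) q(1)] by (intro tendsto_mult tendsto_const) (simp add: o_def)
      with elim(2,3) show ?case using LIMSEQ_unique by simp
    qed
  qed
qed

section \<open>Functions that are locally constant almost everywhere\<close>

lemma AE_open_ex:
  fixes U :: "'a::euclidean_space set"
  assumes "open U" "U \<noteq> {}" "AE x in lebesgue. x \<in> U \<longrightarrow> P x"
  obtains x where "x \<in> U" "P x"
proof -
  have "\<not> (AE x in lebesgue. x \<notin> U)"
  proof
    assume "AE x in lebesgue. x \<notin> U"
    then have "U \<in> null_sets lebesgue"
      using assms(1) by (simp add: AE_iff_null_sets)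
    then show False using open_not_negligible[OF assms(1,2)] by (simp add: negligible_iff_null_sets)
  qed
  moreover have "AE x in lebesgue. x \<notin> U" if "\<not> (\<exists>x\<in>U. P x)"
    using assms(3) by eventually_elim (use that in blast)
  ultimately show ?thesis using that by blast
qed

text \<open>Countably many of the neighbourhoods already cover \<open>S\<close>, so the exceptional
  null sets stay null in union.\<close>

lemma AE_Lindelof:
  fixes S :: "'a::euclidean_space set"
  assumes "\<And>x. x \<in> S \<Longrightarrow> \<exists>U. open U \<and> x \<in> U \<and> (AE y in lebesgue. y \<in> U \<longrightarrow> P y)"
  shows "AE y in lebesgue. y \<in> S \<longrightarrow> P y"
proof -
  define \<F> where "\<F> = {U. open U \<and> (AE y in lebesgue. y \<in> U \<longrightarrow> P y)}"
  obtain \<F>' where F: "\<F>' \<subseteq> \<F>" "countable \<F>'" "\<Union>\<F>' = \<Union>\<F>"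
    using Lindelof[of \<F>] by (auto simp: \<F>_def)
  have "AE y in lebesgue. \<forall>U\<in>\<F>'. y \<in> U \<longrightarrow> P y"
    using F by (intro AE_ball_countable'[OF _ F(2)]) (auto simp: \<F>_def)
  then show ?thesis
  proof eventually_elim
    case (elim y)
    have "S \<subseteq> \<Union>\<F>" using assms unfolding \<F>_def by blast
    then show ?case using elim F(3) by blast
  qed
qed

lemma AE_zero_outside_ess_supp:
  assumes "\<phi> \<in> borel_measurable lebesgue"
  shows "AE x in lebesgue. x \<notin> ess_supp \<phi> \<longrightarrow> \<phi> x = 0"
proof -
  have [measurable]: "\<phi> \<in> borel_measurable lebesgue" by fact
  have "AE x in lebesgue. x \<in> - ess_supp \<phi> \<longrightarrow> \<phi> x = 0"
  proof (rule AE_Lindelof)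
    fix x assume "x \<in> - ess_supp \<phi>"
    then obtain U where U: "open U" "x \<in> U" "emeasure lebesgue (U \<inter> {x. \<phi> x \<noteq> 0}) = 0"
      by (auto simp: ess_supp_def)
    have "{x \<in> space lebesgue. \<phi> x \<noteq> 0} \<in> sets lebesgue" by measurable
    then have "U \<inter> {x. \<phi> x \<noteq> 0} \<in> null_sets lebesgue"
      using U(1,3) by (intro null_setsI) auto
    then have "AE y in lebesgue. y \<notin> U \<inter> {x. \<phi> x \<noteq> 0}" by (rule AE_not_in)
    then have "AE y in lebesgue. y \<in> U \<longrightarrow> \<phi> y = 0" by eventually_elim auto
    with U(1,2) show "\<exists>U. open U \<and> x \<in> U \<and> (AE y in lebesgue. y \<in> U \<longrightarrow> \<phi> y = 0)" by blast
  qed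
  then show ?thesis by simp
qed

lemma ess_supp_subset_closed:
  assumes "closed K" "AE x in lebesgue. x \<notin> K \<longrightarrow> \<phi> x = 0"
  shows "ess_supp \<phi> \<subseteq> K"
proof
  fix x assume x: "x \<in> ess_supp \<phi>"
  show "x \<in> K"
  proof (rule ccontr)
    assume "x \<notin> K"
    then have "emeasure lebesgue (- K \<inter> {x. \<phi> x \<noteq> 0}) > 0"
      using x assms(1) by (auto simp: ess_supp_def open_Compl)
    moreover have "emeasure lebesgue {x \<in> space lebesgue. x \<in> - K \<inter> {x. \<phi> x \<noteq> 0}} = 0"
      by (rule emeasure_eq_0_AE) (use assms(2) in \<open>eventually_elim, auto\<close>)
    moreover have "{x \<in> space lebesgue. x \<in> - K \<inter> {x. \<phi> x \<noteq> 0}} = - K \<inter> {x. \<phi> x \<noteq> 0}" by auto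
    ultimately show False by (simp only: less_irrefl)
  qed
qed

section \<open>Necessity\<close>

lemma L2_norm_mono:
  assumes "f \<in> L2_space" "g \<in> L2_space" "AE x in lebesgue. cmod (f x) \<le> cmod (g x)"
  shows "L2_norm f \<le> L2_norm g"
  unfolding L2_norm_def
proof (rule real_sqrt_le_mono, rule integral_mono_AE)
  show "AE x in lebesgue. (cmod (f x))\<^sup>2 \<le> (cmod (g x))\<^sup>2"
    using assms(3) by eventually_elim (auto intro: power_mono)
qed (use assms L2_integrable_sq in auto)

text \<open>The inverse transform is the transform conjugated by complex conjugation, hence bounded
  for integrable \<open>F\<close>. This produces the bounded test functions that the Bedrosian
  identity demands.\<close>

lemma has_fourier_L2_inverse_bounded:
  assumes "F \<in> L1_space" "F \<in> L2_space"
  obtains f where "has_fourier_L2 f F" "f \<in> Linf_space"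
proof -
  let ?F = "\<lambda>x. cnj (F x)"
  have F: "?F \<in> L1_space" "?F \<in> L2_space"
    using assms(1) L2_cnj[OF assms(2)] by (auto simp: L1_space_def)
  let ?f = "\<lambda>x. cnj (fourier_L1 ?F x)"
  have f: "has_fourier_L2 ?f F"
    by (rule has_fourier_L2_inversion[OF has_fourier_L2_L1[OF F]])
  have "cmod (?f x) \<le> (2 * pi) powr (- real CARD('a) / 2) * (LINT x|lebesgue. cmod (?F x))" for x
    by (subst complex_mod_cnj) (rule fourier_L1_bounded)
  then have "?f \<in> Linf_space"
    using L2_measurable[OF has_fourier_L2_space(1)[OF f]] unfolding Linf_space_def by auto
  with f that show ?thesis by blast
qed

lemma Linf_mult_L2:
  assumes "f \<in> Linf_space" "g \<in> L2_space"
  shows "(\<lambda>x. f x * g x) \<in> L2_space"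
proof -
  obtain C where "AE x in lebesgue. cmod (f x) \<le> C" "f \<in> borel_measurable lebesgue"
    using assms(1) by (auto simp: Linf_space_def)
  then show ?thesis using L2_mult_bounded[OF assms(2)] by blast
qed

lemma L2_mult_L1: "f \<in> L2_space \<Longrightarrow> g \<in> L2_space \<Longrightarrow> (\<lambda>x. f x * g x) \<in> L1_space"
  by (simp add: L1_space_def L2_mult_integrable)

lemma multiplier_L2:
  assumes T: "bounded_linear_L2 T"
    and m: "fourier_multiplier T m"
    and f: "has_fourier_L2 f F"
  shows "(\<lambda>\<xi>. m \<xi> * F \<xi>) \<in> L2_space" "has_fourier_L2 (T f) (\<lambda>\<xi>. m \<xi> * F \<xi>)"
proof -
  obtain G where G: "has_fourier_L2 (T f) G"
    using has_fourier_L2_exists[OF bounded_linear_L2_in[OF T has_fourier_L2_space(1)[OF f]]] .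
  show "has_fourier_L2 (T f) (\<lambda>\<xi>. m \<xi> * F \<xi>)"
    using m f G unfolding fourier_multiplier_def
    by (intro has_fourier_L2_cong_AE[OF G, where G = "\<lambda>\<xi>. m \<xi> * F \<xi>"]) auto
  then show "(\<lambda>\<xi>. m \<xi> * F \<xi>) \<in> L2_space" by (rule has_fourier_L2_space(2))
qed

text \<open>Vanishing almost everywhere off a closed set confines the essential support to that set,
  whichever representative \<open>fourier_L2\<close> picks. Hence the inverse transforms of
  \<open>F\<close> and \<open>G\<close> are admissible, and the convolution theorem translates the
  identity for them.\<close>

lemma bedrosian_multiplier_identity:
  fixes A B :: "(real ^ 'n) set"
  assumes T: "bounded_linear_L2 T" and bed: "bedrosian_identity T A B"
    and m: "fourier_multiplier T m"
    and F: "F \<in> L1_space" "F \<in> L2_space" "closed K" "K \<subseteq> A" "AE x in lebesgue. x \<notin> K \<longrightarrow> F x = 0"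
    and G: "G \<in> L1_space" "G \<in> L2_space" "closed L" "L \<subseteq> B" "AE x in lebesgue. x \<notin> L \<longrightarrow> G x = 0"
  shows "AE \<xi> in lebesgue. m \<xi> * (LINT \<eta>|lebesgue. F (\<xi> - \<eta>) * G \<eta>) = (LINT \<eta>|lebesgue. F (\<xi> - \<eta>) * (m \<eta> * G \<eta>))"
proof -
  obtain f where f: "has_fourier_L2 f F" "f \<in> Linf_space" using has_fourier_L2_inverse_bounded[OF F(1,2)] .
  obtain g where g: "has_fourier_L2 g G" "g \<in> Linf_space" using has_fourier_L2_inverse_bounded[OF G(1,2)] .
  have f2: "f \<in> L2_space" and g2: "g \<in> L2_space" using f g has_fourier_L2_space by blast+
  have supp: "ess_supp (fourier_L2 h) \<subseteq> M"
    if h: "has_fourier_L2 h H" and M: "closed M" "AE x in lebesgue. x \<notin> M \<longrightarrow> H x = 0" for h H and M :: "(real ^ 'n) set"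
  proof (rule ess_supp_subset_closed[OF M(1)])
    have "AE x in lebesgue. fourier_L2 h x = H x"
      by (rule has_fourier_L2_unique[OF has_fourier_L2_fourier_L2[OF has_fourier_L2_space(1)[OF h]] h]) simp
    with M(2) show "AE x in lebesgue. x \<notin> M \<longrightarrow> fourier_L2 h x = 0" by eventually_elim simp
  qed
  have eq: "AE x in lebesgue. T (\<lambda>y. f y * g y) x = f x * T g x"
    using bed f2 f(2) g2 g(2) supp[OF f(1) F(3,5)] supp[OF g(1) G(3,5)] F(4) G(4)
    unfolding bedrosian_identity_def by blast
  note Tg = multiplier_L2[OF T m g(1)]
  have fg: "has_fourier_L2 (\<lambda>x. f x * g x) (fourier_L1 (\<lambda>x. f x * g x))"
    by (intro has_fourier_L2_L1 L2_mult_L1 Linf_mult_L2 f2 g2 f)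
  have fTg: "has_fourier_L2 (\<lambda>x. f x * T g x) (fourier_L1 (\<lambda>x. f x * T g x))"
    by (intro has_fourier_L2_L1 L2_mult_L1 Linf_mult_L2 f2 f bounded_linear_L2_in[OF T] g2)
  note Tfg = multiplier_L2(2)[OF T m fg]
  have "AE \<xi> in lebesgue. m \<xi> * fourier_L1 (\<lambda>x. f x * g x) \<xi> = fourier_L1 (\<lambda>x. f x * T g x) \<xi>"
    by (rule has_fourier_L2_unique[OF Tfg fTg eq])
  then show ?thesis
    unfolding fourier_L1_product[OF f(1) g(1)] fourier_L1_product[OF f(1) Tg(2)]
    by eventually_elim (simp add: mult.left_commute[of "m _" "complex_of_real _"])
qed

text \<open>A substitute for the value of \<open>m\<close> at \<open>x\<close> that is insensitive
  to null sets. There is at most one such \<open>c\<close>, because a nonempty open set is not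
  null.\<close>

definition ae_const_near :: "('a::euclidean_space \<Rightarrow> complex) \<Rightarrow> 'a \<Rightarrow> complex \<Rightarrow> bool" where
  "ae_const_near m x c \<longleftrightarrow> (\<exists>U. open U \<and> x \<in> U \<and> (AE y in lebesgue. y \<in> U \<longrightarrow> m y = c))"

lemma ae_const_near_unique:
  assumes "ae_const_near m x c" "ae_const_near m x c'"
  shows "c = c'"
proof -
  obtain U V where UV: "open U" "x \<in> U" "AE y in lebesgue. y \<in> U \<longrightarrow> m y = c"
    "open V" "x \<in> V" "AE y in lebesgue. y \<in> V \<longrightarrow> m y = c'"
    using assms unfolding ae_const_near_def by blast
  have "AE y in lebesgue. y \<in> U \<inter> V \<longrightarrow> c = c'"
    using UV(3,6) by eventually_elim auto
  then show ?thesis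
    using AE_open_ex[of "U \<inter> V" "\<lambda>_. c = c'"] UV by blast
qed

text \<open>The points with local constant \<open>c\<close> and those with another local constant
  form disjoint open sets that cover \<open>S\<close>.\<close>

lemma ae_const_near_connected:
  assumes "connected S" and ex: "\<And>x. x \<in> S \<Longrightarrow> \<exists>c. ae_const_near m x c"
    and "x \<in> S" "ae_const_near m x c" "y \<in> S"
  shows "ae_const_near m y c"
proof (rule ccontr)
  assume ny: "\<not> ae_const_near m y c"
  have op: "open {x. \<exists>c\<in>X. ae_const_near m x c}" for X
  proof (subst open_subopen, intro ballI)
    fix z assume "z \<in> {x. \<exists>c\<in>X. ae_const_near m x c}"
    then obtain c U where "c \<in> X" "open U" "z \<in> U" "AE y in lebesgue. y \<in> U \<longrightarrow> m y = c"
      unfolding ae_const_near_def by blast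
    then show "\<exists>U. open U \<and> z \<in> U \<and> U \<subseteq> {x. \<exists>c\<in>X. ae_const_near m x c}"
      unfolding ae_const_near_def by blast
  qed
  let ?U = "{x. \<exists>c\<in>{c}. ae_const_near m x c}" and ?V = "{x. \<exists>c\<in>- {c}. ae_const_near m x c}"
  have "?U \<inter> S = {} \<or> ?V \<inter> S = {}"
  proof (rule connectedD[OF assms(1) op op])
    show "?U \<inter> ?V \<inter> S = {}" using ae_const_near_unique by blast
    show "S \<subseteq> ?U \<union> ?V" using ex by blast
  qed
  moreover have "x \<in> ?U \<inter> S" using assms by blast
  moreover have "y \<in> ?V \<inter> S" using assms(5) ex[OF assms(5)] ny by blast
  ultimately show False by blast
qed

lemma indicator_L1:
  fixes S :: "(real ^ 'n) set"
  assumes "bounded S" "S \<in> sets lebesgue"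
  shows "(indicator S :: real ^ 'n \<Rightarrow> complex) \<in> L1_space"
proof -
  have "(indicator S :: real ^ 'n \<Rightarrow> complex) = (\<lambda>x. indicator S x * indicator S x)"
    by (auto simp: indicator_def)
  then show ?thesis using L2_mult_L1[OF indicator_L2[OF assms] indicator_L2[OF assms]] by simp
qed

text \<open>
  Testing with an indicator \<open>F\<close> of a neighbourhood of \<open>a\<close> so large that \<open>F (\<xi> - \<eta>) = 1\<close> for \<open>\<xi>\<close>
  near \<open>a + b\<close> and \<open>\<eta>\<close> near \<open>b\<close> removes \<open>F\<close> from the identity: \<open>m \<xi> * \<integral>G = \<integral>m * G\<close> for all \<open>G\<close>
  concentrated near \<open>b\<close>.
\<close>

lemma bedrosian_multiplier_ae_const_near:
  fixes A B :: "(real ^ 'n) set"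
  assumes T: "bounded_linear_L2 T" and bed: "bedrosian_identity T A B"
    and m: "fourier_multiplier T m"
    and "open A" "open B" "a \<in> A" "b \<in> B"
  obtains c where "ae_const_near m (a + b) c" "ae_const_near m b c"
proof -
  obtain r1 where r1: "r1 > 0" "cball a r1 \<subseteq> A" using \<open>open A\<close> \<open>a \<in> A\<close> open_contains_cball by blast
  obtain r2 where r2: "r2 > 0" "cball b r2 \<subseteq> B" using \<open>open B\<close> \<open>b \<in> B\<close> open_contains_cball by blast
  \<comment> \<open>If \<open>\<xi>\<close> is within \<open>r\<close> of \<open>a + b\<close> and
    \<open>\<eta>\<close> within \<open>r\<close> of \<open>b\<close>, then
    \<open>\<xi> - \<eta>\<close> is within \<open>2 r\<close> of \<open>a\<close>; hence the halved
    \<open>r1\<close>. Closed balls serve as the closed sets that confine the supports.\<close>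
  define r where "r = min (r1 / 2) r2"
  have r: "r > 0" "cball a (2 * r) \<subseteq> A" "cball b r \<subseteq> B"
    using r1 r2 by (auto simp: r_def)
  define F :: "real ^ 'n \<Rightarrow> complex" where "F = indicator (cball a (2 * r))"
  define U where "U = ball (a + b) r"
  define V where "V = ball b r"
  have U: "open U" "a + b \<in> U" and V: "open V" "b \<in> V" using r(1) by (auto simp: U_def V_def)
  have F1: "F (\<xi> - \<eta>) = 1" if "\<xi> \<in> U" "\<eta> \<in> V" for \<xi> \<eta>
  proof -
    have "norm ((a + b - \<xi>) - (b - \<eta>)) \<le> norm (a + b - \<xi>) + norm (b - \<eta>)" by (rule norm_triangle_ineq4)
    then have "dist a (\<xi> - \<eta>) \<le> 2 * r" using that by (simp add: U_def V_def dist_norm algebra_simps)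
    then show ?thesis by (simp add: F_def)
  qed
  have F12: "F \<in> L1_space" "F \<in> L2_space" unfolding F_def by (auto intro!: indicator_L1 indicator_L2)
  have test: "AE \<xi> in lebesgue. \<xi> \<in> U \<longrightarrow> m \<xi> * (LINT \<eta>|lebesgue. G \<eta>) = (LINT \<eta>|lebesgue. m \<eta> * G \<eta>)"
    if G: "G \<in> L1_space" "G \<in> L2_space" and G0: "\<forall>\<eta>. \<eta> \<notin> V \<longrightarrow> G \<eta> = 0" for G
  proof -
    have "AE \<xi> in lebesgue. m \<xi> * (LINT \<eta>|lebesgue. F (\<xi> - \<eta>) * G \<eta>) = (LINT \<eta>|lebesgue. F (\<xi> - \<eta>) * (m \<eta> * G \<eta>))"
      using G0 by (intro bedrosian_multiplier_identity[OF T bed m F12 _ r(2) _ G _ r(3)])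
        (auto simp: F_def V_def)
    then show ?thesis
    proof eventually_elim
      case (elim \<xi>)
      show ?case
      proof
        assume "\<xi> \<in> U"
        then have "F (\<xi> - \<eta>) * G \<eta> = G \<eta>" "F (\<xi> - \<eta>) * (m \<eta> * G \<eta>) = m \<eta> * G \<eta>" for \<eta>
          using F1 G0 by (cases "\<eta> \<in> V"; simp)+
        with elim show "m \<xi> * (LINT \<eta>|lebesgue. G \<eta>) = (LINT \<eta>|lebesgue. m \<eta> * G \<eta>)" by simp
      qed
    qed
  qed
  define I :: "real ^ 'n \<Rightarrow> complex" where "I = indicator V"
  have I: "I \<in> L1_space" "I \<in> L2_space" "\<forall>\<eta>. \<eta> \<notin> V \<longrightarrow> I \<eta> = 0"
    unfolding I_def V_def by (auto intro!: indicator_L1 indicator_L2)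
  have "(LINT \<eta>|lebesgue. I \<eta>) = complex_of_real (measure lebesgue V)"
  proof -
    have "I = (\<lambda>\<eta>. complex_of_real (indicator V \<eta>))" by (auto simp: I_def indicator_def)
    then show ?thesis using V(1) by simp
  qed
  moreover have "measure lebesgue V > 0" unfolding V_def using content_ball_pos[OF r(1)] by simp
  ultimately have I0: "(LINT \<eta>|lebesgue. I \<eta>) \<noteq> 0" by simp
  \<comment> \<open>First test, with \<open>G\<close> the indicator of \<open>V\<close>: on
    \<open>U\<close> the multiplier must equal its average over \<open>V\<close>.\<close>
  define c where "c = (LINT \<eta>|lebesgue. m \<eta> * I \<eta>) / (LINT \<eta>|lebesgue. I \<eta>)"
  have cU: "AE \<xi> in lebesgue. \<xi> \<in> U \<longrightarrow> m \<xi> = c"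
    using test[OF I] by eventually_elim (use I0 in \<open>auto simp: c_def field_simps\<close>)
  \<comment> \<open>As \<open>I\<close> is itself a transform, \<open>T\<close> maps its inverse
    transform to a square integrable function, which makes \<open>m\<close> square integrable on
    \<open>V\<close>.\<close>
  obtain i where "has_fourier_L2 i I" using has_fourier_L2_inverse_exists[OF I(2)] .
  from multiplier_L2(1)[OF T m this] have mI: "(\<lambda>\<eta>. m \<eta> * I \<eta>) \<in> L2_space" .
  define D where "D \<eta> = m \<eta> * I \<eta> - c * I \<eta>" for \<eta>
  have D: "D \<in> L2_space" unfolding D_def by (intro L2_diff mI L2_cmult I)
  \<comment> \<open>Second test, with the conjugate of \<open>m - c\<close> on \<open>V\<close>:
    because \<open>m = c\<close> on \<open>U\<close>, the identity says that the integral of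
    \<open>(m - c) G\<close>, which is that of \<open>|D|^2\<close>, vanishes.\<close>
  define G where "G \<eta> = cnj (D \<eta>)" for \<eta>
  have G2: "G \<in> L2_space" unfolding G_def by (rule L2_cnj[OF D])
  have GI: "G = (\<lambda>\<eta>. G \<eta> * I \<eta>)" unfolding G_def D_def I_def by (auto simp: indicator_def)
  have G1: "G \<in> L1_space" by (subst GI) (rule L2_mult_L1[OF G2 I(2)])
  have G0: "\<forall>\<eta>. \<eta> \<notin> V \<longrightarrow> G \<eta> = 0" using I(3) by (simp add: G_def D_def)
  have mG: "(\<lambda>\<eta>. m \<eta> * G \<eta>) = (\<lambda>\<eta>. (m \<eta> * I \<eta>) * G \<eta>)"
    unfolding G_def D_def I_def by (auto simp: indicator_def)
  have "AE \<xi> in lebesgue. \<xi> \<in> U \<longrightarrow> c * (LINT \<eta>|lebesgue. G \<eta>) = (LINT \<eta>|lebesgue. m \<eta> * G \<eta>)"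
    using test[OF G1 G2 G0] cU by eventually_elim auto
  \<comment> \<open>The equation no longer involves \<open>\<xi>\<close>, so one point of the
    nonempty open \<open>U\<close> suffices.\<close>
  then have "c * (LINT \<eta>|lebesgue. G \<eta>) = (LINT \<eta>|lebesgue. m \<eta> * G \<eta>)"
    using AE_open_ex[of U "\<lambda>_. c * (LINT \<eta>|lebesgue. G \<eta>) = (LINT \<eta>|lebesgue. m \<eta> * G \<eta>)"] U by blast
  moreover have "integrable lebesgue (\<lambda>\<eta>. m \<eta> * G \<eta>)"
    unfolding mG by (rule L2_mult_integrable[OF mI G2])
  moreover have "integrable lebesgue G" using G1 by (simp add: L1_space_def)
  ultimately have "(LINT \<eta>|lebesgue. m \<eta> * G \<eta> - c * G \<eta>) = 0"
    by (simp only: Bochner_Integration.integral_diff integrable_mult_right integral_mult_right_zero diff_self)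
  moreover have "(\<lambda>\<eta>. m \<eta> * G \<eta> - c * G \<eta>) = (\<lambda>\<eta>. D \<eta> * cnj (D \<eta>))"
    unfolding G_def D_def I_def by (auto simp: indicator_def algebra_simps)
  ultimately have "L2_inner D D = 0" by (simp add: L2_inner_def)
  then have "AE \<eta> in lebesgue. D \<eta> = 0"
    using L2_norm_eq_0_iff[OF D] by (simp add: L2_inner_self)
  then have cV: "AE \<eta> in lebesgue. \<eta> \<in> V \<longrightarrow> m \<eta> = c"
    by eventually_elim (auto simp: D_def I_def)
  show ?thesis
    using that[of c] cU cV U V unfolding ae_const_near_def by blast
qed

lemma open_characteristic_set:
  fixes A B :: "(real ^ 'n) set"
  assumes "open A" "open B" "C \<in> components (A + B)"
  shows "open (characteristic_set A B C)"
proof -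
  have "A + B = (\<Union>x\<in>A. \<Union>y\<in>B. {x + y})" by (auto simp: set_plus_def)
  then have "open (A + B)" using open_sums assms by metis
  then show ?thesis
    using assms unfolding characteristic_set_def by (intro open_Un open_Union) (auto intro: open_components)
qed

lemma nontrivial_imp_constants:
  fixes A B :: "(real ^ 'n) set"
  assumes "open A" "A \<noteq> {}" "open B" "B \<noteq> {}"
    and T: "bounded_linear_L2 T" "translation_invariant_L2 T" "nontrivial_L2 T" "bedrosian_identity T A B"
  shows "\<exists>c :: (real ^ 'n) set \<Rightarrow> complex.
            (\<forall>C \<in> components (A + B). \<forall>C' \<in> components (A + B).
               characteristic_set A B C \<inter> characteristic_set A B C' \<noteq> {} \<longrightarrow> c C = c C') \<and>
            (\<forall>C \<in> components (A + B).
               emeasure lebesgue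
                 (- \<Union>{characteristic_set A B C' | C'.
                       C' \<in> components (A + B) \<and> c C' = c C}) > 0)"
proof -
  obtain m where m: "fourier_multiplier T m"
    using translation_invariant_multiplier[OF T(1,2)] .
  have near: "\<exists>c. ae_const_near m (a + b) c \<and> ae_const_near m b c" if "a \<in> A" "b \<in> B" for a b
    using bedrosian_multiplier_ae_const_near[OF T(1,4) m assms(1,3) that] by blast
  have "\<exists>c. \<forall>x\<in>characteristic_set A B C. ae_const_near m x c" if C: "C \<in> components (A + B)" for C
  proof -
    have Cn: "C \<noteq> {}" "connected C" "C \<subseteq> A + B"
      using in_components_nonempty[OF C] in_components_connected[OF C] in_components_subset[OF C] by auto
    have exC: "\<exists>c. ae_const_near m x c" if "x \<in> C" for x
    proof -
      have "x \<in> A + B" using that Cn(3) by blast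
      then obtain a b where "x = a + b" "a \<in> A" "b \<in> B" by (rule set_plus_elim)
      then show ?thesis using near by blast
    qed
    obtain x0 c where x0: "x0 \<in> C" "ae_const_near m x0 c" using Cn(1) exC by blast
    have onC: "ae_const_near m x c" if "x \<in> C" for x
      by (rule ae_const_near_connected[OF Cn(2) exC x0 that])
    \<comment> \<open>An adjoined component of \<open>B\<close> inherits the constant of
      \<open>C\<close>: for a fixed \<open>a \<in> A'\<close> the point \<open>a + x\<close> lies in
      \<open>C\<close>, and \<open>m\<close> has the same constant near \<open>x\<close> as near
      \<open>a + x\<close>.\<close>
    have "ae_const_near m x c" if B': "B' \<in> components B" "A' \<in> components A" "A' + B' \<subseteq> C" "x \<in> B'" for x A' B'
    proof -
      have "A' \<noteq> {}" "A' \<subseteq> A" "B' \<subseteq> B" "connected B'"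
        using in_components_nonempty[OF B'(2)] in_components_subset[OF B'(2)]
          in_components_subset[OF B'(1)] in_components_connected[OF B'(1)] by auto
      then obtain a where a: "a \<in> A'" "a \<in> A" by blast
      obtain c' where c': "ae_const_near m (a + x) c'" "ae_const_near m x c'"
        using near[of a x] a B'(4) \<open>B' \<subseteq> B\<close> by blast
      have "a + x \<in> C" using a B' by (auto simp: set_plus_def)
      then show ?thesis using ae_const_near_unique[OF onC c'(1)] c'(2) by simp
    qed
    then have "\<forall>x\<in>characteristic_set A B C. ae_const_near m x c"
      using onC unfolding characteristic_set_def by blast
    then show ?thesis ..
  qed
  then obtain c where c: "\<And>C x. C \<in> components (A + B) \<Longrightarrow> x \<in> characteristic_set A B C \<Longrightarrow> ae_const_near m x (c C)"
    by metis
  show ?thesis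
  proof (intro exI[of _ c] conjI ballI impI)
    fix C C' assume "C \<in> components (A + B)" "C' \<in> components (A + B)"
      "characteristic_set A B C \<inter> characteristic_set A B C' \<noteq> {}"
    then show "c C = c C'" using c ae_const_near_unique by blast
  next
    fix C assume C: "C \<in> components (A + B)"
    let ?E = "\<Union>{characteristic_set A B C' | C'. C' \<in> components (A + B) \<and> c C' = c C}"
    have E: "open ?E" using open_characteristic_set[OF assms(1,3)] by blast
    have mE: "AE x in lebesgue. x \<in> ?E \<longrightarrow> m x = c C"
    proof (rule AE_Lindelof)
      fix x assume "x \<in> ?E"
      then have "ae_const_near m x (c C)" using c by force
      then show "\<exists>U. open U \<and> x \<in> U \<and> (AE y in lebesgue. y \<in> U \<longrightarrow> m y = c C)" by (simp add: ae_const_near_def)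
    qed
    show "emeasure lebesgue (- ?E) > 0"
    proof (rule ccontr)
      assume "\<not> emeasure lebesgue (- ?E) > 0"
      moreover have "- ?E \<in> sets lebesgue" using E by (intro sets_completionI_sets) simp
      ultimately have "- ?E \<in> null_sets lebesgue" by (intro null_setsI) auto
      then have "AE x in lebesgue. x \<notin> - ?E" by (rule AE_not_in)
      \<comment> \<open>A null complement would make \<open>m\<close> a constant almost everywhere
        and hence \<open>T\<close> a multiple of the identity.\<close>
      with mE have mc: "AE x in lebesgue. m x = c C" by eventually_elim blast
      have "AE x in lebesgue. T f x = c C * f x" if f: "f \<in> L2_space" for f
      proof -
        note F = has_fourier_L2_fourier_L2[OF f]
        show ?thesis
          by (rule has_fourier_L2_inj[OF multiplier_L2(2)[OF T(1) m F] has_fourier_L2_cmult[OF F]])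
            (use mc in \<open>eventually_elim, simp\<close>)
      qed
      then show False using T(3) unfolding nontrivial_L2_def by blast
    qed
  qed
qed

section \<open>Sufficiency\<close>

text \<open>The projection onto the frequencies in \<open>E\<close>. The outer conjugations around
  \<open>fourier_L2\<close> form the inverse transform, as in
  \<open>has_fourier_L2_inversion\<close>.\<close>

definition indicator_multiplier ::
    "(real ^ 'n) set \<Rightarrow> (real ^ 'n \<Rightarrow> complex) \<Rightarrow> real ^ 'n \<Rightarrow> complex" where
  "indicator_multiplier E f = (\<lambda>x. cnj (fourier_L2 (\<lambda>\<xi>. cnj (indicator E \<xi> * fourier_L2 f \<xi>)) x))"

lemma indicator_mult_L2:
  assumes "E \<in> sets lebesgue" "F \<in> L2_space"
  shows "(\<lambda>\<xi>. indicator E \<xi> * F \<xi>) \<in> L2_space"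
  using assms by (intro L2_mult_bounded[where C = 1] borel_measurable_indicator) (auto simp: indicator_def)

lemma has_fourier_indicator_multiplier:
  assumes "E \<in> sets lebesgue" "has_fourier_L2 f F"
  shows "has_fourier_L2 (indicator_multiplier E f) (\<lambda>\<xi>. indicator E \<xi> * F \<xi>)"
proof -
  have f: "f \<in> L2_space" using has_fourier_L2_space(1)[OF assms(2)] .
  have "(\<lambda>\<xi>. cnj (indicator E \<xi> * fourier_L2 f \<xi>)) \<in> L2_space"
    by (intro L2_cnj indicator_mult_L2 assms has_fourier_L2_space(2)[OF has_fourier_L2_fourier_L2[OF f]])
  then have h: "has_fourier_L2 (indicator_multiplier E f) (\<lambda>\<xi>. indicator E \<xi> * fourier_L2 f \<xi>)"
    unfolding indicator_multiplier_def by (rule has_fourier_L2_inversion[OF has_fourier_L2_fourier_L2])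
  have "AE \<xi> in lebesgue. fourier_L2 f \<xi> = F \<xi>"
    by (rule has_fourier_L2_unique[OF has_fourier_L2_fourier_L2[OF f] assms(2)]) simp
  then have "AE \<xi> in lebesgue. indicator E \<xi> * fourier_L2 f \<xi> = indicator E \<xi> * F \<xi>"
    by eventually_elim simp
  from has_fourier_L2_cong_AE[OF h _ this] show ?thesis by simp
qed

text \<open>Each identity is evident for the transforms and is carried back by
  \<open>has_fourier_L2_inj\<close>; the norm bound 1 is Plancherel's theorem.\<close>

lemma bounded_linear_indicator_multiplier:
  assumes E: "E \<in> sets lebesgue"
  shows "bounded_linear_L2 (indicator_multiplier E)"
  unfolding bounded_linear_L2_def
proof (intro conjI ballI allI impI exI)
  note hT = has_fourier_indicator_multiplier[OF E]
  show "indicator_multiplier E f \<in> L2_space" if "f \<in> L2_space" for f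
    using has_fourier_L2_space(1)[OF hT[OF has_fourier_L2_fourier_L2[OF that]]] .
  fix f :: "real ^ 'a \<Rightarrow> complex" assume f: "f \<in> L2_space"
  note F = has_fourier_L2_fourier_L2[OF f]
  show "AE x in lebesgue. indicator_multiplier E (\<lambda>y. c * f y) x = c * indicator_multiplier E f x" for c
    by (rule has_fourier_L2_inj[OF hT[OF has_fourier_L2_cmult[OF F]] has_fourier_L2_cmult[OF hT[OF F]]]) simp
  have "L2_norm (indicator_multiplier E f) = L2_norm (\<lambda>\<xi>. indicator E \<xi> * fourier_L2 f \<xi>)"
    using has_fourier_L2_norm[OF hT[OF F]] by simp
  also have "\<dots> \<le> L2_norm (fourier_L2 f)"
    by (intro L2_norm_mono indicator_mult_L2 E has_fourier_L2_space(2)[OF F]) (auto simp: indicator_def)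
  finally show "L2_norm (indicator_multiplier E f) \<le> 1 * L2_norm f"
    using has_fourier_L2_norm[OF F] by simp
  fix g :: "real ^ 'a \<Rightarrow> complex" assume g: "g \<in> L2_space"
  note G = has_fourier_L2_fourier_L2[OF g]
  show "AE x in lebesgue. indicator_multiplier E (\<lambda>y. f y + g y) x = indicator_multiplier E f x + indicator_multiplier E g x"
    by (rule has_fourier_L2_inj[OF hT[OF has_fourier_L2_add[OF F G]] has_fourier_L2_add[OF hT[OF F] hT[OF G]]])
      (simp add: distrib_left)
  assume "AE x in lebesgue. f x = g x"
  from has_fourier_L2_unique[OF F G this]
  have "AE \<xi> in lebesgue. indicator E \<xi> * fourier_L2 f \<xi> = indicator E \<xi> * fourier_L2 g \<xi>" by eventually_elim simp
  then show "AE x in lebesgue. indicator_multiplier E f x = indicator_multiplier E g x"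
    by (rule has_fourier_L2_inj[OF hT[OF F] hT[OF G]])
qed

lemma translation_invariant_indicator_multiplier:
  assumes E: "E \<in> sets lebesgue"
  shows "translation_invariant_L2 (indicator_multiplier E)"
  unfolding translation_invariant_L2_def
proof (intro allI ballI)
  fix a :: "real ^ 'a" and f :: "real ^ 'a \<Rightarrow> complex" assume f: "f \<in> L2_space"
  note hT = has_fourier_indicator_multiplier[OF E]
  note F = has_fourier_L2_fourier_L2[OF f]
  show "AE y in lebesgue. indicator_multiplier E (\<lambda>z. f (z - a)) y = indicator_multiplier E f (y - a)"
    by (rule has_fourier_L2_inj[OF hT[OF has_fourier_L2_translate[OF F]] has_fourier_L2_translate[OF hT[OF F]]])
      (simp add: mult.left_commute)
qed

text \<open>Evaluated at the Gaussian, triviality makes the indicator of \<open>E\<close> constant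
  almost everywhere. The constant is 1 because \<open>E\<close> is open and nonempty, contradicting
  the positive measure of the complement.\<close>

lemma nontrivial_indicator_multiplier:
  fixes E :: "(real ^ 'n) set"
  assumes E: "open E" "E \<noteq> {}" "emeasure lebesgue (- E) > 0"
  shows "nontrivial_L2 (indicator_multiplier E)"
  unfolding nontrivial_L2_def
proof
  assume "\<exists>c. \<forall>f\<in>L2_space. AE x in lebesgue. indicator_multiplier E f x = c * f x"
  then obtain c where c: "\<And>f. f \<in> L2_space \<Longrightarrow> AE x in lebesgue. indicator_multiplier E f x = c * f x" by blast
  let ?g = "gaussian 1 :: real ^ 'n \<Rightarrow> complex"
  have Em: "E \<in> sets lebesgue" using E(1) by simp
  have g1: "?g \<in> L1_space" and g2: "?g \<in> L2_space" by (auto intro: gaussian_L1 gaussian_L2)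
  have gF: "has_fourier_L2 ?g ?g"
    using has_fourier_L2_L1[OF g1 g2] by (simp add: fourier_L1_gaussian)
  have "AE \<xi> in lebesgue. indicator E \<xi> * ?g \<xi> = c * ?g \<xi>"
    by (rule has_fourier_L2_unique[OF has_fourier_indicator_multiplier[OF Em gF] has_fourier_L2_cmult[OF gF] c[OF g2]])
  then have ind: "AE \<xi> in lebesgue. indicator E \<xi> = c" by eventually_elim simp
  then have "AE \<xi> in lebesgue. \<xi> \<in> E \<longrightarrow> c = 1" by eventually_elim auto
  then have "c = 1" using AE_open_ex[of E "\<lambda>_. c = 1"] E by blast
  from ind have "AE \<xi> in lebesgue. \<xi> \<notin> - E"
    by eventually_elim (use \<open>c = 1\<close> in \<open>auto simp: indicator_def split: if_splits\<close>)
  then have "emeasure lebesgue {\<xi> \<in> space lebesgue. \<xi> \<in> - E} = 0" by (rule emeasure_eq_0_AE)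
  moreover have "{\<xi> \<in> space lebesgue. \<xi> \<in> - E} = - E" by auto
  ultimately show False using E(3) by simp
qed

text \<open>In the convolution at \<open>\<xi>\<close> only \<open>\<eta> \<in> B\<close> with
  \<open>\<xi> - \<eta> \<in> A\<close> contribute. For these \<open>compat\<close>, applied to
  \<open>(\<xi> - \<eta>) + \<eta>\<close>, lets the indicator at \<open>\<xi>\<close> pass under
  the integral as the indicator at \<open>\<eta>\<close>.\<close>

lemma bedrosian_indicator_multiplier:
  fixes A B E :: "(real ^ 'n) set"
  assumes E: "E \<in> sets lebesgue"
    and compat: "\<And>a b. a \<in> A \<Longrightarrow> b \<in> B \<Longrightarrow> a + b \<in> E \<longleftrightarrow> b \<in> E"
  shows "bedrosian_identity (indicator_multiplier E) A B"
  unfolding bedrosian_identity_def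
proof (intro ballI impI, elim IntE conjE)
  fix f g :: "real ^ 'n \<Rightarrow> complex"
  assume f: "f \<in> L2_space" "f \<in> Linf_space" and g: "g \<in> L2_space" "g \<in> Linf_space"
    and sf: "ess_supp (fourier_L2 f) \<subseteq> A" and sg: "ess_supp (fourier_L2 g) \<subseteq> B"
  note hT = has_fourier_indicator_multiplier[OF E]
  note F = has_fourier_L2_fourier_L2[OF f(1)] and G = has_fourier_L2_fourier_L2[OF g(1)]
  let ?F = "fourier_L2 f" and ?G = "fourier_L2 g"
  have F0: "AE x in lebesgue. x \<notin> A \<longrightarrow> ?F x = 0"
    using AE_zero_outside_ess_supp[OF L2_measurable[OF has_fourier_L2_space(2)[OF F]]]
    by eventually_elim (use sf in blast)
  have G0: "AE x in lebesgue. x \<notin> B \<longrightarrow> ?G x = 0"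
    using AE_zero_outside_ess_supp[OF L2_measurable[OF has_fourier_L2_space(2)[OF G]]]
    by eventually_elim (use sg in blast)
  have fg: "has_fourier_L2 (\<lambda>x. f x * g x) (fourier_L1 (\<lambda>x. f x * g x))"
    by (intro has_fourier_L2_L1 L2_mult_L1 Linf_mult_L2 f g)
  have Tg: "indicator_multiplier E g \<in> L2_space" using has_fourier_L2_space(1)[OF hT[OF G]] .
  have fTg: "has_fourier_L2 (\<lambda>x. f x * indicator_multiplier E g x) (fourier_L1 (\<lambda>x. f x * indicator_multiplier E g x))"
    by (intro has_fourier_L2_L1 L2_mult_L1 Linf_mult_L2 f Tg)
  have "indicator E \<xi> * fourier_L1 (\<lambda>x. f x * g x) \<xi> = fourier_L1 (\<lambda>x. f x * indicator_multiplier E g x) \<xi>" for \<xi>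
  proof -
    have m: "(\<lambda>\<eta>. H (\<xi> - \<eta>)) \<in> borel_measurable lebesgue" if "H \<in> L2_space" for H :: "real ^ 'n \<Rightarrow> complex"
      using L2_measurable[OF L2_unit_affine(1)[OF _ that, of "-1" \<xi>]] by simp
    note Fm = m[OF has_fourier_L2_space(2)[OF F]]
    have "AE \<eta> in lebesgue. \<xi> - \<eta> \<notin> A \<longrightarrow> ?F (\<xi> - \<eta>) = 0"
      using lebesgue_AE_unit_affine[OF _ F0, of "-1" \<xi>] by simp
    with G0 have "AE \<eta> in lebesgue. indicator E \<xi> * (?F (\<xi> - \<eta>) * ?G \<eta>) = ?F (\<xi> - \<eta>) * (indicator E \<eta> * ?G \<eta>)"
    proof eventually_elim
      case (elim \<eta>)
      have "\<xi> \<in> E \<longleftrightarrow> \<eta> \<in> E" if "\<xi> - \<eta> \<in> A" "\<eta> \<in> B" using compat[OF that] by simp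
      then show ?case using elim by (auto simp: indicator_def)
    qed
    then have "(LINT \<eta>|lebesgue. indicator E \<xi> * (?F (\<xi> - \<eta>) * ?G \<eta>)) = (LINT \<eta>|lebesgue. ?F (\<xi> - \<eta>) * (indicator E \<eta> * ?G \<eta>))"
      by (intro integral_cong_AE borel_measurable_times borel_measurable_const Fm L2_measurable
          indicator_mult_L2 E has_fourier_L2_space(2)[OF G])
    then have eqI: "indicator E \<xi> * (LINT \<eta>|lebesgue. ?F (\<xi> - \<eta>) * ?G \<eta>) = (LINT \<eta>|lebesgue. ?F (\<xi> - \<eta>) * (indicator E \<eta> * ?G \<eta>))"
      by simp
    show ?thesis
      unfolding fourier_L1_product[OF F G] fourier_L1_product[OF F hT[OF G]]
      by (simp only: mult.left_commute[of "indicator E \<xi>"] eqI)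
  qed
  then show "AE x in lebesgue. indicator_multiplier E (\<lambda>y. f y * g y) x = f x * indicator_multiplier E g x"
    by (intro has_fourier_L2_inj[OF hT[OF fg] fTg]) simp
qed

lemma connected_set_plus:
  fixes S S' :: "'a::real_normed_vector set"
  assumes "connected S" "connected S'"
  shows "connected (S + S')"
proof -
  have "S + S' = (\<lambda>(x, y). x + y) ` (S \<times> S')" by (auto simp: set_plus_def)
  moreover have "continuous_on (S \<times> S') (\<lambda>(x, y). x + y)"
    by (auto simp: case_prod_beta intro!: continuous_intros)
  ultimately show ?thesis using connected_continuous_image connected_Times[OF assms] by metis
qed

text \<open>The sum of the components of \<open>a\<close> and \<open>b\<close> is connected and
  meets the component \<open>C\<close> of \<open>a + b\<close>, so it lies in \<open>C\<close>, and
  the component of \<open>b\<close> is one of those adjoined to \<open>C\<close>. This is the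
  property for which characteristic sets are made.\<close>

lemma sum_in_characteristic_set:
  fixes A B :: "(real ^ 'n) set"
  assumes "a \<in> A" "b \<in> B"
  obtains C where "C \<in> components (A + B)" "a + b \<in> characteristic_set A B C" "b \<in> characteristic_set A B C"
proof -
  have ab: "a + b \<in> A + B" using assms by (auto simp: set_plus_def)
  obtain C where C: "C \<in> components (A + B)" "a + b \<in> C" using ab Union_components by blast
  obtain A' where A': "A' \<in> components A" "a \<in> A'" using assms(1) Union_components by blast
  obtain B' where B': "B' \<in> components B" "b \<in> B'" using assms(2) Union_components by blast
  have "A' + B' \<subseteq> C"
  proof (rule components_maximal[OF C(1)])
    show "connected (A' + B')"
      using A' B' in_components_connected by (blast intro: connected_set_plus)
    show "A' + B' \<subseteq> A + B"
      using in_components_subset[OF A'(1)] in_components_subset[OF B'(1)] by (rule set_plus_mono2)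
    show "C \<inter> (A' + B') \<noteq> {}" using C(2) A'(2) B'(2) by (auto simp: set_plus_def)
  qed
  then have "b \<in> characteristic_set A B C"
    using A' B' unfolding characteristic_set_def by blast
  moreover have "a + b \<in> characteristic_set A B C" using C by (simp add: characteristic_set_def)
  ultimately show ?thesis using that C(1) by blast
qed

lemma constants_imp_nontrivial:
  fixes A B :: "(real ^ 'n) set"
  assumes "open A" "A \<noteq> {}" "open B" "B \<noteq> {}"
    and c: "\<And>C C'. C \<in> components (A + B) \<Longrightarrow> C' \<in> components (A + B) \<Longrightarrow>
      characteristic_set A B C \<inter> characteristic_set A B C' \<noteq> {} \<Longrightarrow> c C = c C'"
    and pos: "\<And>C. C \<in> components (A + B) \<Longrightarrow>
      emeasure lebesgue (- \<Union>{characteristic_set A B C' | C'. C' \<in> components (A + B) \<and> c C' = c C}) > 0"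
  shows "\<exists>T. bounded_linear_L2 T \<and> translation_invariant_L2 T \<and> nontrivial_L2 T \<and> bedrosian_identity T A B"
proof -
  \<comment> \<open>A component actually met by the construction, so that \<open>E\<close> is
    nonempty; an empty \<open>E\<close> would give the zero operator, which is trivial.\<close>
  obtain a b where "a \<in> A" "b \<in> B" using assms by blast
  then obtain C0 where C0: "C0 \<in> components (A + B)" "b \<in> characteristic_set A B C0"
    using sum_in_characteristic_set by metis
  define E where "E = \<Union>{characteristic_set A B C' | C'. C' \<in> components (A + B) \<and> c C' = c C0}"
  have E: "open E" "E \<noteq> {}" "emeasure lebesgue (- E) > 0"
    using open_characteristic_set[OF assms(1,3)] C0 pos[OF C0(1)] unfolding E_def by blast+
  have Em: "E \<in> sets lebesgue" using E(1) by simp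
  have iff: "x \<in> E \<longleftrightarrow> c C = c C0" if "C \<in> components (A + B)" "x \<in> characteristic_set A B C" for C x
  proof
    assume "x \<in> E"
    then obtain C' where C': "C' \<in> components (A + B)" "c C' = c C0" "x \<in> characteristic_set A B C'"
      unfolding E_def by blast
    then show "c C = c C0" using c[OF that(1) C'(1)] that(2) by auto
  next
    assume "c C = c C0"
    then show "x \<in> E" using that unfolding E_def by blast
  qed
  have "a + b \<in> E \<longleftrightarrow> b \<in> E" if ab: "a \<in> A" "b \<in> B" for a b
  proof -
    obtain C where "C \<in> components (A + B)" "a + b \<in> characteristic_set A B C" "b \<in> characteristic_set A B C"
      using sum_in_characteristic_set[OF ab] .
    then show ?thesis using iff by simp
  qed
  then have "bedrosian_identity (indicator_multiplier E) A B"
    by (rule bedrosian_indicator_multiplier[OF Em])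
  then show ?thesis
    using bounded_linear_indicator_multiplier[OF Em] translation_invariant_indicator_multiplier[OF Em]
      nontrivial_indicator_multiplier[OF E] by blast
qed

theorem corollary1p4:
  fixes A B :: "(real ^ 'n) set"
  assumes "open A" and "A \<noteq> {}" and "open B" and "B \<noteq> {}"
  shows "(\<exists>T. bounded_linear_L2 T \<and> translation_invariant_L2 T \<and> nontrivial_L2 T \<and>
            bedrosian_identity T A B) \<longleftrightarrow>
         (\<exists>c :: (real ^ 'n) set \<Rightarrow> complex.
            (\<forall>C \<in> components (A + B). \<forall>C' \<in> components (A + B).
               characteristic_set A B C \<inter> characteristic_set A B C' \<noteq> {} \<longrightarrow> c C = c C') \<and>
            (\<forall>C \<in> components (A + B).
               emeasure lebesgue
                 (- \<Union>{characteristic_set A B C' | C'.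
                       C' \<in> components (A + B) \<and> c C' = c C}) > 0))"
proof
  assume "\<exists>T. bounded_linear_L2 T \<and> translation_invariant_L2 T \<and> nontrivial_L2 T \<and> bedrosian_identity T A B"
  then obtain T where "bounded_linear_L2 T" "translation_invariant_L2 T" "nontrivial_L2 T" "bedrosian_identity T A B"
    by blast
  then show "\<exists>c :: (real ^ 'n) set \<Rightarrow> complex.
            (\<forall>C \<in> components (A + B). \<forall>C' \<in> components (A + B).
               characteristic_set A B C \<inter> characteristic_set A B C' \<noteq> {} \<longrightarrow> c C = c C') \<and>
            (\<forall>C \<in> components (A + B).
               emeasure lebesgue
                 (- \<Union>{characteristic_set A B C' | C'.
                       C' \<in> components (A + B) \<and> c C' = c C}) > 0)"
    by (rule nontrivial_imp_constants[OF assms])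
next
  assume "\<exists>c :: (real ^ 'n) set \<Rightarrow> complex.
            (\<forall>C \<in> components (A + B). \<forall>C' \<in> components (A + B).
               characteristic_set A B C \<inter> characteristic_set A B C' \<noteq> {} \<longrightarrow> c C = c C') \<and>
            (\<forall>C \<in> components (A + B).
               emeasure lebesgue
                 (- \<Union>{characteristic_set A B C' | C'.
                       C' \<in> components (A + B) \<and> c C' = c C}) > 0)"
  then obtain c :: "(real ^ 'n) set \<Rightarrow> complex" where
    "\<forall>C \<in> components (A + B). \<forall>C' \<in> components (A + B).
       characteristic_set A B C \<inter> characteristic_set A B C' \<noteq> {} \<longrightarrow> c C = c C'"
    "\<forall>C \<in> components (A + B). emeasure lebesgue
       (- \<Union>{characteristic_set A B C' | C'. C' \<in> components (A + B) \<and> c C' = c C}) > 0"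
    by (elim exE conjE)
  then show "\<exists>T. bounded_linear_L2 T \<and> translation_invariant_L2 T \<and> nontrivial_L2 T \<and> bedrosian_identity T A B"
    by (intro constants_imp_nontrivial[OF assms, of c]) blast+
qed

end
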